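(* Let $n\geqslant 2$ and let $M=(\alpha_{i,j})_{1\leqslant i,j\leqslant 2}$ be a Griffiths positive $2\times 2$ matrix of constant coefficient $(1,1)$-forms on $\mathbb{C}^n$ with only diagonalized entries. Let $\Omega=\det(M)$. Then: (1) if $n\leqslant 5$, then for every Kähler form $\omega$, $\Omega$ satisfies HLT, HRR and LD (with respect to $\omega$) for all bidegrees $(p,q)$ with $p,q\geqslant0$, $p+q=n-2$; (2) if $n\geqslant 6$, then $\Omega$ satisfies HLT for the bidegrees $(n-2,0)$, $(n-3,1)$, $(1,n-3)$ and $(0,n-2)$.
   Context: Let $V=(\mathbb{C}^n)^*$ and $V^{p,q}=\Lambda^pV\otimes\Lambda^q\overline{V}$ be the space of constant coefficient $(p,q)$-forms on $\mathbb{C}^n$ (zero unless $0\leqslant p,q\leqslant n$). A form in $V^{1,1}$ is Kähler if it equals $\sum_{l}\frac{\sqrt{-1}}{2}dw_l\wedge d\overline{w_l}$ in some complex linear coordinates $(w_l)$. A $k\times k$ matrix $M=(\alpha_{i,j})$ of elements of $V^{1,1}$ with $\alpha_{i,j}=\overline{\alpha_{j,i}}$ is Griffiths positive if $\sum_{i,j}\theta_i\alpha_{i,j}\overline{\theta_j}$ is Kähler for all $\theta\in\mathbb{C}^k\setminus\{0\}$. $M$ has diagonalized entries if there are complex linear coordinates $(z_1,\dots,z_n)$ with $\alpha_{i,j}=\sum_{l=1}^n b_{i,j}^{(l)}\frac{\sqrt{-1}}{2}dz_l\wedge d\overline{z_l}$ for all $i,j$ (no terms $dz_u\wedge d\overline{z_v}$,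 $u\neq v$). $\det(M)=\sum_{\sigma\in S_k}\mathrm{sgn}(\sigma)\alpha_{1,\sigma(1)}\wedge\dots\wedge\alpha_{k,\sigma(k)}\in V^{k,k}$. For a Kähler form $\omega$, define $\star:V^{n,n}\to\mathbb{C}$ by $\eta=\star(\eta)\,\omega^n/n!$. For $\Omega\in V^{k,k}$ and $p+q=n-k$: HLT for $(p,q)$ means $\alpha\mapsto\alpha\wedge\Omega$ is an isomorphism $V^{p,q}\to V^{n-q,n-p}$; with $Q(\alpha,\beta)=(\sqrt{-1})^{p-q}(-1)^{\frac{(p+q)(p+q-1)}{2}}\star(\alpha\wedge\overline{\beta}\wedge\Omega)$ and $P^{p,q}=\{\alpha\in V^{p,q}:\alpha\wedge\Omega\wedge\omega=0\}$, HRR means $Q$ is positive definite on $P^{p,q}$, and LD means $V^{p,q}=(\omega\wedge V^{p-1,q-1})\oplus P^{p,q}$ with the summands $Q$-orthogonal. *)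

theory Defs
  imports Complex_Main "HOL-Combinatorics.Permutations"
begin

text \<open>Constant coefficient forms on C^n.  The exterior algebra over C is generated by
  dz_0..dz_(n-1) (generator index k) and dzbar_0..dzbar_(n-1) (generator index n+k).
  A form is given by its coefficients on the basis e_S (S a finite set of generator
  indices, wedge of the generators in increasing order); S ranges over subsets of
  {0..<2n}.  So dz_I wedge dzbar_J is e_(I union (n+J)).\<close>

type_synonym form = "nat set \<Rightarrow> complex"

definition zero_form :: form where "zero_form = (\<lambda>S. 0)"
definition fadd :: "form \<Rightarrow> form \<Rightarrow> form" where "fadd f g = (\<lambda>S. f S + g S)"
definition fscale :: "complex \<Rightarrow> form \<Rightarrow> form" where "fscale c f = (\<lambda>S. c * f S)"
definition fsum :: "('a \<Rightarrow> form) \<Rightarrow> 'a set \<Rightarrow> form" where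
  "fsum F A = (\<lambda>S. \<Sum>a\<in>A. F a S)"

definition shuffle_sign :: "nat set \<Rightarrow> nat set \<Rightarrow> complex" where
  "shuffle_sign S T = (-1) ^ card {(s,t). s \<in> S \<and> t \<in> T \<and> t < s}"

definition wedge :: "form \<Rightarrow> form \<Rightarrow> form" where
  "wedge f g = (\<lambda>U. \<Sum>S\<in>Pow U. shuffle_sign S (U - S) * f S * g (U - S))"

definition unit_form :: form where "unit_form = (\<lambda>S. if S = {} then 1 else 0)"

definition wedge_list :: "form list \<Rightarrow> form" where
  "wedge_list fs = foldr wedge fs unit_form"

definition wpow :: "form \<Rightarrow> nat \<Rightarrow> form" where
  "wpow f m = wedge_list (replicate m f)"

definition dz :: "nat \<Rightarrow> form" where "dz k = (\<lambda>S. if S = {k} then 1 else 0)"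

text \<open>Complex conjugation: conj(c dz_I wedge dzbar_J) = conj c dzbar_I wedge dz_J
   = conj c (-1)^(|I||J|) dz_J wedge dzbar_I.\<close>
definition swap_gen :: "nat \<Rightarrow> nat \<Rightarrow> nat" where
  "swap_gen n k = (if k < n then k + n else k - n)"

definition conjf :: "nat \<Rightarrow> form \<Rightarrow> form" where
  "conjf n f = (\<lambda>U. if U \<subseteq> {0..<2*n}
      then cnj (f (swap_gen n ` U)) * (-1) ^ (card (U \<inter> {..<n}) * card (U \<inter> {n..<2*n}))
      else 0)"

text \<open>V^{p,q} (zero space if p or q is negative or exceeds n).\<close>
definition Vpq :: "nat \<Rightarrow> int \<Rightarrow> int \<Rightarrow> form set" where
  "Vpq n p q = {f. \<forall>S. f S \<noteq> 0 \<longrightarrow> S \<subseteq> {0..<2*n} \<and>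
      int (card (S \<inter> {..<n})) = p \<and> int (card (S \<inter> {n..<2*n})) = q}"

definition invertible_mat :: "nat \<Rightarrow> (nat \<Rightarrow> nat \<Rightarrow> complex) \<Rightarrow> bool" where
  "invertible_mat n A \<longleftrightarrow> (\<exists>B. \<forall>i<n. \<forall>j<n.
      (\<Sum>k<n. A i k * B k j) = (if i = j then 1 else 0) \<and>
      (\<Sum>k<n. B i k * A k j) = (if i = j then 1 else 0))"

text \<open>dw_l for the coordinates w = A z.\<close>
definition oneform :: "nat \<Rightarrow> (nat \<Rightarrow> nat \<Rightarrow> complex) \<Rightarrow> nat \<Rightarrow> form" where
  "oneform n A l = fsum (\<lambda>k. fscale (A l k) (dz k)) {..<n}"

definition kahler_term :: "nat \<Rightarrow> (nat \<Rightarrow> nat \<Rightarrow> complex) \<Rightarrow> nat \<Rightarrow> form" where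
  "kahler_term n A l = fscale (\<i> / 2) (wedge (oneform n A l) (conjf n (oneform n A l)))"

definition kahler :: "nat \<Rightarrow> form \<Rightarrow> bool" where
  "kahler n \<omega> \<longleftrightarrow> (\<exists>A. invertible_mat n A \<and> \<omega> = fsum (kahler_term n A) {..<n})"

definition hermitian_form_matrix :: "nat \<Rightarrow> nat \<Rightarrow> (nat \<Rightarrow> nat \<Rightarrow> form) \<Rightarrow> bool" where
  "hermitian_form_matrix n k M \<longleftrightarrow> (\<forall>i<k. \<forall>j<k. M i j \<in> Vpq n 1 1 \<and> M i j = conjf n (M j i))"

definition griffiths_positive :: "nat \<Rightarrow> nat \<Rightarrow> (nat \<Rightarrow> nat \<Rightarrow> form) \<Rightarrow> bool" where
  "griffiths_positive n k M \<longleftrightarrow> hermitian_form_matrix n k M \<and>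
     (\<forall>\<theta> :: nat \<Rightarrow> complex. (\<exists>i<k. \<theta> i \<noteq> 0) \<longrightarrow>
        kahler n (fsum (\<lambda>(i,j). fscale (\<theta> i * cnj (\<theta> j)) (M i j)) ({..<k} \<times> {..<k})))"

definition diagonalized_entries :: "nat \<Rightarrow> nat \<Rightarrow> (nat \<Rightarrow> nat \<Rightarrow> form) \<Rightarrow> bool" where
  "diagonalized_entries n k M \<longleftrightarrow> (\<exists>A b. invertible_mat n A \<and>
     (\<forall>i<k. \<forall>j<k. M i j = fsum (\<lambda>l. fscale (b i j l) (kahler_term n A l)) {..<n}))"

definition det_forms :: "nat \<Rightarrow> (nat \<Rightarrow> nat \<Rightarrow> form) \<Rightarrow> form" where
  "det_forms k M = fsum (\<lambda>\<sigma>. fscale (of_int (sign \<sigma>)) (wedge_list (map (\<lambda>i. M i (\<sigma> i)) [0..<k])))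
      {\<sigma>. \<sigma> permutes {..<k}}"

text \<open>star: eta = star(eta) omega^n/n!  for eta in V^{n,n}.\<close>
definition star :: "nat \<Rightarrow> form \<Rightarrow> form \<Rightarrow> complex" where
  "star n \<omega> \<eta> = \<eta> {0..<2*n} / (wpow \<omega> n {0..<2*n} / of_nat (fact n))"

definition HLT :: "nat \<Rightarrow> form \<Rightarrow> nat \<Rightarrow> nat \<Rightarrow> bool" where
  "HLT n \<Omega> p q \<longleftrightarrow>
     bij_betw (\<lambda>\<alpha>. wedge \<alpha> \<Omega>) (Vpq n (int p) (int q)) (Vpq n (int n - int q) (int n - int p))"

definition Qform :: "nat \<Rightarrow> form \<Rightarrow> form \<Rightarrow> nat \<Rightarrow> nat \<Rightarrow> form \<Rightarrow> form \<Rightarrow> complex" where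
  "Qform n \<Omega> \<omega> p q \<alpha> \<beta> = \<i> powi (int p - int q) * (-1) ^ ((p + q) * (p + q - 1) div 2)
      * star n \<omega> (wedge (wedge \<alpha> (conjf n \<beta>)) \<Omega>)"

definition primitive :: "nat \<Rightarrow> form \<Rightarrow> form \<Rightarrow> nat \<Rightarrow> nat \<Rightarrow> form set" where
  "primitive n \<Omega> \<omega> p q = {\<alpha> \<in> Vpq n (int p) (int q). wedge (wedge \<alpha> \<Omega>) \<omega> = zero_form}"

definition HRR :: "nat \<Rightarrow> form \<Rightarrow> form \<Rightarrow> nat \<Rightarrow> nat \<Rightarrow> bool" where
  "HRR n \<Omega> \<omega> p q \<longleftrightarrow> (\<forall>\<alpha> \<in> primitive n \<Omega> \<omega> p q. \<alpha> \<noteq> zero_form \<longrightarrow>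
      Qform n \<Omega> \<omega> p q \<alpha> \<alpha> \<in> \<real> \<and> Re (Qform n \<Omega> \<omega> p q \<alpha> \<alpha>) > 0)"

definition lef_image :: "nat \<Rightarrow> form \<Rightarrow> nat \<Rightarrow> nat \<Rightarrow> form set" where
  "lef_image n \<omega> p q = {wedge \<omega> \<beta> | \<beta>. \<beta> \<in> Vpq n (int p - 1) (int q - 1)}"

definition LD :: "nat \<Rightarrow> form \<Rightarrow> form \<Rightarrow> nat \<Rightarrow> nat \<Rightarrow> bool" where
  "LD n \<Omega> \<omega> p q \<longleftrightarrow>
     Vpq n (int p) (int q) = {fadd a b | a b. a \<in> lef_image n \<omega> p q \<and> b \<in> primitive n \<Omega> \<omega> p q}
   \<and> lef_image n \<omega> p q \<inter> primitive n \<Omega> \<omega> p q = {zero_form}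
   \<and> (\<forall>a \<in> lef_image n \<omega> p q. \<forall>b \<in> primitive n \<Omega> \<omega> p q.
        Qform n \<Omega> \<omega> p q a b = 0 \<and> Qform n \<Omega> \<omega> p q b a = 0)"

end

theory Submission
  imports Defs
begin

text \<open>In coordinates diagonalizing the entries, \<open>\<Omega>\<close> is the sum of \<open>D\<^sub>l\<^sub>m \<omega>\<^sub>l \<omega>\<^sub>m\<close> over \<open>l < m\<close>, where \<open>D\<^sub>l\<^sub>m > 0\<close> is
  the mixed discriminant of the positive definite coefficient matrices at \<open>l\<close> and \<open>m\<close>. All bidegrees in
  question satisfy \<open>min p q \<le> 1\<close>. The monomials \<open>\<theta>\<^sub>X \<theta>bar\<^sub>Y \<omega>\<^sub>K\<close> with \<open>X, Y, K\<close> disjoint span \<open>V\<^sup>p\<^sup>,\<^sup>q\<close>, and \<open>Q\<close>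
  only pairs monomials with the same \<open>(X, Y)\<close>. Blocks with \<open>K = {}\<close> are one-dimensional and positive. Blocks
  with \<open>|K| = 1\<close> are four-dimensional; as the determinant is a Lorentzian form on hermitian 2x2 matrices,
  \<open>Q\<close> is positive definite there on the kernel of a linear functional. There are as many such functionals
  as the dimension of \<open>V\<^bsup>p-1,q-1\<^esup>\<close>. For an arbitrary Kaehler form \<open>\<omega>\<close>, \<open>Q(\<omega>\<beta>, \<omega>\<beta>)\<close> expands into negative
  multiples of squares \<open>|\<beta> \<and> dw\<^sub>i \<and> dw\<^sub>j \<and> dz\<^sub>l \<and> dz\<^sub>m|\<^sup>2\<close>, so \<open>Q\<close> is negative definite on \<open>\<omega> \<and> V\<^bsup>p-1,q-1\<^esup>\<close>. Hence
  the \<open>Q\<close>-orthogonal complement of this image, the primitive space, is positive definite, which implies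
  HLT and LD as well.\<close>

subsection \<open>The exterior algebra as a ring\<close>

text \<open>The Kaehler form \<omega> need not be diagonal in the coordinates that diagonalize
  \<open>M\<close>, so its primitive space does not split into blocks; the kernel of the trace
  functionals does split, but knows nothing of \<omega>. The two are compared without signature
  theory: a nonzero \<open>b\<close> for which all trace functionals vanish on \<omega>b would make
  \<open>Q\<close> both positive and negative there, so by a dimension count each primitive
  \<open>x\<close> can be moved into the kernel by subtracting some \<omega>b. The cross terms
  vanish, and \<open>Q(x,x)\<close> is the positive value at \<open>x\<close> - \<omega>b minus the
  nonpositive value at \<omega>b. The restriction \<open>min p q \<le> 1\<close> enters twice. A
  block with \<open>|K| = k\<close> has \<open>2k + 2\<close> free indices, so only sets of two or
  four occur. And \<beta> is then purely holomorphic or antiholomorphic, so that \<beta> times its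
  conjugate times positive terms is a square of a top holomorphic form. Top-degree forms are
  compared through their plain coefficient. Positive volumes are then positive multiples of the
  constant \<open>vphase n\<close>, the same in every coframe, and it cancels when
  \<open>star\<close> divides by the volume of \<omega>.\<close>

definition inversions :: "nat set \<Rightarrow> nat set \<Rightarrow> nat" where
  "inversions S T = card {(s,t). s \<in> S \<and> t \<in> T \<and> t < s}"

lemma shuffle_sign_eq: "shuffle_sign S T = (-1) ^ inversions S T"
  by (simp add: shuffle_sign_def inversions_def)

lemma finite_inversions:
  "finite S \<Longrightarrow> finite T \<Longrightarrow> finite {(s,t). s \<in> S \<and> t \<in> T \<and> t < (s::nat)}"
  by (rule finite_subset[of _ "S \<times> T"]) auto

lemma inversions_empty [simp]: "inversions S {} = 0" "inversions {} T = 0"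
  by (simp_all add: inversions_def)

lemma inversions_Un_left:
  assumes "finite S" "finite S'" "finite T" "S \<inter> S' = {}"
  shows "inversions (S \<union> S') T = inversions S T + inversions S' T"
proof -
  have "{(s,t). s \<in> S \<union> S' \<and> t \<in> T \<and> t < s}
      = {(s,t). s \<in> S \<and> t \<in> T \<and> t < s} \<union> {(s,t). s \<in> S' \<and> t \<in> T \<and> t < s}" by auto
  then show ?thesis using assms unfolding inversions_def
    by (simp add: card_Un_disjoint finite_inversions disjoint_iff)
qed

lemma inversions_Un_right:
  assumes "finite S" "finite T" "finite T'" "T \<inter> T' = {}"
  shows "inversions S (T \<union> T') = inversions S T + inversions S T'"
proof -
  have "{(s,t). s \<in> S \<and> t \<in> T \<union> T' \<and> t < s}
      = {(s,t). s \<in> S \<and> t \<in> T \<and> t < s} \<union> {(s,t). s \<in> S \<and> t \<in> T' \<and> t < s}" by auto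
  then show ?thesis using assms unfolding inversions_def
    by (simp add: card_Un_disjoint finite_inversions disjoint_iff)
qed

lemma inversions_sym:
  assumes "finite S" "finite T" "S \<inter> T = {}"
  shows "inversions S T + inversions T S = card S * card T"
proof -
  let ?X = "{(s,t). s \<in> S \<and> t \<in> T \<and> t < s}"
  let ?Y = "{(s,t). s \<in> T \<and> t \<in> S \<and> t < s}"
  have "S \<times> T = ?X \<union> prod.swap ` ?Y"
    using assms(3) by (auto simp: image_iff disjoint_iff) (metis linorder_neqE_nat)
  moreover have "?X \<inter> prod.swap ` ?Y = {}" by auto
  moreover have "card (prod.swap ` ?Y) = card ?Y" by (simp add: card_image)
  ultimately have "card (S \<times> T) = card ?X + card ?Y"
    using assms by (simp add: card_Un_disjoint finite_inversions)
  then show ?thesis by (simp add: inversions_def card_cartesian_product)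
qed

lemma shuffle_sign_swap:
  assumes "finite S" "finite T" "S \<inter> T = {}"
  shows "shuffle_sign T S = (-1) ^ (card S * card T) * shuffle_sign S T"
proof -
  have "(-1::complex) ^ (card S * card T) = shuffle_sign S T * shuffle_sign T S"
    using inversions_sym[OF assms] by (simp add: shuffle_sign_eq flip: power_add)
  then show ?thesis
    by (simp add: shuffle_sign_eq mult.assoc mult.left_commute flip: power_mult_distrib)
qed

lemma wedge_infinite: "infinite U \<Longrightarrow> wedge f g U = 0"
  by (simp add: wedge_def)

text \<open>Both sides sum over ordered partitions of \<open>U\<close> into three sets; the map from
  \<open>(S, T)\<close> to \<open>(T, S - T)\<close> matches the two ways of nesting. Either product
  of signs counts the inversions between the three pairs of parts.\<close>

lemma wedge_assoc: "wedge (wedge f g) h = wedge f (wedge g h)"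
proof
  fix U
  show "wedge (wedge f g) h U = wedge f (wedge g h) U"
  proof (cases "finite U")
    case True
    have fin: "finite (Pow U)" and fin': "\<And>S. S \<in> Pow U \<Longrightarrow> finite (Pow S)"
      and fin'': "\<And>S. S \<in> Pow U \<Longrightarrow> finite (Pow (U - S))"
      using True by (auto intro: finite_subset)
    have "wedge (wedge f g) h U = (\<Sum>(S,T)\<in>Sigma (Pow U) Pow.
        shuffle_sign S (U-S) * shuffle_sign T (S-T) * f T * g (S-T) * h (U-S))"
      unfolding wedge_def
      by (subst sum.Sigma[symmetric, OF fin])
        (use fin' in \<open>auto simp: sum_distrib_left sum_distrib_right mult.assoc intro!: sum.cong\<close>)
    also have "\<dots> = (\<Sum>(T,R)\<in>Sigma (Pow U) (\<lambda>T. Pow (U - T)).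
        shuffle_sign T (U-T) * shuffle_sign R (U-T-R) * f T * g R * h (U-T-R))"
    proof (rule sum.reindex_bij_witness[where i = "\<lambda>(T,R). (T \<union> R, T)" and j = "\<lambda>(S,T). (T, S - T)"],
        goal_cases)
      case (5 x)
      obtain S T where x: "x = (S,T)" by force
      have ST: "T \<subseteq> S" "S \<subseteq> U" using 5 x by auto
      have f: "finite S" "finite T" "finite U" using True ST by (auto intro: finite_subset)
      have e: "U - T - (S - T) = U - S" using ST by auto
      have 1: "inversions S (U-S) = inversions T (U-S) + inversions (S-T) (U-S)"
        using inversions_Un_left[of T "S-T" "U-S"] f ST by (simp add: Un_absorb1)
      have 2: "inversions T (U-T) = inversions T (U-S) + inversions T (S-T)"
      proof -
        have "U - T = (U - S) \<union> (S - T)" using ST by auto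
        then show ?thesis using inversions_Un_right[of T "U-S" "S-T"] f by auto
      qed
      show ?case unfolding x by (simp add: e shuffle_sign_eq 1 2 power_add)
    qed auto
    also have "\<dots> = wedge f (wedge g h) U"
      unfolding wedge_def
      by (subst sum.Sigma[symmetric, OF fin])
        (use fin'' in \<open>auto simp: sum_distrib_left mult_ac intro!: sum.cong\<close>)
    finally show ?thesis .
  qed (simp add: wedge_infinite)
qed

text \<open>On an infinite index set the sum defining \<open>wedge\<close> is infinite and hence 0,
  so \<open>unit_form\<close> is neutral only for forms vanishing there. With this restriction the
  forms make up a ring, independent of \<open>n\<close>, and ring simplification becomes
  available.\<close>

typedef ext = "{f::form. \<forall>S. infinite S \<longrightarrow> f S = 0}" morphisms coef Ext
  by (rule exI[of _ "\<lambda>_. 0"]) simp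

setup_lifting type_definition_ext

instantiation ext :: ring_1
begin
lift_definition zero_ext :: ext is zero_form by (simp add: zero_form_def)
lift_definition one_ext :: ext is unit_form by (auto simp: unit_form_def)
lift_definition plus_ext :: "ext \<Rightarrow> ext \<Rightarrow> ext" is fadd by (simp add: fadd_def)
lift_definition uminus_ext :: "ext \<Rightarrow> ext" is "\<lambda>f S. - f S" by simp
lift_definition minus_ext :: "ext \<Rightarrow> ext \<Rightarrow> ext" is "\<lambda>f g S. f S - g S" by simp
lift_definition times_ext :: "ext \<Rightarrow> ext \<Rightarrow> ext" is wedge by (simp add: wedge_infinite)
instance
proof
  fix a b c :: ext
  show "a * b * c = a * (b * c)" by transfer (rule wedge_assoc)
  show "a + b + c = a + (b + c)" by transfer (simp add: fadd_def add.assoc)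
  show "a + b = b + a" by transfer (simp add: fadd_def add.commute)
  show "0 + a = a" by transfer (simp add: fadd_def zero_form_def)
  show "- a + a = 0" by transfer (simp add: fadd_def zero_form_def)
  show "a - b = a + - b" by transfer (simp add: fadd_def)
  show "(a + b) * c = a * c + b * c"
    by transfer (simp add: fadd_def wedge_def fun_eq_iff algebra_simps sum.distrib)
  show "a * (b + c) = a * b + a * c"
    by transfer (simp add: fadd_def wedge_def fun_eq_iff algebra_simps sum.distrib)
  show "1 * a = a"
  proof transfer
    fix f :: form assume f: "\<forall>S. infinite S \<longrightarrow> f S = 0"
    show "wedge unit_form f = f"
    proof
      fix U show "wedge unit_form f U = f U"
      proof (cases "finite U")
        case True
        have "wedge unit_form f U = (\<Sum>S\<in>Pow U. if S = {} then f U else 0)"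
          unfolding wedge_def unit_form_def
          by (rule sum.cong) (auto simp: shuffle_sign_eq)
        then show ?thesis using True by (simp add: sum.delta)
      qed (simp add: f wedge_infinite)
    qed
  qed
  show "a * 1 = a"
  proof transfer
    fix f :: form assume f: "\<forall>S. infinite S \<longrightarrow> f S = 0"
    show "wedge f unit_form = f"
    proof
      fix U show "wedge f unit_form U = f U"
      proof (cases "finite U")
        case True
        have "wedge f unit_form U = (\<Sum>S\<in>Pow U. if S = U then f U else 0)"
          unfolding wedge_def unit_form_def
          by (rule sum.cong) (auto simp: shuffle_sign_eq)
        then show ?thesis using True by (simp add: sum.delta)
      qed (simp add: f wedge_infinite)
    qed
  qed
  show "(0::ext) \<noteq> 1" by transfer (auto simp: zero_form_def unit_form_def fun_eq_iff)
qed
end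

lemma ext_eqI: "(\<And>S. coef x S = coef y S) \<Longrightarrow> x = y"
  by (metis coef_inject ext)

lemma coef_simps [simp]:
  "coef 0 S = 0" "coef (x + y) S = coef x S + coef y S"
  "coef (- x) S = - coef x S" "coef (x - y) S = coef x S - coef y S"
  by (transfer; simp add: zero_form_def fadd_def)+

lemma coef_sum [simp]: "coef (sum f A) S = (\<Sum>a\<in>A. coef (f a) S)"
  by (induction A rule: infinite_finite_induct) simp_all

lemma coef_times: "coef (x * y) U = (\<Sum>S\<in>Pow U. shuffle_sign S (U - S) * coef x S * coef y (U - S))"
  by (simp add: times_ext.rep_eq wedge_def)

lemma coef_infinite: "infinite S \<Longrightarrow> coef x S = 0"
  using coef[of x] by simp

lift_definition cs :: "complex \<Rightarrow> ext" is "\<lambda>c. fscale c unit_form"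
  by (auto simp: fscale_def unit_form_def)

lemma coef_cs_mult [simp]: "coef (cs c * x) S = c * coef x S"
proof (cases "finite S")
  case True
  have "coef (cs c * x) S = (\<Sum>T\<in>Pow S. if T = {} then c * coef x S else 0)"
    unfolding coef_times
    by (rule sum.cong) (auto simp: cs.rep_eq fscale_def unit_form_def shuffle_sign_eq)
  then show ?thesis using True by (simp add: sum.delta)
qed (simp add: coef_infinite)

lemma coef_mult_cs: "coef (x * cs c) S = c * coef x S"
proof (cases "finite S")
  case True
  have "coef (x * cs c) S = (\<Sum>T\<in>Pow S. if T = S then c * coef x S else 0)"
    unfolding coef_times
    by (rule sum.cong) (auto simp: cs.rep_eq fscale_def unit_form_def shuffle_sign_eq)
  then show ?thesis using True by (simp add: sum.delta)
qed (simp add: coef_infinite)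

lemma cs_right: "x * cs c = cs c * x"
  by (rule ext_eqI) (simp add: coef_mult_cs)

lemma cs_left_commute: "x * (cs c * y) = cs c * (x * y)"
  by (metis cs_right mult.assoc)

lemma cs_mult: "cs c * cs d = cs (c * d)"
  by (rule ext_eqI) (simp add: cs.rep_eq fscale_def)

lemma cs_mult_left: "cs c * (cs d * x) = cs (c * d) * x"
  by (simp add: cs_mult flip: mult.assoc)

lemma cs_add: "cs (c + d) = cs c + cs d"
  by (rule ext_eqI) (simp add: cs.rep_eq fscale_def algebra_simps)

lemma cs_0 [simp]: "cs 0 = 0" by (rule ext_eqI) (simp add: cs.rep_eq fscale_def)
lemma cs_1 [simp]: "cs 1 = 1" by (rule ext_eqI) (simp add: cs.rep_eq one_ext.rep_eq fscale_def)
lemma cs_uminus: "cs (- c) = - cs c"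
  by (rule ext_eqI) (simp add: cs.rep_eq fscale_def)
lemma cs_sum: "cs (sum f A) = (\<Sum>a\<in>A. cs (f a))"
  by (induction A rule: infinite_finite_induct) (simp_all add: cs_add)
text \<open>The guards keep scalars from being commuted past each other indefinitely.\<close>

lemma cs_right_guarded: "NO_MATCH (cs d) x \<Longrightarrow> x * cs c = cs c * x"
  by (rule cs_right)

lemma cs_left_guarded: "NO_MATCH (cs d) x \<Longrightarrow> x * (cs c * y) = cs c * (x * y)"
  by (rule cs_left_commute)

lemmas cs_simps = cs_right_guarded cs_left_guarded cs_mult cs_mult_left

lemma cs_mult_eq_0: "cs c * x = 0 \<Longrightarrow> c \<noteq> 0 \<Longrightarrow> x = 0"
  by (metis cs_1 cs_mult_left mult_zero_right mult_1_left left_inverse)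

global_interpretation ext: vector_space "\<lambda>c x. cs c * x"
  by unfold_locales (simp_all add: algebra_simps cs_add cs_mult_left)

definition homog :: "nat \<Rightarrow> ext \<Rightarrow> bool" where
  "homog k x \<longleftrightarrow> (\<forall>S. coef x S \<noteq> 0 \<longrightarrow> card S = k)"

text \<open>Replacing \<open>S\<close> by its complement in \<open>U\<close> exchanges the factors
  at the cost of the swap sign, so graded commutativity becomes a comparison of summands.\<close>

lemma coef_times_swap:
  assumes "finite U"
  shows "coef (x * y) U = (\<Sum>S\<in>Pow U. (-1) ^ (card S * card (U - S)) *
          shuffle_sign S (U - S) * coef y S * coef x (U - S))"
  unfolding coef_times
proof (rule sum.reindex_bij_witness[where i = "\<lambda>S. U - S" and j = "\<lambda>S. U - S"], goal_cases)
  case (5 S)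
  then have "finite S" "finite (U - S)" using assms by (auto intro: finite_subset)
  then show ?case using 5 shuffle_sign_swap[of "U - S" S]
    by (auto simp: double_diff mult_ac Int_commute)
qed auto

lemma homog_commute:
  assumes "homog a x" "homog b y"
  shows "x * y = cs ((-1) ^ (a * b)) * (y * x)"
proof (rule ext_eqI)
  fix U show "coef (x * y) U = coef (cs ((-1) ^ (a * b)) * (y * x)) U"
  proof (cases "finite U")
    case True
    show ?thesis unfolding coef_times_swap[OF True, of x y] coef_cs_mult coef_times[of y] sum_distrib_left
    proof (rule sum.cong[OF refl])
      fix S assume "S \<in> Pow U"
      show "(-1) ^ (card S * card (U - S)) * shuffle_sign S (U - S) * coef y S * coef x (U - S) =
            (-1) ^ (a * b) * (shuffle_sign S (U - S) * coef y S * coef x (U - S))"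
        using assms unfolding homog_def
        by (cases "coef y S = 0 \<or> coef x (U - S) = 0") (auto simp: mult.commute)
    qed
  qed (simp add: coef_infinite)
qed

lemma even_central:
  assumes "\<And>S. coef x S \<noteq> 0 \<Longrightarrow> even (card S)"
  shows "x * y = y * x"
proof (rule ext_eqI)
  fix U show "coef (x * y) U = coef (y * x) U"
  proof (cases "finite U")
    case True
    show ?thesis unfolding coef_times_swap[OF True, of x y] coef_times[of y]
    proof (rule sum.cong[OF refl])
      fix S assume "S \<in> Pow U"
      show "(-1) ^ (card S * card (U - S)) * shuffle_sign S (U - S) * coef y S * coef x (U - S) =
            shuffle_sign S (U - S) * coef y S * coef x (U - S)"
        using assms[of "U - S"] by (cases "coef x (U - S) = 0") auto
    qed
  qed (simp add: coef_infinite)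
qed

lemma homog_even_central: "homog a x \<Longrightarrow> even a \<Longrightarrow> x * y = y * x"
  by (rule even_central) (auto simp: homog_def)

lemma homog_mult:
  assumes "homog a x" "homog b y"
  shows "homog (a + b) (x * y)"
  unfolding homog_def
proof (intro allI impI)
  fix U assume nz: "coef (x * y) U \<noteq> 0"
  then have fin: "finite U" using coef_infinite by blast
  from nz obtain S where "S \<in> Pow U" "coef x S \<noteq> 0" "coef y (U - S) \<noteq> 0"
    unfolding coef_times by (metis (no_types, lifting) mult_eq_0_iff sum.neutral)
  then show "card U = a + b" using assms fin card_Un_disjoint[of S "U - S"]
    by (auto simp: homog_def Un_absorb1 intro: finite_subset)
qed

lemma homog_0 [simp]: "homog k 0" by (simp add: homog_def)
lemma homog_1 [simp]: "homog 0 1" by (simp add: homog_def one_ext.rep_eq unit_form_def)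
lemma homog_cs: "homog k x \<Longrightarrow> homog k (cs c * x)" by (simp add: homog_def)
lemma homog_add: "homog k x \<Longrightarrow> homog k y \<Longrightarrow> homog k (x + y)"
  unfolding homog_def by (metis coef_simps(2) add_0)
lemma one_form_anticommute:
  assumes "homog 1 u" "homog 1 v" shows "u * v = - (v * u)"
  using homog_commute[OF assms] by (simp add: cs_uminus)

lemma eq_neg_self_ext: "x = - x \<Longrightarrow> x = (0::ext)"
proof (rule ext_eqI)
  fix S assume "x = - x"
  then have "coef x S = - coef x S" by (metis coef_simps(3))
  then show "coef x S = coef 0 S" by simp
qed

text \<open>The factor \<open>x\<close> may be inhomogeneous. Its even part \<open>e\<close>
  commutes with \<open>u\<close> and its odd part \<open>x - e\<close> anticommutes, so in both
  cases the two copies of \<open>u\<close> come together, and \<open>u * u = 0\<close>. This makes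
  any product with a repeated one-form vanish, whatever stands in between.\<close>

lemma one_form_sandwich:
  assumes u: "homog 1 u"
  shows "u * x * u = 0"
proof -
  define e where "e = Ext (\<lambda>S. if even (card S) then coef x S else 0)"
  have ce: "coef e S = (if even (card S) then coef x S else 0)" for S
    unfolding e_def by (subst Ext_inverse) (auto simp: coef_infinite)
  have uu: "u * u = 0" by (rule eq_neg_self_ext) (rule one_form_anticommute[OF u u])
  have 1: "e * u = u * e" by (rule even_central) (auto simp: ce split: if_splits)
  have "homog 2 (u * v)" if "homog 1 v" for v using homog_mult[OF u that] by (simp add: numeral_2_eq_2)
  have 2: "(x - e) * u = - (u * (x - e))"
  proof (rule ext_eqI)
    fix U show "coef ((x - e) * u) U = coef (- (u * (x - e))) U"
    proof (cases "finite U")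
      case True
      show ?thesis unfolding coef_simps(3) coef_times_swap[OF True, of "x - e" u] coef_times[of u] sum_negf[symmetric]
      proof (rule sum.cong[OF refl])
        fix S assume "S \<in> Pow U"
        show "(-1) ^ (card S * card (U - S)) * shuffle_sign S (U - S) * coef u S * coef (x - e) (U - S) =
            - (shuffle_sign S (U - S) * coef u S * coef (x - e) (U - S))"
          using u unfolding homog_def
          by (cases "coef u S = 0 \<or> even (card (U - S))") (auto simp: ce)
      qed
    qed (simp add: coef_infinite)
  qed
  have "u * x * u = u * (e * u) + u * ((x - e) * u)" by (simp add: algebra_simps)
  also have "\<dots> = u * u * e - u * u * (x - e)" unfolding 1 2 by (simp add: algebra_simps)
  finally show ?thesis by (simp add: uu)
qed

lemma one_form_square: "homog 1 u \<Longrightarrow> u * u = 0"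
  using one_form_sandwich[of u 1] by simp

subsection \<open>Conjugation and bidegree\<close>

lemma swap_gen_swap_gen: "k < 2*n \<Longrightarrow> swap_gen n (swap_gen n k) = k"
  by (auto simp: swap_gen_def)

lemma swap_image_image:
  assumes "U \<subseteq> {0..<2*n}" shows "swap_gen n ` swap_gen n ` U = U"
proof -
  have "swap_gen n ` swap_gen n ` U = (\<lambda>k. k) ` U" unfolding image_image
    using assms by (intro image_cong refl swap_gen_swap_gen) auto
  then show ?thesis by simp
qed

lemma swap_image_subset: "U \<subseteq> {0..<2*n} \<Longrightarrow> swap_gen n ` U \<subseteq> {0..<2*n}"
  by (force simp: swap_gen_def)

lemma inj_on_swap: "inj_on (swap_gen n) {0..<2*n}"
  by (rule inj_on_inverseI[of _ "swap_gen n"]) (simp add: swap_gen_swap_gen)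

lemma card_swap_image:
  assumes "U \<subseteq> {0..<2*n}"
  shows "card (swap_gen n ` U \<inter> {..<n}) = card (U \<inter> {n..<2*n})"
    and "card (swap_gen n ` U \<inter> {n..<2*n}) = card (U \<inter> {..<n})"
proof -
  have "swap_gen n ` U \<inter> {..<n} = swap_gen n ` (U \<inter> {n..<2*n})"
    and "swap_gen n ` U \<inter> {n..<2*n} = swap_gen n ` (U \<inter> {..<n})"
    using assms by (auto simp: swap_gen_def image_iff split: if_splits) (force+)?
  moreover have "inj_on (swap_gen n) (U \<inter> X)" for X
    by (rule inj_on_subset[OF inj_on_swap]) (use assms in auto)
  ultimately show "card (swap_gen n ` U \<inter> {..<n}) = card (U \<inter> {n..<2*n})"
    and "card (swap_gen n ` U \<inter> {n..<2*n}) = card (U \<inter> {..<n})"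
    by (simp_all add: card_image)
qed

lemma card_Int_split:
  assumes "S \<subseteq> U" "finite U"
  shows "card (U \<inter> X) = card (S \<inter> X) + card ((U - S) \<inter> X)"
proof -
  have "U \<inter> X = S \<inter> X \<union> (U - S) \<inter> X" using assms by auto
  then show ?thesis using assms by (metis card_Un_disjoint Diff_disjoint Int_assoc Int_left_commute
        finite_Int finite_Diff finite_subset inf_bot_right inf_commute)
qed

lemma inversions_image:
  assumes "strict_mono_on (S \<union> T) f"
  shows "inversions (f ` S) (f ` T) = inversions S T"
proof -
  have inj: "inj_on f (S \<union> T)" using assms strict_mono_on_imp_inj_on by blast
  have "{(s,t). s \<in> f ` S \<and> t \<in> f ` T \<and> t < s} = map_prod f f ` {(s,t). s \<in> S \<and> t \<in> T \<and> t < s}"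
    using assms by (force simp: image_iff strict_mono_on_less)
  moreover have "inj_on (map_prod f f) {(s,t). s \<in> S \<and> t \<in> T \<and> t < s}"
    using inj by (auto simp: inj_on_def)
  ultimately show ?thesis by (simp add: inversions_def card_image)
qed

lemma inversions_all:
  assumes "\<And>s t. s \<in> S \<Longrightarrow> t \<in> T \<Longrightarrow> t < s"
  shows "inversions S T = card S * card T"
proof -
  have "{(s,t). s \<in> S \<and> t \<in> T \<and> t < s} = S \<times> T" using assms by auto
  then show ?thesis by (simp add: inversions_def card_cartesian_product)
qed

lemma inversions_none:
  assumes "\<And>s t. s \<in> S \<Longrightarrow> t \<in> T \<Longrightarrow> s < t"
  shows "inversions S T = 0"
proof -
  have "{(s,t). s \<in> S \<and> t \<in> T \<and> t < s} = {}" using assms by force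
  then show ?thesis by (simp only: inversions_def card.empty)
qed

text \<open>\<open>swap_gen\<close> is increasing on each half of the generators, so only inversions
  between different halves change: antiholomorphic \<open>S\<close> against holomorphic
  \<open>T\<close> before, holomorphic \<open>S\<close> against antiholomorphic \<open>T\<close>
  after. The equation is arranged additively to stay within the naturals.\<close>

lemma inversions_swap:
  assumes "S \<subseteq> {0..<2*n}" "T \<subseteq> {0..<2*n}" "S \<inter> T = {}"
  shows "inversions (swap_gen n ` S) (swap_gen n ` T) + card (S \<inter> {n..<2*n}) * card (T \<inter> {..<n})
       = inversions S T + card (S \<inter> {..<n}) * card (T \<inter> {n..<2*n})"
proof -
  let ?s = "swap_gen n"
  define S1 S2 T1 T2 where d: "S1 = S \<inter> {..<n}" "S2 = S \<inter> {n..<2*n}" "T1 = T \<inter> {..<n}" "T2 = T \<inter> {n..<2*n}"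
  have S: "S = S1 \<union> S2" and T: "T = T1 \<union> T2" using assms by (auto simp: d)
  have dS: "S1 \<inter> S2 = {}" and dT: "T1 \<inter> T2 = {}" by (auto simp: d)
  have fin: "finite S1" "finite S2" "finite T1" "finite T2"
    by (simp_all add: d)
  have sub: "S1 \<subseteq> {0..<2*n}" "S2 \<subseteq> {0..<2*n}" "T1 \<subseteq> {0..<2*n}" "T2 \<subseteq> {0..<2*n}"
    using assms by (auto simp: d)
  have dS': "?s ` S1 \<inter> ?s ` S2 = {}" and dT': "?s ` T1 \<inter> ?s ` T2 = {}"
    using inj_on_image_Int[OF inj_on_swap] sub dS dT by (metis image_empty)+
  have cs: "card (?s ` S1) = card S1" "card (?s ` T2) = card T2"
    using sub by (meson card_image inj_on_subset inj_on_swap)+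
  have split: "inversions (A1 \<union> A2) (B1 \<union> B2)
       = inversions A1 B1 + inversions A1 B2 + (inversions A2 B1 + inversions A2 B2)"
    if "finite A1" "finite A2" "finite B1" "finite B2" "A1 \<inter> A2 = {}" "B1 \<inter> B2 = {}" for A1 A2 B1 B2
    using that by (simp add: inversions_Un_left inversions_Un_right)
  have "inversions S1 T2 = 0" by (rule inversions_none) (auto simp: d)
  moreover have "inversions S2 T1 = card S2 * card T1" by (rule inversions_all) (auto simp: d)
  ultimately have 1: "inversions S T = inversions S1 T1 + inversions S2 T2 + card S2 * card T1"
    unfolding S T using split[OF fin dS dT] by simp
  have "inversions (?s ` S2) (?s ` T1) = 0"
    by (rule inversions_none) (auto simp: d swap_gen_def split: if_splits)
  moreover have "inversions (?s ` S1) (?s ` T2) = card (?s ` S1) * card (?s ` T2)"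
    by (rule inversions_all) (auto simp: d swap_gen_def split: if_splits)
  ultimately have 2: "inversions (?s ` S) (?s ` T)
     = inversions (?s ` S1) (?s ` T1) + inversions (?s ` S2) (?s ` T2) + card S1 * card T2"
    unfolding S T image_Un
    using split[OF finite_imageI finite_imageI finite_imageI finite_imageI dS' dT', OF fin] cs by simp
  have 3: "inversions (?s ` S1) (?s ` T1) = inversions S1 T1"
    by (rule inversions_image) (auto simp: d swap_gen_def strict_mono_on_def)
  have 4: "inversions (?s ` S2) (?s ` T2) = inversions S2 T2"
    by (rule inversions_image) (auto simp: d swap_gen_def strict_mono_on_def)
  show ?thesis using 1 2 3 4 by (simp flip: d)
qed

lift_definition cj :: "nat \<Rightarrow> ext \<Rightarrow> ext" is conjf
  using finite_subset by (fastforce simp: conjf_def)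

lemma cj_mult: "cj n (x * y) = cj n x * cj n y"
proof (rule ext_eqI)
  fix U
  let ?s = "swap_gen n"
  let ?h = "\<lambda>U. card (U \<inter> {..<n})" and ?a = "\<lambda>U. card (U \<inter> {n..<2*n})"
  show "coef (cj n (x * y)) U = coef (cj n x * cj n y) U"
  proof (cases "U \<subseteq> {0..<2*n}")
    case True
    then have fin: "finite U" using finite_subset by blast
    have "coef (cj n (x * y)) U = (\<Sum>S\<in>Pow (?s ` U). cnj (shuffle_sign S (?s ` U - S) * coef x S * coef y (?s ` U - S))) * (-1) ^ (?h U * ?a U)"
      using True by (simp add: cj.rep_eq conjf_def coef_times)
    also have "(\<Sum>S\<in>Pow (?s ` U). cnj (shuffle_sign S (?s ` U - S) * coef x S * coef y (?s ` U - S)))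
      = (\<Sum>S\<in>Pow U. cnj (shuffle_sign (?s ` S) (?s ` (U - S)) * coef x (?s ` S) * coef y (?s ` (U - S))))"
    proof (rule sum.reindex_bij_witness[where i = "(`) ?s" and j = "(`) ?s"], goal_cases)
      case (1 a) then show ?case using True swap_image_image swap_image_subset by (meson Pow_iff subset_trans)
    next
      case (2 a)
      then have "?s ` a \<subseteq> ?s ` ?s ` U" by auto
      then show ?case using True by (simp add: swap_image_image)
    next
      case (3 b) then show ?case using True swap_image_image by (meson Pow_iff subset_trans)
    next
      case (4 b) then show ?case by auto
    next
      case (5 a)
      then have a: "a \<subseteq> {0..<2*n}" using True swap_image_subset by (meson Pow_iff subset_trans)
      have "?s ` (U - ?s ` a) = ?s ` U - ?s ` ?s ` a"
        using inj_on_image_set_diff[of ?s "{0..<2*n}" U "?s ` a"] inj_on_swap[of n] True swap_image_subset[OF a] by auto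
      then show ?case using a by (simp add: swap_image_image)
    qed
    also have "\<dots> * (-1) ^ (?h U * ?a U) = coef (cj n x * cj n y) U"
      unfolding coef_times sum_distrib_right
    proof (rule sum.cong[OF refl])
      fix S assume "S \<in> Pow U"
      then have S: "S \<subseteq> {0..<2*n}" "U - S \<subseteq> {0..<2*n}" "S \<subseteq> U" using True by auto
      have h: "?h U = ?h S + ?h (U - S)" and a: "?a U = ?a S + ?a (U - S)"
        using card_Int_split[OF S(3) fin] by blast+
      let ?k = "inversions (?s ` S) (?s ` (U - S))" and ?l = "inversions S (U - S)"
      have "?k + ?a S * ?h (U - S) = ?l + ?h S * ?a (U - S)"
        using inversions_swap[of S n "U - S"] S by simp
      \<comment> \<open>Expanding \<open>?h U * ?a U\<close> over \<open>S\<close> and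
        \<open>U - S\<close> gives two mixed products. One cancels against
        \<open>inversions_swap\<close> and the other is doubled, so it does not affect the
        sign.\<close>
      then have e: "?k + ?h U * ?a U = ?l + ?h S * ?a S + ?h (U-S) * ?a (U-S) + 2 * (?h S * ?a (U-S))"
        unfolding h a by (simp add: algebra_simps)
      have "(-1::complex) ^ (?k + ?h U * ?a U) = (-1) ^ (?l + ?h S * ?a S + ?h (U-S) * ?a (U-S))"
        unfolding e by (simp add: power_add)
      then have e': "(-1::complex) ^ ?k * (-1) ^ (?h U * ?a U)
          = (-1) ^ ?l * (-1) ^ (?h S * ?a S) * (-1) ^ (?h (U-S) * ?a (U-S))"
        by (simp add: power_add)
      have "cnj (shuffle_sign (?s ` S) (?s ` (U - S)) * coef x (?s ` S) * coef y (?s ` (U - S))) * (- 1) ^ (?h U * ?a U)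
          = ((-1) ^ ?k * (-1) ^ (?h U * ?a U)) * (cnj (coef x (?s ` S)) * cnj (coef y (?s ` (U - S))))"
        by (simp add: shuffle_sign_eq)
      also have "\<dots> = shuffle_sign S (U - S) * coef (cj n x) S * coef (cj n y) (U - S)"
        unfolding e' using S by (simp add: shuffle_sign_eq cj.rep_eq conjf_def)
      finally show "cnj (shuffle_sign (?s ` S) (?s ` (U - S)) * coef x (?s ` S) * coef y (?s ` (U - S))) * (- 1) ^ (?h U * ?a U)
         = shuffle_sign S (U - S) * coef (cj n x) S * coef (cj n y) (U - S)" .
    qed
    finally show ?thesis .
  next
    case False
    have "coef (cj n x) S * coef (cj n y) (U - S) = 0" if "S \<in> Pow U" for S
      using that False by (auto simp: cj.rep_eq conjf_def)
    then have "coef (cj n x * cj n y) U = 0" unfolding coef_times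
      by (intro sum.neutral ballI) (simp add: mult.assoc)
    then show ?thesis using False by (simp add: cj.rep_eq conjf_def)
  qed
qed

lemma coef_cj: "coef (cj n x) U = (if U \<subseteq> {0..<2*n}
      then cnj (coef x (swap_gen n ` U)) * (-1) ^ (card (U \<inter> {..<n}) * card (U \<inter> {n..<2*n})) else 0)"
  by (simp add: cj.rep_eq conjf_def)

lemma cj_add: "cj n (x + y) = cj n x + cj n y"
  by (rule ext_eqI) (simp add: coef_cj algebra_simps)
lemma cj_0 [simp]: "cj n 0 = 0"
  by (rule ext_eqI) (simp add: coef_cj)
lemma cj_cs_mult: "cj n (cs c * x) = cs (cnj c) * cj n x"
  by (rule ext_eqI) (simp add: coef_cj)
lemma cj_1 [simp]: "cj n 1 = 1"
  by (rule ext_eqI) (auto simp add: coef_cj one_ext.rep_eq unit_form_def)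
lemma cj_cs [simp]: "cj n (cs c) = cs (cnj c)"
  using cj_cs_mult[of n c 1] by simp
lemma cj_sum: "cj n (sum f A) = (\<Sum>a\<in>A. cj n (f a))"
  by (induction A rule: infinite_finite_induct) (simp_all add: cj_add)
lemma cj_prod_list: "cj n (prod_list xs) = prod_list (map (cj n) xs)"
  by (induction xs) (simp_all add: cj_mult)

definition basis_sets :: "nat \<Rightarrow> int \<Rightarrow> int \<Rightarrow> nat set set" where
  "basis_sets n p q = {S. S \<subseteq> {0..<2*n} \<and>
      int (card (S \<inter> {..<n})) = p \<and> int (card (S \<inter> {n..<2*n})) = q}"

definition supported :: "nat set set \<Rightarrow> ext set" where
  "supported I = {x. \<forall>S. coef x S \<noteq> 0 \<longrightarrow> S \<in> I}"

definition V :: "nat \<Rightarrow> int \<Rightarrow> int \<Rightarrow> ext set" where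
  "V n p q = supported (basis_sets n p q)"

lemma V_iff_Vpq: "x \<in> V n p q \<longleftrightarrow> coef x \<in> Vpq n p q"
  by (auto simp: V_def Vpq_def supported_def basis_sets_def)

lemma Vpq_coef:
  assumes "f \<in> Vpq n p q" obtains x where "x \<in> V n p q" "f = coef x"
proof -
  have "\<forall>S. infinite S \<longrightarrow> f S = 0"
    using assms by (auto simp: Vpq_def dest: finite_subset)
  then have "coef (Ext f) = f" by (simp add: Ext_inverse)
  then show ?thesis using assms that by (metis V_iff_Vpq)
qed

lemma Vpq_eq: "Vpq n p q = coef ` V n p q"
proof
  show "Vpq n p q \<subseteq> coef ` V n p q"
  proof
    fix f assume "f \<in> Vpq n p q"
    then obtain x where "x \<in> V n p q" "f = coef x" by (rule Vpq_coef)
    then show "f \<in> coef ` V n p q" by blast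
  qed
qed (auto simp: V_iff_Vpq)

lemma finite_basis_sets: "finite (basis_sets n p q)"
  by (rule finite_subset[of _ "Pow {0..<2*n}"]) (auto simp: basis_sets_def)

lemma supported_0 [simp]: "0 \<in> supported I" by (simp add: supported_def)
lemma supported_add: "x \<in> supported I \<Longrightarrow> y \<in> supported I \<Longrightarrow> x + y \<in> supported I"
  unfolding supported_def mem_Collect_eq coef_simps by (metis add_0)
lemma supported_cs: "x \<in> supported I \<Longrightarrow> cs c * x \<in> supported I"
  by (simp add: supported_def)
lemma V_0 [simp]: "0 \<in> V n p q" by (simp add: V_def)
lemma V_add: "x \<in> V n p q \<Longrightarrow> y \<in> V n p q \<Longrightarrow> x + y \<in> V n p q"
  by (simp add: V_def supported_add)
lemma V_cs: "x \<in> V n p q \<Longrightarrow> cs c * x \<in> V n p q"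
  by (simp add: V_def supported_cs)
lemma V_diff: "x \<in> V n p q \<Longrightarrow> y \<in> V n p q \<Longrightarrow> x - y \<in> V n p q"
  using V_add[of x n p q "cs (-1) * y"] V_cs[of y n p q "-1"] by (simp add: cs_uminus)
lemma V_sum: "(\<And>a. a \<in> A \<Longrightarrow> f a \<in> V n p q) \<Longrightarrow> sum f A \<in> V n p q"
  by (induction A rule: infinite_finite_induct) (auto intro: V_add)

lemma V_mult:
  assumes "x \<in> V n p q" "y \<in> V n p' q'"
  shows "x * y \<in> V n (p + p') (q + q')"
  unfolding V_def supported_def mem_Collect_eq
proof (intro allI impI)
  fix U assume nz: "coef (x * y) U \<noteq> 0"
  then have fin: "finite U" using coef_infinite by blast
  from nz obtain S where S: "S \<subseteq> U" "coef x S \<noteq> 0" "coef y (U - S) \<noteq> 0"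
    unfolding coef_times by (metis (no_types, lifting) PowD mult_eq_0_iff sum.neutral)
  have c: "card (U \<inter> X) = card (S \<inter> X) + card ((U - S) \<inter> X)" for X
    using card_Int_split[OF S(1) fin] .
  show "U \<in> basis_sets n (p + p') (q + q')"
    using assms S c unfolding V_def supported_def basis_sets_def by fastforce
qed

lemma V_1 [simp]: "1 \<in> V n 0 0"
  by (auto simp: V_def supported_def basis_sets_def one_ext.rep_eq unit_form_def)

lemma swap_basis_sets:
  assumes "S \<in> basis_sets n p q" shows "swap_gen n ` S \<in> basis_sets n q p"
proof -
  have "S \<subseteq> {0..<2*n}" using assms by (simp add: basis_sets_def)
  from card_swap_image[OF this] swap_image_subset[OF this] show ?thesis
    using assms by (simp add: basis_sets_def)
qed

lemma V_cj:
  assumes "x \<in> V n p q" shows "cj n x \<in> V n q p"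
  unfolding V_def supported_def mem_Collect_eq
proof (intro allI impI)
  fix U assume "coef (cj n x) U \<noteq> 0"
  then have U: "U \<subseteq> {0..<2*n}" "coef x (swap_gen n ` U) \<noteq> 0" by (auto simp: coef_cj split: if_splits)
  then have "swap_gen n ` U \<in> basis_sets n p q" using assms by (simp add: V_def supported_def)
  from swap_basis_sets[OF this] show "U \<in> basis_sets n q p" using U by (simp add: swap_image_image)
qed

text \<open>\<open>cj n\<close> discards all coefficients outside the \<open>2*n\<close> generators,
  so it is an involution only on forms that live there.\<close>

lemma cj_cj:
  assumes "x \<in> V n p q" shows "cj n (cj n x) = x"
proof (rule ext_eqI)
  fix U
  show "coef (cj n (cj n x)) U = coef x U"
  proof (cases "U \<subseteq> {0..<2*n}")
    case True
    then show ?thesis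
      using swap_image_image[OF True] swap_image_subset[OF True] card_swap_image[OF True]
      by (simp add: coef_cj mult.commute flip: power_add)
  next
    case False
    then have "coef x U = 0" using assms by (auto simp: V_def supported_def basis_sets_def)
    then show ?thesis using False by (simp add: coef_cj)
  qed
qed

lemma V_homog:
  assumes "x \<in> V n (int p) (int q)" shows "homog (p + q) x"
  unfolding homog_def
proof (intro allI impI)
  fix S assume "coef x S \<noteq> 0"
  then have S: "S \<in> basis_sets n p q" using assms by (simp add: V_def supported_def)
  then have "S = (S \<inter> {..<n}) \<union> (S \<inter> {n..<2*n})" by (auto simp: basis_sets_def)
  then have "card S = card (S \<inter> {..<n}) + card (S \<inter> {n..<2*n})"
    using card_Un_disjoint[of "S \<inter> {..<n}" "S \<inter> {n..<2*n}"] by (auto simp: disjoint_iff)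
  then show "card S = p + q" using S by (simp add: basis_sets_def)
qed

text \<open>Complementation sends \<open>(p, q)\<close> to \<open>(n - p, n - q)\<close>, and
  exchanging the two halves swaps the entries. So source and target of the Lefschetz map have equal
  dimension.\<close>

lemma basis_sets_complement: "card (basis_sets n p q) = card (basis_sets n (int n - q) (int n - p))"
proof -
  have c: "int (card (({0..<2*n} - S) \<inter> {..<n})) = int n - int (card (S \<inter> {..<n}))"
     "int (card (({0..<2*n} - S) \<inter> {n..<2*n})) = int n - int (card (S \<inter> {n..<2*n}))"
    if "S \<subseteq> {0..<2*n}" for S
  proof -
    have "card ({..<n} - S \<inter> {..<n}) = card {..<n} - card (S \<inter> {..<n})"
      by (rule card_Diff_subset) auto
    moreover have "card ({n..<2*n} - S \<inter> {n..<2*n}) = card {n..<2*n} - card (S \<inter> {n..<2*n})"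
      by (rule card_Diff_subset) auto
    moreover have "({0..<2*n} - S) \<inter> {..<n} = {..<n} - S \<inter> {..<n}"
      "({0..<2*n} - S) \<inter> {n..<2*n} = {n..<2*n} - S \<inter> {n..<2*n}" by auto
    moreover have "card (S \<inter> {..<n}) \<le> card {..<n}" "card (S \<inter> {n..<2*n}) \<le> card {n..<2*n}"
      by (rule card_mono; auto)+
    ultimately show "int (card (({0..<2*n} - S) \<inter> {..<n})) = int n - int (card (S \<inter> {..<n}))"
     "int (card (({0..<2*n} - S) \<inter> {n..<2*n})) = int n - int (card (S \<inter> {n..<2*n}))" by simp_all
  qed
  have "bij_betw (\<lambda>S. {0..<2*n} - S) (basis_sets n p q) (basis_sets n (int n - p) (int n - q))"
    by (rule bij_betw_byWitness[where f' = "\<lambda>S. {0..<2*n} - S"])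
       (auto simp: basis_sets_def c double_diff)
  then have 1: "card (basis_sets n p q) = card (basis_sets n (int n - p) (int n - q))"
    by (rule bij_betw_same_card)
  have inv: "swap_gen n ` swap_gen n ` S = S" if "S \<in> basis_sets n a b" for S a b
    using that by (intro swap_image_image) (simp add: basis_sets_def)
  have "bij_betw ((`) (swap_gen n)) (basis_sets n a b) (basis_sets n b a)" for a b
    by (rule bij_betw_byWitness[where f' = "(`) (swap_gen n)"])
       (use swap_basis_sets inv in blast)+
  then show ?thesis using 1 bij_betw_same_card by metis
qed

section \<open>Coefficient basis and dimension counts\<close>

lift_definition E :: "nat set \<Rightarrow> ext" is "\<lambda>S U. if U = S \<and> finite S then 1 else 0"
  by auto

lemma coef_E: "finite S \<Longrightarrow> coef (E S) U = (if U = S then 1 else 0)"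
  by (simp add: E.rep_eq)

lemma supported_expand:
  assumes "x \<in> supported I" "finite I"
  shows "x = (\<Sum>S\<in>I. cs (coef x S) * E S)"
proof (rule ext_eqI)
  fix U
  have "coef (\<Sum>S\<in>I. cs (coef x S) * E S) U = (\<Sum>S\<in>I. if U = S then coef x U else 0)"
    unfolding coef_sum coef_cs_mult
    by (rule sum.cong) (auto simp: E.rep_eq coef_infinite)
  then show "coef x U = coef (\<Sum>S\<in>I. cs (coef x S) * E S) U"
    using assms by (auto simp: sum.delta supported_def)
qed

lemma supported_eq_span:
  assumes "finite I" "\<And>S. S \<in> I \<Longrightarrow> finite S"
  shows "supported I = ext.span (E ` I)"
proof
  show "supported I \<subseteq> ext.span (E ` I)"
  proof
    fix x assume "x \<in> supported I"
    from supported_expand[OF this assms(1)]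
    show "x \<in> ext.span (E ` I)"
      by (metis (no_types, lifting) ext.span_sum ext.span_scale ext.span_base image_eqI)
  qed
  show "ext.span (E ` I) \<subseteq> supported I"
  proof (rule ext.span_minimal)
    show "E ` I \<subseteq> supported I" using assms by (auto simp: supported_def coef_E split: if_splits)
    show "ext.subspace (supported I)"
      by (rule ext.subspaceI) (auto simp: supported_add supported_cs)
  qed
qed

lemma independent_E:
  assumes "finite I" "\<And>S. S \<in> I \<Longrightarrow> finite S"
  shows "ext.independent (E ` I)" "card (E ` I) = card I"
proof -
  have inj: "inj_on E I"
  proof (rule inj_onI)
    fix S T assume "S \<in> I" "T \<in> I" "E S = E T"
    then have "coef (E S) S = coef (E T) S" by simp
    then show "S = T" using assms \<open>S \<in> I\<close> \<open>T \<in> I\<close> by (auto simp: coef_E split: if_splits)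
  qed
  then show "card (E ` I) = card I" by (rule card_image)
  show "ext.independent (E ` I)"
  proof (rule ext.independent_if_scalars_zero)
    show "finite (E ` I)" using assms by simp
    fix f x assume s: "(\<Sum>x\<in>E ` I. cs (f x) * x) = 0" and "x \<in> E ` I"
    then obtain S where S: "S \<in> I" "x = E S" by auto
    have "0 = coef (\<Sum>x\<in>E ` I. cs (f x) * x) S" unfolding s by simp
    also have "\<dots> = (\<Sum>T\<in>I. if T = S then f (E S) else 0)"
      unfolding sum.reindex[OF inj] coef_sum o_def coef_cs_mult
      by (rule sum.cong) (use assms in \<open>auto simp: coef_E\<close>)
    finally show "f x = 0" using assms(1) S by (simp add: sum.delta)
  qed
qed

text \<open>The image of the basis is independent and has as many elements as a basis of the target;
  a target vector outside its span would yield one independent vector too many. All bijectivity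
  claims below thus reduce to a trivial kernel.\<close>

lemma supported_linear_surj:
  assumes I: "finite I" "\<And>S. S \<in> I \<Longrightarrow> finite S"
    and J: "finite J" "\<And>S. S \<in> J \<Longrightarrow> finite S"
    and card: "card J = card I"
    and add: "\<And>x y. f (x + y) = f x + f y"
    and scale: "\<And>c x. f (cs c * x) = cs c * f x"
    and maps: "\<And>x. x \<in> supported I \<Longrightarrow> f x \<in> supported J"
    and inj: "\<And>x. x \<in> supported I \<Longrightarrow> f x = 0 \<Longrightarrow> x = 0"
  shows "bij_betw f (supported I) (supported J)"
proof -
  interpret f: Vector_Spaces.linear "\<lambda>c x. cs c * x" "\<lambda>c x. cs c * x" f
    by unfold_locales (simp_all add: add scale)
  have sI: "ext.span (E ` I) = supported I" and sJ: "ext.span (E ` J) = supported J"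
    using supported_eq_span I J by auto
  have inj': "inj_on f (supported I)"
    using inj f.inj_on_iff_eq_0[OF ext.subspace_span, of "E ` I"] unfolding sI by blast
  have ind: "ext.independent (f ` E ` I)"
    by (rule f.independent_injective_image) (use independent_E[OF I] inj' sI in auto)
  have cfI: "card (f ` E ` I) = card I" "finite (f ` E ` I)"
  proof -
    have "inj_on f (E ` I)" using inj' ext.span_superset sI by (metis inj_on_subset)
    then show "card (f ` E ` I) = card I" using independent_E(2)[OF I] by (simp add: card_image)
  qed (use I in simp)
  have sub: "f ` E ` I \<subseteq> supported J" using maps sI ext.span_superset by blast
  have "supported J \<subseteq> ext.span (f ` E ` I)"
  proof
    fix v assume v: "v \<in> supported J"
    show "v \<in> ext.span (f ` E ` I)"
    proof (rule ccontr)
      assume nv: "v \<notin> ext.span (f ` E ` I)"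
      then have "ext.independent (insert v (f ` E ` I))" using ind by (rule ext.independent_insertI)
      moreover have "insert v (f ` E ` I) \<subseteq> ext.span (E ` J)" using v sub sJ by auto
      ultimately have "card (insert v (f ` E ` I)) \<le> card (E ` J)"
        using ext.independent_span_bound J by blast
      moreover have "v \<notin> f ` E ` I" using nv ext.span_base[of v "f ` E ` I"] by metis
      ultimately show False using cfI card independent_E(2)[OF J] by simp
    qed
  qed
  then have "supported J \<subseteq> f ` supported I" unfolding f.span_image sI .
  then show ?thesis using inj' maps by (auto simp: bij_betw_def)
qed

lemma finite_basis_sets_mem: "S \<in> basis_sets n p q \<Longrightarrow> finite S"
  by (auto simp: basis_sets_def dest: finite_subset)

subsection \<open>Ordered products\<close>

definition oprod :: "(nat \<Rightarrow> ext) \<Rightarrow> nat set \<Rightarrow> ext" where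
  "oprod f X = prod_list (map f (sorted_list_of_set X))"

lemma oprod_empty [simp]: "oprod f {} = 1"
  by (simp add: oprod_def)

lemma oprod_singleton [simp]: "oprod f {j} = f j"
  by (simp add: oprod_def)

lemma prod_list_insort_anticommute:
  assumes "\<And>i. homog 1 (f i)" "sorted xs" "j \<notin> set xs"
  shows "prod_list (map f (insort j xs)) =
    cs ((-1) ^ length (filter (\<lambda>a. a < j) xs)) * (f j * prod_list (map f xs))"
  using assms(2,3)
proof (induction xs)
  case (Cons a xs)
  show ?case
  proof (cases "j \<le> a")
    case True
    then have "filter (\<lambda>a. a < j) (a # xs) = []" using Cons.prems by (auto simp: filter_empty_conv)
    then show ?thesis using True by simp
  next
    case False
    have "f a * (f j * y) = - (f j * (f a * y))" for y
      using one_form_anticommute[OF assms(1) assms(1), of a j] by (simp flip: mult.assoc)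
    then show ?thesis using False Cons by (auto simp: cs_left_commute cs_uminus)
  qed
qed simp

lemma oprod_insert:
  assumes "\<And>i. homog 1 (f i)" "finite A" "j \<notin> A"
  shows "oprod f (insert j A) = cs ((-1) ^ card {a \<in> A. a < j}) * (f j * oprod f A)"
proof -
  have "length (filter (\<lambda>a. a < j) (sorted_list_of_set A)) = card {a \<in> A. a < j}"
    using assms by (subst distinct_card[symmetric]) (auto intro: arg_cong[of _ _ card])
  then show ?thesis unfolding oprod_def
    using assms prod_list_insort_anticommute[of f "sorted_list_of_set A" j] by simp
qed

lemma oprod_insert_central:
  assumes c: "\<And>i y. f i * y = y * f i" and "finite A" "j \<notin> A"
  shows "oprod f (insert j A) = f j * oprod f A"
proof -
  have "prod_list (map f (insort j xs)) = f j * prod_list (map f xs)" for xs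
  proof (induction xs)
    case (Cons a xs)
    have "f a * (f j * y) = f j * (f a * y)" for y
      using c[of a "f j"] by (simp flip: mult.assoc)
    then show ?case using Cons by simp
  qed simp
  then show ?thesis using assms by (simp add: oprod_def)
qed

lemma oprod_central:
  assumes c: "\<And>i y. f i * y = y * f i"
  shows "oprod f A * y = y * oprod f A"
proof -
  have "prod_list (map f xs) * y = y * prod_list (map f xs)" for xs
  proof (induction xs)
    case (Cons a xs)
    have "f a * prod_list (map f xs) * y = f a * y * prod_list (map f xs)"
      using Cons by (simp add: mult.assoc)
    then show ?case using c[of a y] by (simp add: mult.assoc)
  qed simp
  then show ?thesis by (simp add: oprod_def)
qed

lemma oprod_Un_central:
  assumes c: "\<And>i y. f i * y = y * f i" and "finite A" "finite B" "A \<inter> B = {}"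
  shows "oprod f (A \<union> B) = oprod f A * oprod f B"
  using assms(2,4)
proof (induction A rule: finite_induct)
  case (insert j A)
  then show ?case using assms(3)
    by (simp add: oprod_insert_central[of f, OF c] mult.assoc)
qed simp

lemma oprod_homog:
  assumes "\<And>i. homog 1 (f i)" "finite A"
  shows "homog (card A) (oprod f A)"
  using assms(2)
proof (induction A rule: finite_induct)
  case (insert j A)
  then show ?case using homog_mult[OF assms(1)[of j] insert.IH]
    by (simp add: oprod_insert[of f, OF assms(1)] homog_cs)
qed simp

lemma oprod_factor:
  assumes "\<And>i. homog 1 (f i)" "finite A" "j \<in> A"
  shows "\<exists>y. oprod f A = f j * y"
proof -
  have "oprod f A = oprod f (insert j (A - {j}))" using assms by (simp add: insert_absorb)
  also have "\<dots> = f j * (cs ((-1) ^ card {a \<in> A - {j}. a < j}) * oprod f (A - {j}))"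
    by (subst oprod_insert[of f, OF assms(1)]) (use assms in \<open>auto simp: cs_left_commute\<close>)
  finally show ?thesis by blast
qed

subsection \<open>Volume of products of one-forms\<close>

definition area :: "nat \<Rightarrow> ext \<Rightarrow> ext" where
  "area n u = cs (\<i>/2) * (u * cj n u)"

text \<open>A raw coefficient instead of \<open>star\<close>, so that it refers to no Kaehler form
  and can be used with two coframes at once.\<close>

definition topc :: "nat \<Rightarrow> ext \<Rightarrow> complex" where
  "topc n x = coef x {0..<2*n}"

lemma topc_simps [simp]:
  "topc n 0 = 0" "topc n (x + y) = topc n x + topc n y" "topc n (cs c * x) = c * topc n x"
  "topc n (sum f A) = (\<Sum>a\<in>A. topc n (f a))"
  by (simp_all add: topc_def)

text \<open>The constant by which a product of \<open>m\<close> areas differs from the product of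
  the \<open>m\<close> one-forms times its conjugate: \<open>m\<close> factors
  \<open>\<i>/2\<close>, and a triangular number of transpositions.\<close>

definition vphase :: "nat \<Rightarrow> complex" where
  "vphase m = (\<i>/2) ^ m * (-1) ^ (m * (m - 1) div 2)"

lemma triangle_Suc: "Suc m * (Suc m - 1) div 2 = m * (m - 1) div 2 + (m::nat)"
proof -
  have "Suc m * (Suc m - 1) = m * (m - 1) + m * 2" by (cases m) auto
  then show ?thesis by simp
qed

lemma vphase_0 [simp]: "vphase 0 = 1" by (simp add: vphase_def)
lemma vphase_Suc: "vphase (Suc m) = \<i> / 2 * (-1) ^ m * vphase m"
  unfolding vphase_def triangle_Suc power_add by simp
lemma vphase_nonzero [simp]: "vphase m \<noteq> 0" by (simp add: vphase_def)

lemma V_10_homog: "u \<in> V n 1 0 \<Longrightarrow> homog 1 u"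
  using V_homog[of u n 1 0] by simp
lemma V_01_homog: "u \<in> V n 0 1 \<Longrightarrow> homog 1 u"
  using V_homog[of u n 0 1] by simp

lemma area_V: "u \<in> V n 1 0 \<Longrightarrow> area n u \<in> V n 1 1"
  using V_mult[OF _ V_cj, of u n 1 0 u 1 0] by (simp add: area_def V_cs)

lemma V_11_central: "x \<in> V n 1 1 \<Longrightarrow> x * y = y * x"
  using V_homog[of x n 1 1] homog_even_central[of 2 x y] by (simp add: numeral_2_eq_2)

lemma area_cj: assumes "u \<in> V n 1 0" shows "cj n (area n u) = area n u"
proof -
  have "cj n u * u = - (u * cj n u)"
    using one_form_anticommute[OF V_01_homog[OF V_cj[OF assms]] V_10_homog[OF assms]] .
  then show ?thesis
    by (simp add: area_def cj_cs_mult cj_mult cj_cj[OF assms] cs_uminus)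
qed

lemma area_sq: assumes "u \<in> V n 1 0" shows "area n u * area n u = 0"
proof -
  have "area n u * area n u = cs (\<i>/2 * (\<i>/2)) * (u * cj n u * u * cj n u)"
    by (simp add: area_def cs_simps mult.assoc)
  then show ?thesis using one_form_sandwich[OF V_10_homog[OF assms]] by simp
qed

lemma prod_list_V:
  assumes "set us \<subseteq> V n 1 0" shows "prod_list us \<in> V n (int (length us)) 0"
  using assms
proof (induction us)
  case (Cons u us)
  then show ?case using V_mult[of u n 1 0 "prod_list us" "int (length us)" 0] by (simp add: add.commute)
qed simp

lemma prod_list_area:
  assumes "set us \<subseteq> V n 1 0"
  shows "prod_list (map (area n) us) = cs (vphase (length us)) * (prod_list us * cj n (prod_list us))"
  using assms
proof (induction us)
  case (Cons u us)
  let ?p = "prod_list us" and ?m = "length us"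
  have u: "u \<in> V n 1 0" and us: "set us \<subseteq> V n 1 0" using Cons.prems by auto
  have h: "homog ?m ?p" using V_homog[of ?p n ?m 0] prod_list_V[OF us] by simp
  have "homog 1 (cj n u)" using u V_cj V_01_homog by blast
  then have c: "?p * cj n u = cs ((-1) ^ ?m) * (cj n u * ?p)" using homog_commute[OF h] by simp
  have "u * ?p * cj n (u * ?p) = u * (?p * cj n u) * cj n ?p"
    by (simp add: cj_mult mult.assoc)
  also have "\<dots> = cs ((-1) ^ ?m) * (u * cj n u * (?p * cj n ?p))"
    unfolding c by (simp add: cs_simps mult.assoc)
  finally have e: "u * cj n u * (?p * cj n ?p) = cs ((-1) ^ ?m) * (u * ?p * cj n (u * ?p))"
    by (simp add: cs_simps flip: power_mult_distrib)
  have "prod_list (map (area n) (u # us)) = cs (\<i>/2 * vphase ?m) * (u * cj n u * (?p * cj n ?p))"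
    using Cons.IH[OF us] by (simp add: area_def[of n u] cs_simps mult.assoc)
  then show ?case unfolding e by (simp add: cs_simps vphase_Suc mult_ac)
qed simp

lemma V_top_holomorphic:
  assumes "x \<in> V n (int n) 0" shows "x = cs (coef x {..<n}) * E {..<n}"
proof (rule ext_eqI)
  fix U
  show "coef x U = coef (cs (coef x {..<n}) * E {..<n}) U"
  proof (cases "U = {..<n}")
    case False
    have "U \<notin> basis_sets n (int n) 0"
    proof
      assume U: "U \<in> basis_sets n (int n) 0"
      then have "U \<inter> {n..<2*n} = {}" "U \<subseteq> {0..<2*n}" by (auto simp: basis_sets_def)
      then have s: "U \<subseteq> {..<n}" by fastforce
      then have "card U = n" using U by (simp add: basis_sets_def Int_absorb2)
      then show False using s False card_subset_eq[of "{..<n}" U] by simp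
    qed
    then show ?thesis using assms False by (auto simp: V_def supported_def coef_E)
  qed (simp add: coef_E)
qed

lemma cj_E_holomorphic: "cj n (E {..<n}) = E {n..<2*n}"
proof (rule ext_eqI)
  fix U
  show "coef (cj n (E {..<n})) U = coef (E {n..<2*n}) U"
  proof (cases "U \<subseteq> {0..<2*n}")
    case True
    have 1: "swap_gen n ` {n..<2*n} = {..<n}"
    proof -
      have "x \<in> swap_gen n ` {n..<2*n}" if "x < n" for x
        using that by (intro image_eqI[of _ _ "x + n"]) (auto simp: swap_gen_def)
      then show ?thesis by (auto simp: swap_gen_def)
    qed
    have "swap_gen n ` U = {..<n} \<longleftrightarrow> U = {n..<2*n}"
    proof
      assume "swap_gen n ` U = {..<n}"
      then have "swap_gen n ` U = swap_gen n ` {n..<2*n}" using 1 by simp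
      then have "swap_gen n ` swap_gen n ` U = swap_gen n ` swap_gen n ` {n..<2*n}" by simp
      then show "U = {n..<2*n}" using True by (simp add: swap_image_image)
    qed (use 1 in simp)
    moreover have "{n..<2*n} \<inter> {..<n} = {}" by auto
    ultimately show ?thesis using True by (auto simp: coef_cj coef_E)
  next
    case False
    then show ?thesis by (auto simp: coef_cj coef_E)
  qed
qed

lemma top_E_cj_E: "topc n (E {..<n} * cj n (E {..<n})) = 1"
proof -
  have U: "{0..<2*n} - {..<n} = {n..<2*n}" by auto
  have "topc n (E {..<n} * cj n (E {..<n})) = (\<Sum>S\<in>Pow {0..<2*n}. if S = {..<n} then 1 else 0)"
    unfolding topc_def coef_times cj_E_holomorphic
  proof (rule sum.cong[OF refl])
    fix S assume "S \<in> Pow {0..<2*n}"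
    have "inversions {..<n} {n..<2*n} = 0" by (rule inversions_none) auto
    then show "shuffle_sign S ({0..<2*n} - S) * coef (E {..<n}) S * coef (E {n..<2*n}) ({0..<2*n} - S)
       = (if S = {..<n} then 1 else 0)"
      by (auto simp: coef_E U shuffle_sign_eq)
  qed
  also have "\<dots> = 1" by (subst sum.delta) auto
  finally show ?thesis .
qed

lemma top_hol_cj:
  assumes "x \<in> V n (int n) 0" shows "topc n (x * cj n x) = of_real ((cmod (coef x {..<n}))\<^sup>2)"
proof -
  let ?c = "coef x {..<n}"
  have "x * cj n x = cs (?c * cnj ?c) * (E {..<n} * cj n (E {..<n}))"
    by (subst (1 2) V_top_holomorphic[OF assms]) (simp add: cj_cs_mult cs_simps mult.assoc)
  then show ?thesis by (simp only: topc_simps top_E_cj_E complex_norm_square mult_1_right)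
qed

text \<open>Gathering the holomorphic factors on the left turns the product into
  \<open>y * cj n y\<close> with \<open>y = b * prod_list us\<close>. As \<open>y\<close> lies in
  the line of \<open>(n,0)\<close>-forms, its top coefficient is a squared modulus. All squares
  below arise this way, with \<open>b = 1\<close> for volumes and with general \<open>b\<close> for
  negativity on the Lefschetz image.\<close>

lemma top_square_area:
  assumes b: "b \<in> V n (int r) 0" and us: "set us \<subseteq> V n 1 0" and n: "n = r + length us"
  shows "topc n (b * cj n b * prod_list (map (area n) us)) =
    vphase (length us) * (-1) ^ (r * length us) * of_real ((cmod (coef (b * prod_list us) {..<n}))\<^sup>2)"
proof -
  let ?u = "prod_list us" and ?m = "length us"
  have hu: "homog ?m ?u" using V_homog[of ?u n ?m 0] prod_list_V[OF us] by simp
  have hb: "homog r (cj n b)" using V_homog[of "cj n b" n 0 r] V_cj[OF b] by simp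
  have c: "cj n b * ?u = cs ((-1) ^ (r * ?m)) * (?u * cj n b)" by (rule homog_commute[OF hb hu])
  have "b * cj n b * prod_list (map (area n) us) = cs (vphase ?m) * (b * (cj n b * ?u) * cj n ?u)"
    unfolding prod_list_area[OF us] by (simp add: cs_simps mult.assoc)
  also have "\<dots> = cs (vphase ?m * (-1) ^ (r * ?m)) * (b * ?u * cj n (b * ?u))"
    unfolding c by (simp add: cs_simps cj_mult mult.assoc)
  finally have e: "b * cj n b * prod_list (map (area n) us) = \<dots>" .
  have "b * ?u \<in> V n (int n) 0" using V_mult[OF b prod_list_V[OF us]] n by simp
  then show ?thesis unfolding e topc_simps by (simp only: top_hol_cj)
qed

subsection \<open>Monomials in a coframe\<close>

lemma E_empty: "E {} = 1"
  by (rule ext_eqI) (simp add: coef_E one_ext.rep_eq unit_form_def)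

lemma E_insert:
  assumes "finite S" "k \<notin> S"
  shows "E (insert k S) = cs (shuffle_sign {k} S) * (E {k} * E S)"
proof (rule ext_eqI)
  fix U
  have sq: "shuffle_sign {k} S * shuffle_sign {k} S = 1"
    by (simp add: shuffle_sign_eq flip: power_add)
  show "coef (E (insert k S)) U = coef (cs (shuffle_sign {k} S) * (E {k} * E S)) U"
  proof (cases "finite U")
    case True
    have "coef (E {k} * E S) U = (\<Sum>R\<in>Pow U. if R = {k} then (if U - {k} = S then shuffle_sign {k} S else 0) else 0)"
      unfolding coef_times by (rule sum.cong) (auto simp: coef_E assms)
    also have "\<dots> = (if k \<in> U \<and> U - {k} = S then shuffle_sign {k} S else 0)"
      using True by (simp add: sum.delta)
    also have "k \<in> U \<and> U - {k} = S \<longleftrightarrow> U = insert k S" using assms by auto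
    finally show ?thesis using assms sq by (simp add: coef_E)
  qed (use assms in \<open>auto simp: coef_infinite\<close>)
qed

lemma E_hol_V: "k < n \<Longrightarrow> E {k} \<in> V n 1 0"
  by (auto simp: V_def supported_def basis_sets_def coef_E split: if_splits)

lemma cj_E_hol: assumes "k < n" shows "cj n (E {k}) = E {n + k}"
proof (rule ext_eqI)
  fix U
  show "coef (cj n (E {k})) U = coef (E {n + k}) U"
  proof (cases "U \<subseteq> {0..<2*n}")
    case True
    have 1: "swap_gen n ` {n + k} = {k}" by (simp add: swap_gen_def)
    have "swap_gen n ` U = {k} \<longleftrightarrow> U = {n + k}"
    proof
      assume "swap_gen n ` U = {k}"
      then have "swap_gen n ` swap_gen n ` U = swap_gen n ` {k}" by simp
      then show "U = {n + k}" unfolding swap_image_image[OF True]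
        using assms by (simp add: swap_gen_def add.commute)
    qed (use 1 in simp)
    moreover have "{n + k} \<inter> {..<n} = {}" by auto
    ultimately show ?thesis using True by (auto simp: coef_cj coef_E)
  next
    case False
    then show ?thesis using assms by (auto simp: coef_cj coef_E)
  qed
qed

text \<open>The constant in \<open>oprod_th_thb\<close>: each product of a one-form with its
  conjugate contributes \<open>- 2 * \<i>\<close>, and sorting the factors gives the triangular
  sign.\<close>

definition phase :: "nat \<Rightarrow> complex" where
  "phase a = (-1) ^ (a * (a - 1) div 2) * (- 2 * \<i>) ^ a"

lemma phase_Suc: "phase (Suc a) = (-1) ^ a * (- 2 * \<i>) * phase a"
  unfolding phase_def triangle_Suc power_add by simp

locale coframe =
  fixes n :: nat and A :: "nat \<Rightarrow> nat \<Rightarrow> complex"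
  assumes inv: "invertible_mat n A"
begin

definition th :: "nat \<Rightarrow> ext" where "th k = (\<Sum>j<n. cs (A k j) * E {j})"
definition thb :: "nat \<Rightarrow> ext" where "thb k = cj n (th k)"
definition w :: "nat \<Rightarrow> ext" where "w k = area n (th k)"

lemma coef_th: "coef (th k) = oneform n A k"
  by (simp add: th_def oneform_def fsum_def fscale_def dz_def coef_E fun_eq_iff)

lemma coef_w: "coef (w k) = kahler_term n A k"
  unfolding kahler_term_def w_def area_def fun_eq_iff coef_cs_mult
  by (simp add: fscale_def times_ext.rep_eq cj.rep_eq coef_th)

lemma th_V: "th k \<in> V n 1 0"
  unfolding th_def by (intro V_sum V_cs E_hol_V) simp
lemma thb_V: "thb k \<in> V n 0 1"
  unfolding thb_def by (rule V_cj[OF th_V])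
lemma w_V: "w k \<in> V n 1 1"
  unfolding w_def by (rule area_V[OF th_V])

lemma th_homog: "homog 1 (th k)" using th_V V_10_homog by blast
lemma thb_homog: "homog 1 (thb k)" using thb_V V_01_homog by blast
lemma w_central: "w k * y = y * w k" by (rule V_11_central[OF w_V])
lemma w_cj: "cj n (w k) = w k" unfolding w_def by (rule area_cj[OF th_V])
lemma w_sq: "w k * w k = 0" unfolding w_def by (rule area_sq[OF th_V])

lemma th_thb: "th k * thb k = cs (- 2 * \<i>) * w k"
  by (simp add: w_def area_def thb_def cs_mult_left)

lemma w_factor: "w k = th k * (cs (\<i>/2) * thb k)"
  by (simp add: w_def area_def thb_def cs_left_commute)

lemma cj_thb: "cj n (thb k) = th k"
  unfolding thb_def by (rule cj_cj[OF th_V])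

lemma E_th: assumes "k < n" obtains c where "E {k} = (\<Sum>j<n. cs (c j) * th j)"
proof -
  obtain B where B: "\<And>i j. i < n \<Longrightarrow> j < n \<Longrightarrow> (\<Sum>k<n. B i k * A k j) = (if i = j then 1 else 0)"
    using inv unfolding invertible_mat_def by blast
  have "(\<Sum>j<n. cs (B k j) * th j) = (\<Sum>j<n. \<Sum>i<n. cs (B k j * A j i) * E {i})"
    by (simp add: th_def sum_distrib_left cs_mult_left)
  also have "\<dots> = (\<Sum>i<n. \<Sum>j<n. cs (B k j * A j i) * E {i})" by (rule sum.swap)
  also have "\<dots> = (\<Sum>i<n. cs (\<Sum>j<n. B k j * A j i) * E {i})"
    by (simp add: cs_sum sum_distrib_right)
  also have "\<dots> = (\<Sum>i<n. if i = k then E {k} else 0)"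
    by (rule sum.cong) (use assms B in auto)
  also have "\<dots> = E {k}" using assms by (simp add: sum.delta)
  finally show ?thesis using that by metis
qed

text \<open>A triple \<open>(X, Y, K)\<close> of disjoint index sets stands for the monomial \<open>\<theta>\<^sub>X \<theta>bar\<^sub>Y \<omega>\<^sub>K\<close>. Under the pairing
  by wedge product the monomials dual to \<open>(X, Y, K)\<close> have first components swapped to \<open>(Y, X)\<close>.\<close>

definition mon :: "nat set \<times> nat set \<times> nat set \<Rightarrow> ext" where
  "mon = (\<lambda>(X, Y, K). oprod th X * oprod thb Y * oprod w K)"

definition types :: "nat \<Rightarrow> nat \<Rightarrow> (nat set \<times> nat set \<times> nat set) set" where
  "types p q = {(X, Y, K). X \<subseteq> {..<n} \<and> Y \<subseteq> {..<n} \<and> K \<subseteq> {..<n} \<and>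
     X \<inter> Y = {} \<and> X \<inter> K = {} \<and> Y \<inter> K = {} \<and> card X + card K = p \<and> card Y + card K = q}"

lemma finite_types: "finite (types p q)"
  by (rule finite_subset[of _ "Pow {..<n} \<times> Pow {..<n} \<times> Pow {..<n}"]) (auto simp: types_def)

lemma fin_sub: "X \<subseteq> {..<n} \<Longrightarrow> finite X"
  using finite_subset by blast

lemma oprod_w_central: "oprod w K * y = y * oprod w K"
  by (rule oprod_central[of w, OF w_central])

lemma oprod_w_insert: "finite K \<Longrightarrow> j \<notin> K \<Longrightarrow> oprod w (insert j K) = w j * oprod w K"
  by (rule oprod_insert_central[of w, OF w_central])

lemma cj_oprod: "cj n (oprod th X) = oprod thb X" "cj n (oprod thb X) = oprod th X"
  "cj n (oprod w X) = oprod w X"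
  by (simp_all add: oprod_def cj_prod_list thb_def[symmetric] cj_thb w_cj o_def)

lemma cj_mon:
  assumes "(X, Y, K) \<in> types p q"
  shows "cj n (mon (X, Y, K)) = cs ((-1) ^ (card X * card Y)) * mon (Y, X, K)"
proof -
  have f: "finite X" "finite Y" using assms fin_sub by (auto simp: types_def)
  have "oprod thb X * oprod th Y = cs ((-1) ^ (card X * card Y)) * (oprod th Y * oprod thb X)"
    by (rule homog_commute) (use f in \<open>auto intro: oprod_homog th_homog thb_homog\<close>)
  then show ?thesis unfolding mon_def prod.case cj_mult cj_oprod by (simp add: mult.assoc)
qed

lemma mon_factor:
  assumes "(X, Y, K) \<in> types p q" "j \<in> X \<union> K"
  obtains y where "mon (X, Y, K) = th j * y"
proof (cases "j \<in> X")
  case True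
  then obtain y where "oprod th X = th j * y"
    using oprod_factor[of th X j, OF th_homog] assms fin_sub by (auto simp: types_def)
  then show ?thesis using that by (simp add: mon_def mult.assoc)
next
  case False
  then have j: "j \<in> K" and K: "finite K" using assms fin_sub by (auto simp: types_def)
  then have "oprod w K = w j * oprod w (K - {j})"
    using oprod_w_insert[of "K - {j}" j] by (simp add: insert_absorb)
  then have "mon (X, Y, K) = w j * (oprod th X * oprod thb Y * oprod w (K - {j}))"
    using w_central[of j "oprod th X * oprod thb Y"] by (simp add: mon_def flip: mult.assoc)
  then show ?thesis using that w_factor by (metis mult.assoc)
qed

text \<open>If \<open>j\<close> already occurs holomorphically, in \<open>X\<close> or
  \<open>K\<close>, the product is zero. If \<open>j\<close> is in \<open>Y\<close>, the two
  conjugate factors merge into \<open>w j\<close> and \<open>j\<close> moves from \<open>Y\<close>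
  to \<open>K\<close>. Otherwise \<open>j\<close> joins \<open>X\<close>.\<close>

lemma th_mult_mon:
  assumes t: "(X, Y, K) \<in> types p q" and j: "j < n"
  shows "th j * mon (X, Y, K) \<in> ext.span (mon ` types (Suc p) q)"
proof -
  have fin: "finite X" "finite Y" "finite K" using t fin_sub by (auto simp: types_def)
  consider "j \<in> X \<union> K" | "j \<in> Y" | "j \<notin> X \<union> Y \<union> K" by blast
  then show ?thesis
  proof cases
    case 1
    from mon_factor[OF t 1] obtain y where "mon (X, Y, K) = th j * y" .
    then have "th j * mon (X, Y, K) = 0"
      using one_form_square[OF th_homog, of j] by (simp flip: mult.assoc)
    then show ?thesis by (simp add: ext.span_zero)
  next
    case 2
    then have jX: "j \<notin> X" "j \<notin> K" using t by (auto simp: types_def)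
    have "oprod thb Y = oprod thb (insert j (Y - {j}))" using 2 by (simp add: insert_absorb)
    also obtain s where "\<dots> = cs s * (thb j * oprod thb (Y - {j}))"
      using oprod_insert[of thb "Y - {j}" j, OF thb_homog] fin by auto
    finally have Y: "oprod thb Y = cs s * (thb j * oprod thb (Y - {j}))" .
    have c: "oprod th X * thb j = cs ((-1) ^ card X) * (thb j * oprod th X)"
      using homog_commute[OF oprod_homog[of th X, OF th_homog] thb_homog, of j] fin by simp
    have "th j * mon (X, Y, K) = cs s * (th j * (oprod th X * thb j) * oprod thb (Y - {j}) * oprod w K)"
      by (simp add: mon_def Y cs_simps mult.assoc)
    also have "\<dots> = cs (s * (-1) ^ card X) * (th j * thb j * oprod th X * oprod thb (Y - {j}) * oprod w K)"
      unfolding c by (simp add: cs_simps mult.assoc)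
    also have "\<dots> = cs (s * (-1) ^ card X * (-2 * \<i>)) * (w j * (oprod th X * oprod thb (Y - {j})) * oprod w K)"
      unfolding th_thb by (simp add: cs_simps mult.assoc)
    also have "w j * (oprod th X * oprod thb (Y - {j})) * oprod w K = mon (X, Y - {j}, insert j K)"
      unfolding w_central using fin jX by (simp add: mon_def oprod_w_insert mult.assoc)
    finally have e: "th j * mon (X, Y, K) = cs (s * (-1) ^ card X * (-2 * \<i>)) * mon (X, Y - {j}, insert j K)" .
    have "(X, Y - {j}, insert j K) \<in> types (Suc p) q"
      using t j jX 2 fin by (auto simp: types_def card_Diff_singleton card_gt_0_iff Suc_diff_Suc)
        (metis Suc_pred card_gt_0_iff empty_iff add_Suc_right add_Suc)
    then show ?thesis unfolding e by (intro ext.span_scale ext.span_base imageI)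
  next
    case 3
    define s :: complex where "s = (-1) ^ card {a \<in> X. a < j}"
    have s: "oprod th (insert j X) = cs s * (th j * oprod th X)" and s0: "s \<noteq> 0"
      using oprod_insert[of th X j, OF th_homog] fin 3 by (auto simp: s_def)
    have e: "th j * mon (X, Y, K) = cs (1 / s) * mon (insert j X, Y, K)"
      using s0 by (simp add: mon_def s cs_simps mult.assoc)
    have "(insert j X, Y, K) \<in> types (Suc p) q" using t j 3 fin by (auto simp: types_def)
    then show ?thesis unfolding e by (intro ext.span_scale ext.span_base imageI)
  qed
qed

lemma th_mult_span:
  assumes j: "j < n" and x: "x \<in> ext.span (mon ` types p q)"
  shows "th j * x \<in> ext.span (mon ` types (Suc p) q)"
  using x
proof (induction rule: ext.span_induct)
  case base
  show ?case by (rule ext.subspaceI)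
    (auto simp: distrib_left cs_left_commute ext.span_zero intro: ext.span_add ext.span_scale)
next
  case (step x)
  then show ?case using th_mult_mon j by auto
qed

lemma cj_span:
  assumes x: "x \<in> ext.span (mon ` types p q)"
  shows "cj n x \<in> ext.span (mon ` types q p)"
  using x
proof (induction rule: ext.span_induct)
  case base
  show ?case by (rule ext.subspaceI)
    (auto simp: cj_add cj_cs_mult ext.span_zero intro: ext.span_add ext.span_scale)
next
  case (step x)
  then obtain X Y K where t: "(X, Y, K) \<in> types p q" and x: "x = mon (X, Y, K)" by auto
  then have "(Y, X, K) \<in> types q p" by (auto simp: types_def)
  then show ?case unfolding x cj_mon[OF t] by (intro ext.span_scale ext.span_base imageI)
qed

lemma oprod_V: assumes "\<And>i. f i \<in> V n a b"
  shows "finite X \<Longrightarrow> oprod f X \<in> V n (int (card X) * a) (int (card X) * b)"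
proof -
  have "prod_list (map f xs) \<in> V n (int (length xs) * a) (int (length xs) * b)" for xs
  proof (induction xs)
    case (Cons x xs)
    then show ?case using V_mult[OF assms Cons.IH, of x] by (simp add: algebra_simps)
  qed simp
  then show "finite X \<Longrightarrow> oprod f X \<in> V n (int (card X) * a) (int (card X) * b)"
    unfolding oprod_def by (metis length_sorted_list_of_set)
qed

lemma mon_V:
  assumes "t \<in> types p q" shows "mon t \<in> V n (int p) (int q)"
proof -
  obtain X Y K where t: "t = (X, Y, K)" by (cases t)
  then have f: "finite X" "finite Y" "finite K" and c: "card X + card K = p" "card Y + card K = q"
    using assms fin_sub by (auto simp: types_def)
  from V_mult[OF V_mult[OF oprod_V[of th, OF th_V] oprod_V[of thb, OF thb_V]] oprod_V[of w, OF w_V], OF f]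
  show ?thesis by (simp add: t mon_def flip: c)
qed

text \<open>Conjugation exchanges the two components of the type, so this is
  \<open>th_mult_span\<close> applied to the conjugate form.\<close>

lemma thb_mult_span:
  assumes j: "j < n" and x: "x \<in> ext.span (mon ` types p q)"
  shows "thb j * x \<in> ext.span (mon ` types p (Suc q))"
proof -
  have "ext.span (mon ` types p q) \<subseteq> V n (int p) (int q)"
    by (rule ext.span_minimal) (auto intro: mon_V intro!: ext.subspaceI V_add V_cs)
  then have "cj n (cj n x) = x" using x cj_cj by blast
  then have "thb j * x = cj n (th j * cj n x)" by (simp add: cj_mult thb_def)
  then show ?thesis using cj_span[OF th_mult_span[OF j cj_span[OF x]]] by simp
qed

lemma E_span:
  assumes "finite S" "S \<subseteq> {0..<2*n}"
  shows "E S \<in> ext.span (mon ` types (card (S \<inter> {..<n})) (card (S \<inter> {n..<2*n})))"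
  using assms
proof (induction S rule: finite_induct)
  case empty
  have "({}, {}, {}) \<in> types 0 0" by (simp add: types_def)
  moreover have "E {} = mon ({}, {}, {})" by (simp add: E_empty mon_def)
  ultimately show ?case by (simp add: ext.span_base)
next
  case (insert k S)
  let ?p = "card (S \<inter> {..<n})" and ?q = "card (S \<inter> {n..<2*n})"
  have IH: "E S \<in> ext.span (mon ` types ?p ?q)" using insert by auto
  have e: "E (insert k S) = cs (shuffle_sign {k} S) * (E {k} * E S)"
    by (rule E_insert[OF insert.hyps])
  show ?case
  proof (cases "k < n")
    case True
    obtain c where c: "E {k} = (\<Sum>j<n. cs (c j) * th j)" using E_th[OF True] .
    have "E {k} * E S = (\<Sum>j<n. cs (c j) * (th j * E S))"
      by (simp add: c sum_distrib_right mult.assoc)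
    also have "\<dots> \<in> ext.span (mon ` types (Suc ?p) ?q)"
      by (intro ext.span_sum ext.span_scale th_mult_span IH) simp
    finally show ?thesis using True insert.hyps unfolding e by (simp add: Int_insert_left ext.span_scale)
  next
    case False
    define l where "l = k - n"
    have l: "l < n" "k = n + l" using False insert by (auto simp: l_def)
    obtain c where c: "E {l} = (\<Sum>j<n. cs (c j) * th j)" using E_th[OF l(1)] .
    have "E {k} * E S = (\<Sum>j<n. cs (cnj (c j)) * (thb j * E S))"
      unfolding l(2) cj_E_hol[OF l(1), symmetric] c
      by (simp add: cj_sum cj_cs_mult thb_def sum_distrib_right mult.assoc)
    also have "\<dots> \<in> ext.span (mon ` types ?p (Suc ?q))"
      by (intro ext.span_sum ext.span_scale thb_mult_span IH) simp
    finally show ?thesis using False insert.hyps insert.prems unfolding e by (simp add: Int_insert_left ext.span_scale)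
  qed
qed

lemma span_image_expand:
  assumes "finite T" "x \<in> ext.span (f ` T)"
  obtains y where "x = (\<Sum>t\<in>T. cs (y t) * f t)"
proof -
  let ?L = "{x. \<exists>y. x = (\<Sum>t\<in>T. cs (y t) * f t)}"
  have "ext.span (f ` T) \<subseteq> ?L"
  proof (rule ext.span_minimal)
    show "ext.subspace ?L"
    proof (rule ext.subspaceI, goal_cases)
      case 1 show ?case by (auto intro: exI[of _ "\<lambda>_. 0"])
    next
      case (2 x y)
      then obtain a b where "x = (\<Sum>t\<in>T. cs (a t) * f t)" "y = (\<Sum>t\<in>T. cs (b t) * f t)" by auto
      then have "x + y = (\<Sum>t\<in>T. cs (a t + b t) * f t)" by (simp add: cs_add distrib_right sum.distrib)
      then show ?case by (intro CollectI exI)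
    next
      case (3 c x)
      then obtain a where "x = (\<Sum>t\<in>T. cs (a t) * f t)" by auto
      then have "cs c * x = (\<Sum>t\<in>T. cs (c * a t) * f t)" by (simp add: sum_distrib_left cs_mult_left)
      then show ?case by (intro CollectI exI)
    qed
    show "f ` T \<subseteq> ?L"
    proof
      fix x assume "x \<in> f ` T"
      then obtain t where t: "t \<in> T" "x = f t" by auto
      have "(\<Sum>s\<in>T. cs (if s = t then 1 else 0) * f s) = (\<Sum>s\<in>T. if s = t then f t else 0)"
        by (rule sum.cong) auto
      then have "x = (\<Sum>s\<in>T. cs (if s = t then 1 else 0) * f s)" using t assms(1) by (simp add: sum.delta)
      then show "x \<in> ?L" by (intro CollectI exI[of _ "\<lambda>s. if s = t then 1 else 0"])
    qed
  qed
  then have "\<exists>y. x = (\<Sum>t\<in>T. cs (y t) * f t)" using assms(2) by auto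
  then show ?thesis using that by blast
qed

lemma V_expand:
  assumes "x \<in> V n (int p) (int q)"
  obtains y where "x = (\<Sum>t\<in>types p q. cs (y t) * mon t)"
proof -
  have "x = (\<Sum>S\<in>basis_sets n (int p) (int q). cs (coef x S) * E S)"
    using assms supported_expand[OF _ finite_basis_sets] unfolding V_def by blast
  also have "\<dots> \<in> ext.span (mon ` types p q)"
  proof (intro ext.span_sum ext.span_scale)
    fix S assume S: "S \<in> basis_sets n (int p) (int q)"
    then show "E S \<in> ext.span (mon ` types p q)"
      using E_span[of S] finite_basis_sets_mem[OF S] by (simp add: basis_sets_def)
  qed
  finally show ?thesis using span_image_expand[OF finite_types] that by blast
qed

lemma oprod_th_thb: "finite X \<Longrightarrow> oprod th X * oprod thb X = cs (phase (card X)) * oprod w X"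
proof (induction X rule: finite_induct)
  case (insert j X)
  define s :: complex where "s = (-1) ^ card {a \<in> X. a < j}"
  have s2: "s * s = 1" by (simp add: s_def flip: power_add)
  have t: "oprod th (insert j X) = cs s * (th j * oprod th X)"
    and tb: "oprod thb (insert j X) = cs s * (thb j * oprod thb X)"
    using insert by (simp_all add: s_def oprod_insert[of th, OF th_homog] oprod_insert[of thb, OF thb_homog])
  have c: "oprod th X * thb j = cs ((-1) ^ card X) * (thb j * oprod th X)"
    using homog_commute[OF oprod_homog[of th X, OF th_homog] thb_homog, of j] insert by simp
  have "oprod th (insert j X) * oprod thb (insert j X)
      = cs (s * s) * (th j * (oprod th X * thb j) * oprod thb X)"
    unfolding t tb by (simp add: cs_simps mult.assoc)
  also have "\<dots> = cs ((-1) ^ card X) * (th j * thb j * (oprod th X * oprod thb X))"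
    unfolding s2 c by (simp add: cs_simps mult.assoc)
  also have "\<dots> = cs ((-1) ^ card X * (- 2 * \<i>) * phase (card X)) * (w j * oprod w X)"
    unfolding insert.IH th_thb by (simp add: cs_simps mult.assoc)
  finally show ?case using insert by (simp add: oprod_w_insert phase_Suc)
qed (simp add: phase_def)

text \<open>The holomorphic supports are \<open>X \<union> K\<close> and
  \<open>Y' \<union> K'\<close>, the antiholomorphic ones \<open>Y \<union> K\<close> and
  \<open>X' \<union> K'\<close>. If either pair meets, a one-form is repeated. Otherwise, by
  cardinality, each pair partitions \<open>{..<n}\<close>, and this determines \<open>X'\<close> and
  \<open>Y'\<close>.\<close>

lemma mon_pairing:
  assumes t: "(X, Y, K) \<in> types p q" and t': "(Y', X', K') \<in> types p' q'"
    and n: "p + p' = n" "q + q' = n"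
  shows "mon (X, Y, K) * mon (Y', X', K') =
    (if X = X' \<and> Y = Y' \<and> K \<inter> K' = {}
     then cs ((-1) ^ card Y * phase (card X) * phase (card Y)) * oprod w {..<n} else 0)"
proof (cases "(X \<union> K) \<inter> (Y' \<union> K') = {} \<and> (Y \<union> K) \<inter> (X' \<union> K') = {}")
  case True
  have f: "finite X" "finite Y" "finite K" "finite X'" "finite Y'" "finite K'"
    using t t' fin_sub by (auto simp: types_def)
  have 1: "(X \<union> K) \<union> (Y' \<union> K') = {..<n}"
  proof (rule card_subset_eq)
    have "card ((X \<union> K) \<union> (Y' \<union> K')) = card X + card K + (card Y' + card K')"
      using True f t t' by (subst card_Un_disjoint | simp add: types_def)+
    then show "card ((X \<union> K) \<union> (Y' \<union> K')) = card {..<n}" using t t' n by (simp add: types_def)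
  qed (use t t' in \<open>auto simp: types_def\<close>)
  have 2: "(Y \<union> K) \<union> (X' \<union> K') = {..<n}"
  proof (rule card_subset_eq)
    have "card ((Y \<union> K) \<union> (X' \<union> K')) = card Y + card K + (card X' + card K')"
      using True f t t' by (subst card_Un_disjoint | simp add: types_def)+
    then show "card ((Y \<union> K) \<union> (X' \<union> K')) = card {..<n}" using t t' n by (simp add: types_def)
  qed (use t t' in \<open>auto simp: types_def\<close>)
  have d: "X \<inter> Y = {}" "X \<inter> K = {}" "Y \<inter> K = {}" "X' \<inter> Y' = {}" "X' \<inter> K' = {}" "Y' \<inter> K' = {}"
    using t t' by (auto simp: types_def)
  have 3: "x \<in> X \<or> x \<in> K \<or> x \<in> Y' \<or> x \<in> K' \<longleftrightarrow> x < n" for x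
    using arg_cong[OF 1, of "\<lambda>S. x \<in> S"] by auto
  have 4: "x \<in> Y \<or> x \<in> K \<or> x \<in> X' \<or> x \<in> K' \<longleftrightarrow> x < n" for x
    using arg_cong[OF 2, of "\<lambda>S. x \<in> S"] by auto
  have 5: "\<not> (x \<in> X \<and> x \<in> Y)" "\<not> (x \<in> X \<and> x \<in> K)" "\<not> (x \<in> Y \<and> x \<in> K)"
    "\<not> (x \<in> X' \<and> x \<in> Y')" "\<not> (x \<in> X' \<and> x \<in> K')" "\<not> (x \<in> Y' \<and> x \<in> K')"
    "\<not> ((x \<in> X \<or> x \<in> K) \<and> (x \<in> Y' \<or> x \<in> K'))" "\<not> ((x \<in> Y \<or> x \<in> K) \<and> (x \<in> X' \<or> x \<in> K'))" for x
    using d True by (auto simp: disjoint_iff)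
  \<comment> \<open>For \<open>x\<close> in \<open>X\<close>, the exclusions 5 rule out
    \<open>Y\<close>, \<open>K\<close>, \<open>Y'\<close> and \<open>K'\<close>, so the
    antiholomorphic cover 4 leaves only \<open>X'\<close>. The converse, and the case of
    \<open>Y\<close>, use the covers 3 and 4 in the same way.\<close>
  have X: "X = X'"
  proof (rule set_eqI)
    fix x show "x \<in> X \<longleftrightarrow> x \<in> X'" using 3[of x] 4[of x] 5[of x] by argo
  qed
  have Y: "Y = Y'"
  proof (rule set_eqI)
    fix x show "x \<in> Y \<longleftrightarrow> x \<in> Y'" using 3[of x] 4[of x] 5[of x] by argo
  qed
  have KK: "K \<inter> K' = {}" using True by blast
  have n': "{..<n} = X \<union> Y \<union> (K \<union> K')" unfolding 1[symmetric] Y by blast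
  have "oprod thb Y * oprod th Y = cs ((-1) ^ (card Y * card Y)) * (oprod th Y * oprod thb Y)"
    by (rule homog_commute) (use f in \<open>auto intro: oprod_homog th_homog thb_homog\<close>)
  also have "(-1::complex) ^ (card Y * card Y) = (-1) ^ card Y"
    by (simp add: minus_one_power_iff)
  finally have yy: "oprod thb Y * oprod th Y = cs ((-1) ^ card Y * phase (card Y)) * oprod w Y"
    by (simp add: oprod_th_thb f cs_mult_left)
  have "mon (X, Y, K) * mon (Y, X, K')
      = oprod th X * (oprod thb Y * (oprod w K * (oprod th Y * oprod thb X)) * oprod w K')"
    by (simp add: mon_def mult.assoc)
  also have "oprod thb Y * (oprod w K * (oprod th Y * oprod thb X)) * oprod w K'
      = oprod thb Y * oprod th Y * oprod thb X * (oprod w K * oprod w K')"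
    unfolding oprod_w_central[of K "oprod th Y * oprod thb X"] by (simp add: mult.assoc)
  also have "oprod th X * (oprod thb Y * oprod th Y * oprod thb X * (oprod w K * oprod w K'))
      = cs ((-1) ^ card Y * phase (card Y)) * (oprod th X * (oprod w Y * (oprod thb X * (oprod w K * oprod w K'))))"
    unfolding yy by (simp add: cs_simps mult.assoc)
  also have "oprod w Y * (oprod thb X * (oprod w K * oprod w K')) = oprod thb X * (oprod w K * oprod w K' * oprod w Y)"
    unfolding oprod_w_central[of Y "oprod thb X * (oprod w K * oprod w K')"] by (simp add: mult.assoc)
  also have "oprod th X * (oprod thb X * (oprod w K * oprod w K' * oprod w Y))
      = cs (phase (card X)) * (oprod w X * (oprod w K * oprod w K' * oprod w Y))"
    using oprod_th_thb[OF f(1)] by (simp add: mult.assoc[symmetric])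
  also have "oprod w X * (oprod w K * oprod w K' * oprod w Y) = oprod w X * oprod w Y * (oprod w K * oprod w K')"
    unfolding oprod_w_central[of Y "oprod w K * oprod w K'", symmetric] by (simp add: mult.assoc)
  also have "\<dots> = oprod w {..<n}"
  proof -
    have "oprod w (X \<union> Y \<union> (K \<union> K')) = oprod w (X \<union> Y) * oprod w (K \<union> K')"
      by (rule oprod_Un_central[of w, OF w_central]) (use f t t' X Y in \<open>auto simp: types_def\<close>)
    also have "oprod w (X \<union> Y) = oprod w X * oprod w Y"
      by (rule oprod_Un_central[of w, OF w_central]) (use f t in \<open>auto simp: types_def\<close>)
    also have "oprod w (K \<union> K') = oprod w K * oprod w K'"
      by (rule oprod_Un_central[of w, OF w_central]) (use f KK in auto)
    finally show ?thesis using n' by simp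
  qed
  finally show ?thesis using X Y KK by (simp add: cs_mult_left mult_ac)
next
  case meet: False
  have ne: "\<not> (X = X' \<and> Y = Y' \<and> K \<inter> K' = {})" using meet t t' unfolding types_def by blast
  have z: "mon (X1, Y1, K1) * mon (Y2, X2, K2) = 0"
    if t1: "(X1, Y1, K1) \<in> types a b" and t2: "(Y2, X2, K2) \<in> types c d"
      and j: "j \<in> X1 \<union> K1" "j \<in> Y2 \<union> K2"
    for X1 Y1 K1 X2 Y2 K2 a b c d j
  proof -
    obtain y where y: "mon (X1, Y1, K1) = th j * y" using mon_factor[OF t1 j(1)] .
    obtain y' where y': "mon (Y2, X2, K2) = th j * y'" using mon_factor[OF t2 j(2)] .
    have "mon (X1, Y1, K1) * mon (Y2, X2, K2) = th j * y * th j * y'"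
      unfolding y y' by (simp add: mult.assoc)
    then show ?thesis using one_form_sandwich[OF th_homog] by simp
  qed
  have "mon (X, Y, K) * mon (Y', X', K') = 0"
  proof (cases "(X \<union> K) \<inter> (Y' \<union> K') = {}")
    case False
    then show ?thesis using z[OF t t'] by blast
  next
    case True
    then obtain j where j: "j \<in> Y \<union> K" "j \<in> X' \<union> K'" using meet by blast
    \<comment> \<open>A repeated antiholomorphic factor becomes a repeated holomorphic one after
      conjugation.\<close>
    have s: "(Y, X, K) \<in> types q p" "(X', Y', K') \<in> types q' p'" using t t' by (auto simp: types_def)
    have "mon (Y, X, K) * mon (X', Y', K') = 0" using z[OF s j] .
    then have "cj n (mon (Y, X, K) * mon (X', Y', K')) = 0" by simp
    then have "cs ((-1) ^ (card Y * card X) * (-1) ^ (card X' * card Y')) * (mon (X, Y, K) * mon (Y', X', K')) = 0"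
      unfolding cj_mult cj_mon[OF s(1)] cj_mon[OF s(2)] by (simp add: cs_simps mult.assoc)
    then show ?thesis by (rule cs_mult_eq_0) simp
  qed
  then show ?thesis unfolding if_not_P[OF ne] .
qed

definition vol :: complex where "vol = topc n (oprod w {..<n})"

text \<open>The squared modulus of the determinant of \<open>A\<close>, expressed through the top
  holomorphic form so that no determinant has to be expanded.\<close>

definition dsq :: real where "dsq = (cmod (coef (oprod th {..<n}) {..<n}))\<^sup>2"

lemma oprod_w_list: "oprod w X = prod_list (map (area n) (map th (sorted_list_of_set X)))"
  by (simp add: oprod_def w_def[abs_def] o_def)

lemma vol_eq: "vol = vphase n * of_real dsq"
  using top_square_area[of 1 n 0 "map th (sorted_list_of_set {..<n})"] th_V
  unfolding vol_def oprod_w_list dsq_def by (auto simp: oprod_def)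

text \<open>The only monomial of type \<open>(n, 0)\<close> is this product. The monomials span, so
  if it were zero then \<open>E {..<n}\<close> would be zero as well.\<close>

lemma oprod_th_nonzero: "oprod th {..<n} \<noteq> 0"
proof
  assume z: "oprod th {..<n} = 0"
  have "{..<n} \<inter> {n..<2*n} = {}" by auto
  then have s: "E {..<n} \<in> ext.span (mon ` types n 0)" using E_span[of "{..<n}"] by fastforce
  have "X = {..<n} \<and> Y = {} \<and> K = {}" if "(X, Y, K) \<in> types n 0" for X Y K
  proof -
    have "Y = {}" "K = {}" "card X = n" "X \<subseteq> {..<n}" using that fin_sub by (auto simp: types_def)
    then show ?thesis using card_subset_eq[of "{..<n}" X] by simp
  qed
  then have "mon ` types n 0 \<subseteq> {0}" using z by (auto simp: mon_def)
  then have "E {..<n} = 0" using s by (metis ext.span_mono ext.span_insert_0 ext.span_empty insert_absorb singletonD subsetD)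
  then have "coef (E {..<n}) {..<n} = 0" by simp
  then show False by (simp add: coef_E)
qed

lemma dsq_pos: "dsq > 0"
proof -
  have "oprod th {..<n} \<in> V n (int n) 0" using oprod_V[of th 1 0 "{..<n}"] th_V by simp
  from V_top_holomorphic[OF this] have "coef (oprod th {..<n}) {..<n} \<noteq> 0"
    using oprod_th_nonzero by (metis cs_0 mult_zero_left)
  then show ?thesis by (simp add: dsq_def)
qed

lemma vol_nonzero: "vol \<noteq> 0"
  using dsq_pos by (simp add: vol_eq)

end

subsection \<open>Mixed discriminants of positive definite hermitian 2x2 matrices\<close>

text \<open>The polarized determinant of the hermitian matrices with rows \<open>(a l, c l)\<close>
  and \<open>(cnj (c l), d l)\<close>, scaled so that the value at \<open>l = m\<close> is twice the
  determinant.\<close>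

definition mixed_disc :: "(nat \<Rightarrow> real) \<Rightarrow> (nat \<Rightarrow> real) \<Rightarrow> (nat \<Rightarrow> complex) \<Rightarrow> nat \<Rightarrow> nat \<Rightarrow> real" where
  "mixed_disc a d c l m = a l * d m + a m * d l - 2 * Re (c l * cnj (c m))"

lemma mixed_disc_sym: "mixed_disc a d c l m = mixed_disc a d c m l"
  by (simp add: mixed_disc_def algebra_simps)

text \<open>Twice \<open>|c l| |c m|\<close> is less than twice the geometric mean of
  \<open>a l * d m\<close> and \<open>a m * d l\<close>, which is at most their sum.\<close>

lemma mixed_disc_pos:
  assumes "a l > 0" "d l > 0" "(cmod (c l))\<^sup>2 < a l * d l"
    and "a m > 0" "d m > 0" "(cmod (c m))\<^sup>2 < a m * d m"
  shows "mixed_disc a d c l m > 0"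
proof -
  let ?x = "cmod (c l) * cmod (c m)"
  have "Re (c l * cnj (c m)) \<le> cmod (c l * cnj (c m))" by (rule complex_Re_le_cmod)
  then have 1: "Re (c l * cnj (c m)) \<le> ?x" by (simp add: norm_mult)
  have "(2 * ?x)\<^sup>2 = 4 * ((cmod (c l))\<^sup>2 * (cmod (c m))\<^sup>2)" by (simp add: power_mult_distrib)
  also have "\<dots> < 4 * ((a l * d l) * (a m * d m))"
    using mult_strict_mono[OF assms(3,6)] assms by simp
  also have "\<dots> \<le> (a l * d m + a m * d l)\<^sup>2"
  proof -
    have "(a l * d m + a m * d l)\<^sup>2 - 4 * ((a l * d l) * (a m * d m)) = (a l * d m - a m * d l)\<^sup>2"
      by (simp add: power2_eq_square algebra_simps)
    then show ?thesis by (metis diff_ge_0_iff_ge zero_le_power2)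
  qed
  finally have "2 * ?x < a l * d m + a m * d l"
    by (rule power2_less_imp_less) (use assms in simp)
  then show ?thesis using 1 by (simp add: mixed_disc_def)
qed

text \<open>The determinant has signature (1,3) on hermitian 2x2 matrices and is negative on the trace-free
  ones. Removing the positive diagonal of the Gram matrix makes the form definite on this hyperplane.\<close>

lemma mixed_disc_negative:
  fixes z :: "nat \<Rightarrow> complex"
  assumes fin: "finite N"
    and pos: "\<And>l. l \<in> N \<Longrightarrow> (cmod (c l))\<^sup>2 < a l * d l"
    and tr: "(\<Sum>l\<in>N. of_real (a l + d l) * z l) = 0"
    and nz: "\<exists>l\<in>N. z l \<noteq> 0"
  shows "\<exists>r>0. (\<Sum>i\<in>N. \<Sum>j\<in>N-{i}. of_real (mixed_disc a d c i j) * (z i * cnj (z j))) = - of_real r"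
proof -
  \<comment> \<open>These are the entries of the combination of the hermitian matrices with
    coefficients \<open>z l\<close>. As the \<open>z l\<close> are complex, the combination need not
    be hermitian, and its off-diagonal entries \<open>Xc\<close> and \<open>Xc'\<close> are
    independent quantities.\<close>
  define Xa where "Xa = (\<Sum>l\<in>N. of_real (a l) * z l)"
  define Xd where "Xd = (\<Sum>l\<in>N. of_real (d l) * z l)"
  define Xc where "Xc = (\<Sum>l\<in>N. c l * z l)"
  define Xc' where "Xc' = (\<Sum>l\<in>N. cnj (c l) * z l)"
  have Xd: "Xd = - Xa"
    using tr by (simp add: Xa_def Xd_def algebra_simps sum.distrib add_eq_0_iff2)
  have re: "complex_of_real (2 * Re u) = u + cnj u" for u
    by (simp add: complex_add_cnj)
  have m: "of_real (mixed_disc a d c i j) = of_real (a i) * of_real (d j) + of_real (a j) * of_real (d i)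
      - (c i * cnj (c j) + cnj (c i) * c j)" for i j
    unfolding mixed_disc_def of_real_diff re by simp
  define F where "F = (\<Sum>i\<in>N. \<Sum>j\<in>N. of_real (mixed_disc a d c i j) * (z i * cnj (z j)))"
  have "F = Xa * cnj Xd + Xd * cnj Xa - Xc * cnj Xc - Xc' * cnj Xc'"
    unfolding F_def Xa_def Xd_def Xc_def Xc'_def cnj_sum sum_product m
    by (simp add: sum.distrib[symmetric] sum_subtractf[symmetric]) (intro sum.cong refl, simp add: algebra_simps)
  also have "\<dots> = - of_real (2 * (cmod Xa)\<^sup>2 + (cmod Xc)\<^sup>2 + (cmod Xc')\<^sup>2)"
    unfolding Xd by (simp add: complex_norm_square flip: of_real_power) 
  finally have F: "F = - of_real (2 * (cmod Xa)\<^sup>2 + (cmod Xc)\<^sup>2 + (cmod Xc')\<^sup>2)" .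
  \<comment> \<open>The diagonal part of the full form \<open>F\<close>: each summand is twice a
    determinant times \<open>|z i|\<close> squared. It is positive, so removing it makes the form
    more negative.\<close>
  define R where "R = (\<Sum>i\<in>N. 2 * (a i * d i - (cmod (c i))\<^sup>2) * (cmod (z i))\<^sup>2)"
  have diag: "of_real (mixed_disc a d c i i) * (z i * cnj (z i)) =
      of_real (2 * (a i * d i - (cmod (c i))\<^sup>2) * (cmod (z i))\<^sup>2)" for i
  proof -
    have "mixed_disc a d c i i = 2 * (a i * d i - (cmod (c i))\<^sup>2)"
      by (simp add: mixed_disc_def cmod_power2) (simp add: power2_eq_square)
    then show ?thesis by (simp add: complex_norm_square[symmetric] flip: of_real_power)
  qed
  have "F = (\<Sum>i\<in>N. of_real (mixed_disc a d c i i) * (z i * cnj (z i))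
        + (\<Sum>j\<in>N-{i}. of_real (mixed_disc a d c i j) * (z i * cnj (z j))))"
    unfolding F_def by (intro sum.cong refl sum.remove fin)
  also have "\<dots> = of_real R + (\<Sum>i\<in>N. \<Sum>j\<in>N-{i}. of_real (mixed_disc a d c i j) * (z i * cnj (z j)))"
    unfolding sum.distrib diag R_def by simp
  finally have e: "(\<Sum>i\<in>N. \<Sum>j\<in>N-{i}. of_real (mixed_disc a d c i j) * (z i * cnj (z j)))
      = - of_real (2 * (cmod Xa)\<^sup>2 + (cmod Xc)\<^sup>2 + (cmod Xc')\<^sup>2 + R)"
    unfolding F by (simp add: algebra_simps)
  obtain l where l: "l \<in> N" "z l \<noteq> 0" using nz by blast
  have "R > 0" unfolding R_def
    by (rule sum_pos2[OF fin l(1)]) (use pos l in \<open>auto intro!: mult_nonneg_nonneg simp: less_imp_le\<close>)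
  then have "2 * (cmod Xa)\<^sup>2 + (cmod Xc)\<^sup>2 + (cmod Xc')\<^sup>2 + R > 0"
    by (intro add_nonneg_pos) auto
  then show ?thesis using e by blast
qed

text \<open>In four dimensions the form with coefficients \<open>D\<^sub>k\<^sub>l\<close> in position \<open>{i,j}\<close>, where \<open>{i,j,k,l} = N\<close>,
  is congruent to the one with \<open>D\<^sub>i\<^sub>j\<close> in that position, via the diagonal matrix with entries
  \<open>\<Prod>j\<noteq>i. D\<^sub>i\<^sub>j\<close>.\<close>

lemma complementary_block:
  assumes N: "card N = 4"
    and pos: "\<And>l. l \<in> N \<Longrightarrow> a l > 0 \<and> d l > 0 \<and> (cmod (c l))\<^sup>2 < a l * d l"
    and e: "\<And>l m. l \<noteq> m \<Longrightarrow> e {l, m} = mixed_disc a d c l m"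
  shows "\<exists>h::nat \<Rightarrow> real. \<forall>y::nat \<Rightarrow> complex. (\<Sum>j\<in>N. of_real (h j) * y j) = 0 \<longrightarrow> (\<exists>j\<in>N. y j \<noteq> 0) \<longrightarrow>
    (\<exists>r>0. (\<Sum>i\<in>N. \<Sum>j\<in>N-{i}. of_real (e (N - {i, j})) * (y i * cnj (y j))) = - of_real r)"
proof -
  let ?D = "mixed_disc a d c"
  \<comment> \<open>For \<open>N = {i, j, k, l}\<close> the number \<open>P\<close> is the product
    of all six mixed discriminants, while \<open>s i * s j\<close> contains \<open>?D i j\<close>
    twice, the four mixed ones once and \<open>?D k l\<close> not at all. Hence
    \<open>P * ?D i j / (s i * s j)\<close> is exactly \<open>?D k l\<close>.\<close>
  define s where "s i = (\<Prod>j\<in>N-{i}. ?D i j)" for i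
  define P where "P = sqrt (\<Prod>i\<in>N. s i)"
  have fin: "finite N" using N card.infinite by fastforce
  have Dpos: "?D i j > 0" if "i \<in> N" "j \<in> N" for i j using that pos by (intro mixed_disc_pos) auto
  have spos: "s i > 0" if "i \<in> N" for i unfolding s_def by (intro prod_pos) (use Dpos that in auto)
  have Ppos: "P > 0" unfolding P_def by (simp add: prod_pos spos)
  have key: "e (N - {i, j}) = P * ?D i j / (s i * s j)" if ij: "i \<in> N" "j \<in> N" "i \<noteq> j" for i j
  proof -
    have "card (N - {i, j}) = 2" using N ij fin by simp
    then obtain k l where kl: "N - {i, j} = {k, l}" "k \<noteq> l" by (meson card_2_iff)
    then have Neq: "N = {i, j, k, l}" and dist: "k \<noteq> i" "k \<noteq> j" "l \<noteq> i" "l \<noteq> j" using ij by auto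
    let ?a = "?D i j" and ?b = "?D i k" and ?c = "?D i l" and ?d = "?D j k" and ?e = "?D j l" and ?f = "?D k l"
    have p: "?a > 0" "?b > 0" "?c > 0" "?d > 0" "?e > 0" "?f > 0" using Dpos Neq by auto
    have N': "N - {i} = {j, k, l}" "N - {j} = {i, k, l}" "N - {k} = {i, j, l}" "N - {l} = {i, j, k}"
      using Neq dist ij(3) kl(2) by auto
    have s: "s i = ?a * ?b * ?c" "s j = ?a * ?d * ?e" "s k = ?b * ?d * ?f" "s l = ?c * ?e * ?f"
      unfolding s_def N' using dist ij(3) kl(2)
      by (simp_all add: mixed_disc_sym[of a d c j i] mixed_disc_sym[of a d c k i] mixed_disc_sym[of a d c l i]
        mixed_disc_sym[of a d c k j] mixed_disc_sym[of a d c l j] mixed_disc_sym[of a d c l k])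
    have "(\<Prod>i\<in>N. s i) = s i * s j * s k * s l" unfolding Neq using dist ij(3) kl(2) by simp
    also have "\<dots> = (?a * ?b * ?c * ?d * ?e * ?f)\<^sup>2" unfolding s by (simp add: power2_eq_square)
    finally have "P = ?a * ?b * ?c * ?d * ?e * ?f" using p by (simp add: P_def)
    moreover have "e (N - {i, j}) = ?f" unfolding kl by (rule e[OF kl(2)])
    ultimately show ?thesis unfolding s using p by (simp add: field_simps)
  qed
  show ?thesis
  \<comment> \<open>The witness is the trace functional of the congruent form, written in the
    original coordinates \<open>y\<close> by \<open>z j = y j / s j\<close>.\<close>
  proof (intro exI[of _ "\<lambda>j. (a j + d j) / s j"] allI impI)
    fix y :: "nat \<Rightarrow> complex"
    assume y0: "(\<Sum>j\<in>N. of_real ((a j + d j) / s j) * y j) = 0" and nz: "\<exists>j\<in>N. y j \<noteq> 0"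
    define z where "z j = y j / of_real (s j)" for j
    have "(\<Sum>j\<in>N. of_real (a j + d j) * z j) = 0" using y0 by (simp add: z_def)
    moreover have "\<exists>j\<in>N. z j \<noteq> 0" using nz spos by (fastforce simp: z_def)
    ultimately obtain r where r: "r > 0"
      "(\<Sum>i\<in>N. \<Sum>j\<in>N-{i}. of_real (?D i j) * (z i * cnj (z j))) = - of_real r"
      using mixed_disc_negative[OF fin, of c a d z] pos by blast
    have "(\<Sum>i\<in>N. \<Sum>j\<in>N-{i}. of_real (e (N - {i, j})) * (y i * cnj (y j)))
        = (\<Sum>i\<in>N. \<Sum>j\<in>N-{i}. of_real P * (of_real (?D i j) * (z i * cnj (z j))))"
      by (intro sum.cong refl) (auto simp: key z_def)
    also have "\<dots> = - of_real (P * r)" using r(2) by (simp flip: sum_distrib_left)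
    finally show "\<exists>r>0. (\<Sum>i\<in>N. \<Sum>j\<in>N-{i}. of_real (e (N - {i, j})) * (y i * cnj (y j))) = - of_real r"
      using r(1) Ppos by (meson mult_pos_pos)
  qed
qed

subsection \<open>The form on the kernel of the trace functionals\<close>

definition pref :: "nat \<Rightarrow> nat \<Rightarrow> complex" where
  "pref p q = \<i> powi (int p - int q) * (-1) ^ ((p + q) * (p + q - 1) div 2)"

locale diagonal_pair = coframe +
  fixes a d :: "nat \<Rightarrow> real" and c :: "nat \<Rightarrow> complex"
  assumes pos: "l < n \<Longrightarrow> a l > 0 \<and> d l > 0 \<and> (cmod (c l))\<^sup>2 < a l * d l"
begin

definition Om :: ext where
  "Om = (\<Sum>l<n. \<Sum>m<n. cs (of_real (a l * d m) - c l * cnj (c m)) * (w l * w m))"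

text \<open>A function of sets, because the Gram matrix evaluates it on complements of index sets.
  Both orders of each pair are summed, which symmetrizes the coefficients of
  \<open>Om\<close>.\<close>

definition e :: "nat set \<Rightarrow> real" where
  "e Z = (\<Sum>l\<in>Z. \<Sum>m\<in>Z-{l}. a l * d m - Re (c l * cnj (c m)))"

definition pairs :: "nat set set" where "pairs = {Z. Z \<subseteq> {..<n} \<and> card Z = 2}"

lemma finite_pairs: "finite pairs"
  by (rule finite_subset[of _ "Pow {..<n}"]) (auto simp: pairs_def)

lemma e_doubleton: "l \<noteq> m \<Longrightarrow> e {l, m} = mixed_disc a d c l m"
  by (simp add: e_def mixed_disc_def insert_Diff_if algebra_simps)

lemma e_pos: "Z \<in> pairs \<Longrightarrow> e Z > 0"
  using pos by (auto simp: pairs_def card_2_iff e_doubleton intro!: mixed_disc_pos)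

lemma w_commute: "w l * w m = w m * w l" by (rule w_central)

lemma Om_pairs: "Om = (\<Sum>Z\<in>pairs. cs (of_real (e Z)) * oprod w Z)"
proof -
  define F where "F l m = of_real (a l * d m) - c l * cnj (c m)" for l m
  let ?T = "{(l,m). l < n \<and> m < n \<and> l \<noteq> m}"
  have finT: "finite ?T" by (rule finite_subset[of _ "{..<n} \<times> {..<n}"]) auto
  have "Om = (\<Sum>(l,m)\<in>{..<n} \<times> {..<n}. cs (F l m) * (w l * w m))"
    by (simp add: Om_def F_def sum.cartesian_product)
  also have "\<dots> = (\<Sum>(l,m)\<in>?T. cs (F l m) * (w l * w m))"
    by (rule sum.mono_neutral_right) (auto simp: w_sq)
  also have "\<dots> = (\<Sum>Z\<in>pairs. \<Sum>x | x \<in> ?T \<and> {fst x, snd x} = Z. case x of (l,m) \<Rightarrow> cs (F l m) * (w l * w m))"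
    by (rule sum.group[symmetric, OF finT finite_pairs]) (auto simp: pairs_def)
  also have "\<dots> = (\<Sum>Z\<in>pairs. cs (of_real (e Z)) * oprod w Z)"
  proof (rule sum.cong[OF refl])
    fix Z assume "Z \<in> pairs"
    then obtain l m where Z: "Z = {l, m}" "l \<noteq> m" and lm: "l < n" "m < n"
      by (auto simp: pairs_def card_2_iff)
    have "{x. x \<in> ?T \<and> {fst x, snd x} = Z} = {(l, m), (m, l)}"
      using Z lm by (auto simp: doubleton_eq_iff)
    then have "(\<Sum>x | x \<in> ?T \<and> {fst x, snd x} = Z. case x of (l,m) \<Rightarrow> cs (F l m) * (w l * w m))
        = cs (F l m) * (w l * w m) + cs (F m l) * (w m * w l)" using Z by simp
    also have "\<dots> = cs (F l m + F m l) * (w l * w m)"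
      by (simp add: w_commute[of m l] cs_add distrib_right)
    also have "F l m + F m l = of_real (e Z)"
      using complex_add_cnj[of "c l * cnj (c m)"]
      by (simp add: Z e_doubleton F_def mixed_disc_def algebra_simps)
    also have "w l * w m = oprod w Z" using Z by (simp add: oprod_w_insert)
    finally show "(\<Sum>x | x \<in> ?T \<and> {fst x, snd x} = Z. case x of (l,m) \<Rightarrow> cs (F l m) * (w l * w m))
        = cs (of_real (e Z)) * oprod w Z" .
  qed
  finally show ?thesis .
qed

lemma Om_V: "Om \<in> V n 2 2"
  unfolding Om_def using V_mult[OF w_V w_V] by (intro V_sum V_cs) simp

lemma Om_central: "Om * y = y * Om"
  using V_homog[of Om n 2 2] Om_V homog_even_central[of 4 Om y] by simp

lemma cj_Om: "cj n Om = Om"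
  unfolding Om_pairs by (simp add: cj_sum cj_cs_mult cj_oprod)

lemma mon_oprod_w:
  assumes t: "(Y, X, K) \<in> types p q" and Z: "Z \<in> pairs"
  shows "mon (Y, X, K) * oprod w Z = (if Z \<inter> (X \<union> Y \<union> K) = {} then mon (Y, X, K \<union> Z) else 0)"
    and "Z \<inter> (X \<union> Y \<union> K) = {} \<Longrightarrow> (Y, X, K \<union> Z) \<in> types (p + 2) (q + 2)"
proof -
  have f: "finite X" "finite Y" "finite K" "finite Z" using t Z fin_sub by (auto simp: types_def pairs_def)
  show "Z \<inter> (X \<union> Y \<union> K) = {} \<Longrightarrow> (Y, X, K \<union> Z) \<in> types (p + 2) (q + 2)"
    using t Z f card_Un_disjoint[of K Z] by (auto simp: types_def pairs_def Int_commute Int_Un_distrib)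
  show "mon (Y, X, K) * oprod w Z = (if Z \<inter> (X \<union> Y \<union> K) = {} then mon (Y, X, K \<union> Z) else 0)"
  proof (cases "Z \<inter> (X \<union> Y \<union> K) = {}")
    case True
    then have "oprod w (K \<union> Z) = oprod w K * oprod w Z"
      by (intro oprod_Un_central[of w, OF w_central] f) auto
    then show ?thesis using True by (simp add: mon_def mult.assoc)
  next
    case False
    then obtain j where j: "j \<in> Z" "j \<in> X \<union> Y \<union> K" by blast
    have "oprod w Z = w j * oprod w (Z - {j})"
      using oprod_w_insert[of "Z - {j}" j] f j by (simp add: insert_absorb)
    moreover have "mon (Y, X, K) * w j = 0"
    proof (cases "j \<in> Y \<union> K")
      case True
      then obtain y where "mon (Y, X, K) = th j * y" using mon_factor[OF t] by blast
      then have "mon (Y, X, K) * w j = (th j * y * th j) * (cs (\<i>/2) * thb j)"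
        unfolding w_factor by (simp add: mult.assoc)
      then show ?thesis by (simp add: one_form_sandwich[OF th_homog])
    next
      case False
      then have jX: "j \<in> X \<union> K" using j by blast
      have t': "(X, Y, K) \<in> types q p" using t by (auto simp: types_def)
      obtain y where y: "mon (X, Y, K) = th j * y" using mon_factor[OF t' jX] .
      have "mon (X, Y, K) * w j = (th j * y * th j) * (cs (\<i>/2) * thb j)"
        unfolding w_factor y by (simp add: mult.assoc)
      then have "cj n (mon (X, Y, K) * w j) = 0" by (simp add: one_form_sandwich[OF th_homog])
      then have "cs ((-1) ^ (card X * card Y)) * (mon (Y, X, K) * w j) = 0"
        unfolding cj_mult cj_mon[OF t'] w_cj by (simp add: mult.assoc)
      then show ?thesis by (rule cs_mult_eq_0) simp
    qed
    ultimately have "mon (Y, X, K) * oprod w Z = 0" by (simp flip: mult.assoc)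
    then show ?thesis using False by simp
  qed
qed

text \<open>Multiplying by \<open>oprod w Z\<close> enlarges \<open>K'\<close> to
  \<open>K' \<union> Z\<close>. By \<open>mon_pairing\<close> the product survives only if
  \<open>Z\<close> avoids all of \<open>X\<close>, \<open>Y\<close>, \<open>K\<close> and
  \<open>K'\<close>; since \<open>n = p + q + 2\<close>, the remaining indices are exactly two, so a
  single \<open>Z\<close> contributes.\<close>

lemma gram:
  assumes t: "(X, Y, K) \<in> types p q" and t': "(X', Y', K') \<in> types p q" and n: "n = p + q + 2"
  shows "topc n (mon (X, Y, K) * cj n (mon (X', Y', K')) * Om) =
    (if X = X' \<and> Y = Y' \<and> K \<inter> K' = {}
     then (-1) ^ (card X * card Y) * (-1) ^ card Y * phase (card X) * phase (card Y) * vol *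
       of_real (e ({..<n} - X - Y - K - K')) else 0)"
proof -
  have s: "(Y', X', K') \<in> types q p" using t' by (auto simp: types_def)
  have "mon (X, Y, K) * cj n (mon (X', Y', K')) * Om = cs ((-1) ^ (card X' * card Y')) *
      (\<Sum>Z\<in>pairs. cs (of_real (e Z)) * (mon (X, Y, K) * (mon (Y', X', K') * oprod w Z)))"
    unfolding cj_mon[OF t'] Om_pairs by (simp add: cs_simps mult.assoc sum_distrib_left)
  then have 1: "topc n (mon (X, Y, K) * cj n (mon (X', Y', K')) * Om) = (-1) ^ (card X' * card Y') *
      (\<Sum>Z\<in>pairs. of_real (e Z) * topc n (mon (X, Y, K) * (mon (Y', X', K') * oprod w Z)))" by simp
  have 2: "mon (X, Y, K) * (mon (Y', X', K') * oprod w Z) =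
      (if Z \<inter> (X' \<union> Y' \<union> K') = {} \<and> X = X' \<and> Y = Y' \<and> K \<inter> (K' \<union> Z) = {}
       then cs ((-1) ^ card Y * phase (card X) * phase (card Y)) * oprod w {..<n} else 0)"
    if Z: "Z \<in> pairs" for Z
  proof (cases "Z \<inter> (X' \<union> Y' \<union> K') = {}")
    case True
    show ?thesis unfolding mon_oprod_w(1)[OF s Z]
      using mon_pairing[OF t mon_oprod_w(2)[OF s Z True]] n True by simp
  qed (simp add: mon_oprod_w(1)[OF s Z])
  show ?thesis
  proof (cases "X = X' \<and> Y = Y' \<and> K \<inter> K' = {}")
    case True
    let ?R = "{..<n} - X - Y - K - K'"
    have f: "finite X" "finite Y" "finite K" "finite K'" using t t' fin_sub by (auto simp: types_def)
    have "card (X \<union> Y \<union> K \<union> K') = card X + card Y + card K + card K'"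
      using t t' True f by (subst card_Un_disjoint | auto simp: types_def)+
    moreover have "?R = {..<n} - (X \<union> Y \<union> K \<union> K')" by auto
    moreover have "X \<union> Y \<union> K \<union> K' \<subseteq> {..<n}" using t t' by (auto simp: types_def)
    moreover have "card X + card K = p" "card Y + card K = q" "card X + card K' = p"
      using t t' True by (auto simp: types_def)
    ultimately have cR: "card ?R = 2" using n f by (simp add: card_Diff_subset)
    have iff: "Z \<inter> (X' \<union> Y' \<union> K') = {} \<and> X = X' \<and> Y = Y' \<and> K \<inter> (K' \<union> Z) = {} \<longleftrightarrow> Z = ?R"
      if Z: "Z \<in> pairs" for Z
    proof
      assume "Z \<inter> (X' \<union> Y' \<union> K') = {} \<and> X = X' \<and> Y = Y' \<and> K \<inter> (K' \<union> Z) = {}"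
      then have "Z \<subseteq> ?R" using Z by (auto simp: pairs_def)
      then show "Z = ?R" using Z cR by (intro card_subset_eq) (auto simp: pairs_def)
    qed (use True in auto)
    have R: "?R \<in> pairs" using cR by (auto simp: pairs_def)
    have "(\<Sum>Z\<in>pairs. of_real (e Z) * topc n (mon (X, Y, K) * (mon (Y', X', K') * oprod w Z)))
        = (\<Sum>Z\<in>pairs. if Z = ?R then of_real (e ?R) * ((-1) ^ card Y * phase (card X) * phase (card Y) * vol) else 0)"
      by (rule sum.cong[OF refl]) (simp only: 2 iff, simp add: vol_def)
    also have "\<dots> = of_real (e ?R) * ((-1) ^ card Y * phase (card X) * phase (card Y) * vol)"
      using finite_pairs R by (simp add: sum.delta)
    finally show ?thesis unfolding 1 using True by (simp add: mult_ac)
  next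
    case False
    have "topc n (mon (X, Y, K) * (mon (Y', X', K') * oprod w Z)) = 0" if "Z \<in> pairs" for Z
      unfolding 2[OF that] using False by auto
    then have "topc n (mon (X, Y, K) * cj n (mon (X', Y', K')) * Om) = 0" unfolding 1 by simp
    then show ?thesis unfolding if_not_P[OF False] .
  qed
qed

end

section \<open>Signs of the Hodge-Riemann factor\<close>

lemma sign_triangle_add:
  "(-1::complex) ^ ((x + y) * (x + y - 1) div 2) =
    (-1) ^ (x * (x - 1) div 2) * (-1) ^ (y * (y - 1) div 2) * (-1) ^ (x * y)"
proof (induction y)
  case (Suc y)
  show ?case using Suc unfolding add_Suc_right triangle_Suc power_add mult_Suc_right
    by (simp add: mult_ac power_add)
qed simp

lemma sign_triangle_add_double:
  "(-1::complex) ^ ((s + 2 * k) * (s + 2 * k - 1) div 2) = (-1) ^ (s * (s - 1) div 2) * (-1) ^ k"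
proof (induction k)
  case (Suc k)
  have "s + 2 * Suc k = Suc (Suc (s + 2 * k))" by simp
  then show ?case using Suc unfolding \<open>s + 2 * Suc k = _\<close> triangle_Suc power_add
    by (simp add: power_add)
qed simp

lemma i_powi_diff: "\<i> powi (int x - int y) = \<i> ^ x * (- \<i>) ^ y"
  by (simp add: power_int_diff field_simps flip: power_mult_distrib)

text \<open>The factor in \<open>Q\<close> for bidegree \<open>(x + k, y + k)\<close> cancels every
  phase from \<open>gram\<close> up to \<open>(-1) ^ k\<close>. So blocks with empty
  \<open>K\<close> keep their sign, and blocks with \<open>|K| = 1\<close> are reversed, which makes
  the negative form of \<open>complementary_block\<close> positive.\<close>

lemma pref_phase:
  "pref (x + k) (y + k) * ((-1) ^ (x * y) * (-1) ^ y * phase x * phase y) = 2 ^ (x + y) * (-1) ^ k"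
proof -
  define Tx Ty :: complex where "Tx = (-1) ^ (x * (x - 1) div 2)" and "Ty = (-1) ^ (y * (y - 1) div 2)"
  have sq: "Tx * Tx = 1" "Ty * Ty = 1" "(-1::complex) ^ (x * y) * (-1) ^ (x * y) = 1"
    by (simp_all add: Tx_def Ty_def flip: power_add)
  have s: "x + k + (y + k) = x + y + 2 * k" and t: "int (x + k) - int (y + k) = int x - int y" by simp_all
  have p: "pref (x + k) (y + k) = \<i> ^ x * (- \<i>) ^ y * (Tx * Ty * (-1) ^ (x * y) * (-1) ^ k)"
    unfolding pref_def s t i_powi_diff sign_triangle_add_double[of "x + y" k]
      sign_triangle_add[of x y] Tx_def Ty_def ..
  have "pref (x + k) (y + k) * ((-1) ^ (x * y) * (-1) ^ y * phase x * phase y)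
      = (Tx * Tx) * (Ty * Ty) * ((-1) ^ (x * y) * (-1) ^ (x * y)) * (-1) ^ k *
        (\<i> ^ x * (- 2 * \<i>) ^ x) * ((- \<i>) ^ y * (-1) ^ y * (- 2 * \<i>) ^ y)"
    unfolding p phase_def Tx_def[symmetric] Ty_def[symmetric] by (simp only: mult_ac)
  also have "\<i> ^ x * (- 2 * \<i>) ^ x = 2 ^ x"
    unfolding power_mult_distrib[symmetric] by (simp add: algebra_simps)
  also have "(- \<i>) ^ y * (-1) ^ y * (- 2 * \<i>) ^ y = 2 ^ y"
    unfolding power_mult_distrib[symmetric] by (simp add: algebra_simps)
  finally show ?thesis unfolding sq by (simp add: power_add)
qed

section \<open>Decomposition into blocks\<close>

context diagonal_pair
begin

definition blocks :: "nat \<Rightarrow> nat \<Rightarrow> (nat set \<times> nat set) set" where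
  "blocks p q = {(X, Y). X \<subseteq> {..<n} \<and> Y \<subseteq> {..<n} \<and> X \<inter> Y = {} \<and>
     (\<exists>k. card X + k = p \<and> card Y + k = q)}"

definition cores :: "nat \<Rightarrow> nat set \<times> nat set \<Rightarrow> nat set set" where
  "cores p = (\<lambda>(X, Y). {K. K \<subseteq> {..<n} - X - Y \<and> card X + card K = p})"

lemma finite_blocks: "finite (blocks p q)"
  by (rule finite_subset[of _ "Pow {..<n} \<times> Pow {..<n}"]) (auto simp: blocks_def)

lemma finite_cores: "finite (cores p B)"
  by (rule finite_subset[of _ "Pow {..<n}"]) (auto simp: cores_def split: prod.splits)

lemma sum_types:
  "(\<Sum>t\<in>types p q. f t) = (\<Sum>B\<in>blocks p q. \<Sum>K\<in>cores p B. f (fst B, snd B, K))"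
proof -
  have "(\<Sum>B\<in>blocks p q. \<Sum>K\<in>cores p B. f (fst B, snd B, K))
      = (\<Sum>(B, K)\<in>Sigma (blocks p q) (cores p). f (fst B, snd B, K))"
    by (rule sum.Sigma) (simp_all add: finite_blocks finite_cores)
  also have "\<dots> = (\<Sum>t\<in>types p q. f t)"
    by (rule sum.reindex_bij_witness[where i = "\<lambda>(X, Y, K). ((X, Y), K)" and j = "\<lambda>((X, Y), K). (X, Y, K)"])
       (auto simp: blocks_def cores_def types_def)
  finally show ?thesis by simp
qed

text \<open>The contribution of one block to \<open>Q(x, x)\<close>, up to the common factor
  \<open>vol\<close>. The summands with intersecting \<open>K\<close> and \<open>K'\<close> have
  zero Gram entry.\<close>

definition block_form :: "nat \<Rightarrow> (nat set \<times> nat set \<times> nat set \<Rightarrow> complex) \<Rightarrow> nat set \<times> nat set \<Rightarrow> complex" where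
  "block_form p y = (\<lambda>(X, Y). 2 ^ (card X + card Y) * (-1) ^ (p - card X) *
     (\<Sum>K\<in>cores p (X, Y). \<Sum>K'\<in>cores p (X, Y).
        if K \<inter> K' = {} then y (X, Y, K) * cnj (y (X, Y, K')) * of_real (e ({..<n} - X - Y - K - K')) else 0))"

lemma form_blocks:
  assumes n: "n = p + q + 2" and x: "x = (\<Sum>t\<in>types p q. cs (y t) * mon t)"
  shows "pref p q * topc n (x * cj n x * Om) = vol * (\<Sum>B\<in>blocks p q. block_form p y B)"
proof -
  let ?g = "\<lambda>t t'. y t * cnj (y t') * topc n (mon t * cj n (mon t') * Om)"
  have "x * cj n x * Om = (\<Sum>t\<in>types p q. \<Sum>t'\<in>types p q. cs (y t * cnj (y t')) * (mon t * cj n (mon t') * Om))"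
  proof -
    have "x * cj n x = (\<Sum>t\<in>types p q. \<Sum>t'\<in>types p q. cs (y t * cnj (y t')) * (mon t * cj n (mon t')))"
      unfolding x cj_sum cj_cs_mult sum_product by (simp add: cs_simps mult.assoc)
    then show ?thesis by (simp add: sum_distrib_right mult.assoc)
  qed
  then have "topc n (x * cj n x * Om) = (\<Sum>t\<in>types p q. \<Sum>t'\<in>types p q. ?g t t')" by simp
  also have "\<dots> = (\<Sum>B\<in>blocks p q. \<Sum>K\<in>cores p B. \<Sum>B'\<in>blocks p q. \<Sum>K'\<in>cores p B'.
      ?g (fst B, snd B, K) (fst B', snd B', K'))"
    unfolding sum_types ..
  also have "\<dots> = (\<Sum>B\<in>blocks p q. \<Sum>K\<in>cores p B. \<Sum>K'\<in>cores p B.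
      ?g (fst B, snd B, K) (fst B, snd B, K'))"
  proof (intro sum.cong refl)
    fix B K assume B: "B \<in> blocks p q" and K: "K \<in> cores p B"
    have mem: "(fst B, snd B, K) \<in> types p q" if "B \<in> blocks p q" "K \<in> cores p B" for B K
      using that by (auto simp: blocks_def cores_def types_def split: prod.splits)
    have "(\<Sum>K'\<in>cores p B'. ?g (fst B, snd B, K) (fst B', snd B', K')) = 0"
      if "B' \<in> blocks p q - {B}" for B'
    proof (intro sum.neutral ballI)
      fix K' assume "K' \<in> cores p B'"
      moreover have "\<not> (fst B = fst B' \<and> snd B = snd B')" using that by (auto simp: prod_eq_iff)
      ultimately show "?g (fst B, snd B, K) (fst B', snd B', K') = 0"
        using gram[OF mem[OF B K] mem[of B' K'] n] that by auto
    qed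
    then show "(\<Sum>B'\<in>blocks p q. \<Sum>K'\<in>cores p B'. ?g (fst B, snd B, K) (fst B', snd B', K'))
        = (\<Sum>K'\<in>cores p B. ?g (fst B, snd B, K) (fst B, snd B, K'))"
      by (subst sum.remove[OF finite_blocks B]) simp
  qed
  finally have 1: "topc n (x * cj n x * Om) = \<dots>" .
  show ?thesis unfolding 1 sum_distrib_left
  proof (intro sum.cong refl)
    fix B assume B: "B \<in> blocks p q"
    obtain X Y where XY: "B = (X, Y)" by (cases B)
    obtain k where k: "card X + k = p" "card Y + k = q" using B by (auto simp: blocks_def XY)
    have mem: "(X, Y, K) \<in> types p q" if "K \<in> cores p B" for K
      using that B by (auto simp: blocks_def cores_def types_def XY)
    let ?s = "(-1) ^ (card X * card Y) * (-1) ^ card Y * phase (card X) * phase (card Y)"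
    have s: "pref p q * ?s = 2 ^ (card X + card Y) * (-1) ^ (p - card X)"
      using pref_phase[of "card X" k "card Y"] by (simp flip: k)
    have "pref p q * (\<Sum>K\<in>cores p B. \<Sum>K'\<in>cores p B. ?g (X, Y, K) (X, Y, K'))
        = (\<Sum>K\<in>cores p B. \<Sum>K'\<in>cores p B. vol * ((pref p q * ?s) *
           (if K \<inter> K' = {} then y (X, Y, K) * cnj (y (X, Y, K')) * of_real (e ({..<n} - X - Y - K - K')) else 0)))"
      unfolding sum_distrib_left
      by (intro sum.cong refl, subst gram[OF mem mem n]) auto
    also have "\<dots> = vol * block_form p y B"
      unfolding s block_form_def XY by (simp add: sum_distrib_left)
    finally have "pref p q * (\<Sum>K\<in>cores p B. \<Sum>K'\<in>cores p B. ?g (X, Y, K) (X, Y, K')) = \<dots>" .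
    then show "(\<Sum>K\<in>cores p B. \<Sum>K'\<in>cores p B. pref p q * ?g (fst B, snd B, K) (fst B, snd B, K')) = vol * block_form p y B"
      by (simp add: XY sum_distrib_left)
  qed
qed

lemma block_form_top:
  assumes n: "n = p + q + 2" and B: "(X, Y) \<in> blocks p q" and X: "card X = p"
  shows "block_form p y (X, Y) = of_real (2 ^ (card X + card Y) * e ({..<n} - X - Y) * (cmod (y (X, Y, {})))\<^sup>2)"
    and "e ({..<n} - X - Y) > 0"
proof -
  have sub: "X \<subseteq> {..<n}" "Y \<subseteq> {..<n}" "X \<inter> Y = {}" "card Y = q" using B X by (auto simp: blocks_def)
  have "cores p (X, Y) = {{}}"
    unfolding cores_def using X fin_sub by auto (metis Diff_subset card_eq_0_iff equals0D fin_sub subset_trans)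
  then show "block_form p y (X, Y) = of_real (2 ^ (card X + card Y) * e ({..<n} - X - Y) * (cmod (y (X, Y, {})))\<^sup>2)"
    unfolding block_form_def of_real_mult complex_norm_square using X by (simp add: mult_ac)
  have "card ({..<n} - (X \<union> Y)) = 2"
    using sub n X fin_sub by (simp add: card_Diff_subset card_Un_disjoint)
  then have "{..<n} - X - Y \<in> pairs" by (auto simp: pairs_def set_diff_eq Un_def)
  then show "e ({..<n} - X - Y) > 0" by (rule e_pos)
qed

text \<open>Here \<open>K\<close> and \<open>K'\<close> are singletons, so their disjointness
  removes precisely the diagonal, and the coefficient at \<open>i\<close>, \<open>j\<close> is the
  discriminant of the complementary pair. This is the form treated in
  \<open>complementary_block\<close>.\<close>

lemma block_form_single:
  assumes B: "(X, Y) \<in> blocks p q" and X: "Suc (card X) = p"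
  shows "block_form p y (X, Y) = - (2 ^ (card X + card Y) * (\<Sum>i\<in>{..<n}-X-Y. \<Sum>j\<in>{..<n}-X-Y-{i}.
      of_real (e ({..<n} - X - Y - {i, j})) * (y (X, Y, {i}) * cnj (y (X, Y, {j})))))"
proof -
  let ?N = "{..<n} - X - Y"
  have cores: "cores p (X, Y) = (\<lambda>i. {i}) ` ?N"
    unfolding cores_def using X by (auto simp: card_1_singleton_iff image_iff)
  have inj: "inj_on (\<lambda>i. {i}) ?N" by (auto simp: inj_on_def)
  have p: "(-1::complex) ^ (p - card X) = -1" using X by auto
  have "(\<Sum>j\<in>?N. if {i} \<inter> {j} = {} then y (X, Y, {i}) * cnj (y (X, Y, {j})) * of_real (e (?N - {i} - {j})) else 0)
      = (\<Sum>j\<in>?N-{i}. of_real (e (?N - {i, j})) * (y (X, Y, {i}) * cnj (y (X, Y, {j}))))" for i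
  proof (rule sum.mono_neutral_cong_right)
    fix j assume "j \<in> ?N - {i}"
    then have "{i} \<inter> {j} = {}" "?N - {i} - {j} = ?N - {i, j}" by auto
    then show "(if {i} \<inter> {j} = {} then y (X, Y, {i}) * cnj (y (X, Y, {j})) * of_real (e (?N - {i} - {j})) else 0)
        = of_real (e (?N - {i, j})) * (y (X, Y, {i}) * cnj (y (X, Y, {j})))" by simp
  qed auto
  then show ?thesis unfolding block_form_def prod.case cores sum.reindex[OF inj] o_def p by simp
qed

definition trace_blocks :: "nat \<Rightarrow> nat \<Rightarrow> (nat set \<times> nat set) set" where
  "trace_blocks p q = {(X, Y). X \<subseteq> {..<n} \<and> Y \<subseteq> {..<n} \<and> X \<inter> Y = {} \<and> Suc (card X) = p \<and> Suc (card Y) = q}"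

text \<open>Realizes a linear functional of the block coefficients as the wedge product with a fixed
  form. It is thereby linear in \<open>x\<close> itself, independently of the expansion
  \<open>y\<close> chosen for \<open>x\<close>.\<close>

lemma trace_functional:
  assumes n: "n = p + q + 2" and x: "x = (\<Sum>t\<in>types p q. cs (y t) * mon t)"
    and B: "(X, Y) \<in> trace_blocks p q"
  shows "topc n (x * (\<Sum>j\<in>{..<n}-X-Y. cs (of_real (h j)) * mon (Y, X, {..<n}-X-Y-{j})))
    = (-1) ^ card Y * phase (card X) * phase (card Y) * vol * (\<Sum>j\<in>{..<n}-X-Y. of_real (h j) * y (X, Y, {j}))"
proof -
  let ?N = "{..<n} - X - Y" and ?c = "(-1) ^ card Y * phase (card X) * phase (card Y)"
  have sub: "X \<subseteq> {..<n}" "Y \<subseteq> {..<n}" "X \<inter> Y = {}" "Suc (card X) = p" "Suc (card Y) = q"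
    using B by (auto simp: trace_blocks_def)
  have "card ({..<n} - (X \<union> Y)) = 4" using sub n fin_sub by (simp add: card_Diff_subset card_Un_disjoint)
  moreover have "{..<n} - (X \<union> Y) = ?N" by auto
  ultimately have cN: "card ?N = 4" by simp
  have t': "(Y, X, ?N - {j}) \<in> types (q + 2) (p + 2)" if "j \<in> ?N" for j
  proof -
    have "card (?N - {j}) = 3" using that cN by simp
    then show ?thesis using sub by (auto simp: types_def)
  qed
  have pair: "topc n (mon t * mon (Y, X, ?N - {j})) = (if t = (X, Y, {j}) then ?c * vol else 0)"
    if t: "t \<in> types p q" and j: "j \<in> ?N" for t j
  proof -
    obtain X1 Y1 K where t1: "t = (X1, Y1, K)" by (cases t)
    have iff: "X1 = X \<and> Y1 = Y \<and> K \<inter> (?N - {j}) = {} \<longleftrightarrow> t = (X, Y, {j})"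
    proof
      assume a: "X1 = X \<and> Y1 = Y \<and> K \<inter> (?N - {j}) = {}"
      then have "K \<subseteq> {j}" "card K = 1" using t sub by (auto simp: types_def t1)
      then have "K = {j}" by (metis card.empty subset_singletonD zero_neq_one)
      then show "t = (X, Y, {j})" using a t1 by simp
    qed (use t1 in auto)
    have "mon t * mon (Y, X, ?N - {j}) = (if t = (X, Y, {j}) then cs ?c * oprod w {..<n} else 0)"
      unfolding t1 using mon_pairing[OF t[unfolded t1] t'[OF j]] n iff unfolding t1 by auto
    then show ?thesis by (simp add: vol_def)
  qed
  have "x * (\<Sum>j\<in>?N. cs (of_real (h j)) * mon (Y, X, ?N-{j}))
      = (\<Sum>j\<in>?N. \<Sum>t\<in>types p q. cs (of_real (h j) * y t) * (mon t * mon (Y, X, ?N-{j})))"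
    unfolding x by (subst sum.swap) (simp add: sum_product cs_simps mult.assoc mult.commute)
  then have "topc n (x * (\<Sum>j\<in>?N. cs (of_real (h j)) * mon (Y, X, ?N-{j})))
      = (\<Sum>j\<in>?N. \<Sum>t\<in>types p q. (of_real (h j) * y t) * topc n (mon t * mon (Y, X, ?N-{j})))"
    by simp
  also have "\<dots> = (\<Sum>j\<in>?N. of_real (h j) * y (X, Y, {j}) * (?c * vol))"
  proof (rule sum.cong[OF refl])
    fix j assume j: "j \<in> ?N"
    have m: "(X, Y, {j}) \<in> types p q" using j sub by (auto simp: types_def)
    have "(\<Sum>t\<in>types p q. (of_real (h j) * y t) * topc n (mon t * mon (Y, X, ?N-{j})))
        = (\<Sum>t\<in>types p q. if t = (X, Y, {j}) then of_real (h j) * y (X, Y, {j}) * (?c * vol) else 0)"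
      by (rule sum.cong[OF refl]) (subst pair[OF _ j], auto)
    then show "(\<Sum>t\<in>types p q. (of_real (h j) * y t) * topc n (mon t * mon (Y, X, ?N-{j})))
        = of_real (h j) * y (X, Y, {j}) * (?c * vol)" using finite_types m by (simp add: sum.delta)
  qed
  finally show ?thesis by (simp add: sum_distrib_left mult_ac)
qed

lemma phase_nonzero: "phase m \<noteq> 0" by (simp add: phase_def)

lemma positive_on_kernel:
  assumes n: "n = p + q + 2" and pq: "p \<le> 1 \<or> q \<le> 1"
  shows "\<exists>H. \<forall>x\<in>V n (int p) (int q). (\<forall>B\<in>trace_blocks p q. topc n (x * H B) = 0) \<longrightarrow> x \<noteq> 0 \<longrightarrow>
     (\<exists>r>0. pref p q * topc n (x * cj n x * Om) = vphase n * of_real r)"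
proof -
  let ?N = "\<lambda>X Y. {..<n} - X - Y"
  let ?neg = "\<lambda>N h. \<forall>y::nat \<Rightarrow> complex. (\<Sum>j\<in>N. of_real (h j) * y j) = 0 \<longrightarrow> (\<exists>j\<in>N. y j \<noteq> 0) \<longrightarrow>
    (\<exists>r>0. (\<Sum>i\<in>N. \<Sum>j\<in>N-{i}. of_real (e (N - {i, j})) * (y i * cnj (y j))) = - of_real r)"
  have ex: "\<exists>h::nat \<Rightarrow> real. ?neg (?N X Y) h" if B: "(X, Y) \<in> trace_blocks p q" for X Y
  proof (rule complementary_block[of _ a d c])
    have "X \<subseteq> {..<n}" "Y \<subseteq> {..<n}" "X \<inter> Y = {}" "Suc (card X) = p" "Suc (card Y) = q"
      using B by (auto simp: trace_blocks_def)
    then have "card ({..<n} - (X \<union> Y)) = 4" using n fin_sub by (simp add: card_Diff_subset card_Un_disjoint)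
    moreover have "{..<n} - (X \<union> Y) = ?N X Y" by auto
    ultimately show "card (?N X Y) = 4" by simp
  qed (use pos e_doubleton in auto)
  \<comment> \<open>The functional is fixed per block before any form is tested, so \<open>H\<close>
    depends only on the data of \<open>Om\<close>.\<close>
  define h where "h X Y = (SOME h::nat \<Rightarrow> real. ?neg (?N X Y) h)" for X Y
  have h: "?neg (?N X Y) (h X Y)" if "(X, Y) \<in> trace_blocks p q" for X Y
    unfolding h_def by (rule someI_ex[OF ex[OF that]])
  define H where "H = (\<lambda>(X, Y). \<Sum>j\<in>?N X Y. cs (of_real (h X Y j)) * mon (Y, X, ?N X Y - {j}))"
  show ?thesis
  proof (intro exI[of _ H] ballI impI)
    fix x assume xV: "x \<in> V n (int p) (int q)" and ker: "\<forall>B\<in>trace_blocks p q. topc n (x * H B) = 0" and x0: "x \<noteq> 0"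
    obtain y where x: "x = (\<Sum>t\<in>types p q. cs (y t) * mon t)" using V_expand[OF xV] .
    have block: "\<exists>r\<ge>0. block_form p y (X, Y) = of_real r \<and> ((\<exists>K\<in>cores p (X, Y). y (X, Y, K) \<noteq> 0) \<longrightarrow> r > 0)"
      if B: "(X, Y) \<in> blocks p q" for X Y
    proof -
      obtain k where k: "card X + k = p" "card Y + k = q" using B by (auto simp: blocks_def)
      \<comment> \<open>\<open>k\<close> is the common value of \<open>p - card X\<close> and
        \<open>q - card Y\<close>, hence at most the smaller of \<open>p\<close> and
        \<open>q\<close>.\<close>
      then consider "k = 0" | "k = 1" using pq by linarith
      then show ?thesis
      proof cases
        case 1
        then have cX: "card X = p" using k by simp
        have cores: "cores p (X, Y) = {{}}"
          unfolding cores_def using cX by auto (metis Diff_subset card_eq_0_iff equals0D fin_sub subset_trans)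
        note b = block_form_top[OF n B cX]
        show ?thesis unfolding b(1) cores using b(2)
          by (intro exI[of _ "2 ^ (card X + card Y) * e (?N X Y) * (cmod (y (X, Y, {})))\<^sup>2"]) auto
      next
        case 2
        then have cX: "Suc (card X) = p" and B': "(X, Y) \<in> trace_blocks p q"
          using k B by (auto simp: blocks_def trace_blocks_def)
        have "(\<Sum>j\<in>?N X Y. of_real (h X Y j) * y (X, Y, {j})) = 0"
          using trace_functional[OF n x B', of "h X Y"] ker B' vol_nonzero phase_nonzero by (auto simp: H_def)
        then have neg: "\<exists>r>0. (\<Sum>i\<in>?N X Y. \<Sum>j\<in>?N X Y-{i}.
            of_real (e (?N X Y - {i, j})) * (y (X, Y, {i}) * cnj (y (X, Y, {j})))) = - of_real r"
          if "\<exists>j\<in>?N X Y. y (X, Y, {j}) \<noteq> 0"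
          using h[OF B', rule_format, of "\<lambda>j. y (X, Y, {j})"] that by blast
        have cores: "cores p (X, Y) = (\<lambda>i. {i}) ` ?N X Y"
          unfolding cores_def using cX by (auto simp: card_1_singleton_iff image_iff)
        show ?thesis
        proof (cases "\<exists>j\<in>?N X Y. y (X, Y, {j}) \<noteq> 0")
          case True
          from neg[OF this] obtain r where "r > 0" "(\<Sum>i\<in>?N X Y. \<Sum>j\<in>?N X Y-{i}.
            of_real (e (?N X Y - {i, j})) * (y (X, Y, {i}) * cnj (y (X, Y, {j})))) = - of_real r" by blast
          then show ?thesis unfolding block_form_single[OF B cX]
            by (intro exI[of _ "2 ^ (card X + card Y) * r"]) auto
        next
          case False
          then have "block_form p y (X, Y) = 0" unfolding block_form_single[OF B cX] by simp
          then show ?thesis using False unfolding cores by (intro exI[of _ 0]) auto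
        qed
      qed
    qed
    then have "\<forall>B\<in>blocks p q. \<exists>r\<ge>0. block_form p y B = of_real r \<and> ((\<exists>K\<in>cores p B. y (fst B, snd B, K) \<noteq> 0) \<longrightarrow> r > 0)"
      by auto
    then obtain r where r: "\<And>B. B \<in> blocks p q \<Longrightarrow> r B \<ge> 0 \<and> block_form p y B = of_real (r B) \<and>
        ((\<exists>K\<in>cores p B. y (fst B, snd B, K) \<noteq> 0) \<longrightarrow> r B > 0)" by metis
    obtain B K where BK: "B \<in> blocks p q" "K \<in> cores p B" "y (fst B, snd B, K) \<noteq> 0"
    proof (rule ccontr)
      assume "\<not> thesis"
      then have "x = (\<Sum>B\<in>blocks p q. \<Sum>K\<in>cores p B. 0)"
        unfolding x sum_types using that by (intro sum.cong refl) auto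
      then show False using x0 by simp
    qed
    have "(\<Sum>B\<in>blocks p q. r B) > 0"
    proof (rule sum_pos2[OF finite_blocks BK(1)])
      show "r B > 0" using r[OF BK(1)] BK by blast
    qed (use r in blast)
    moreover have "pref p q * topc n (x * cj n x * Om) = vphase n * of_real (dsq * (\<Sum>B\<in>blocks p q. r B))"
      unfolding form_blocks[OF n x] vol_eq using r by simp
    ultimately show "\<exists>r>0. pref p q * topc n (x * cj n x * Om) = vphase n * of_real r"
      using dsq_pos by (meson mult_pos_pos)
  qed
qed

end

subsection \<open>Kaehler forms\<close>

context coframe
begin

definition om :: ext where "om = (\<Sum>k<n. w k)"

lemma coef_om: "coef om = fsum (kahler_term n A) {..<n}"
  by (simp add: om_def fsum_def fun_eq_iff flip: coef_w)

lemma om_V: "om \<in> V n 1 1"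
  unfolding om_def by (intro V_sum w_V)

lemma om_central: "om * y = y * om" by (rule V_11_central[OF om_V])

lemma cj_om: "cj n om = om" by (simp add: om_def cj_sum w_cj)

lemma kahler_om: "kahler n (coef om)"
  using inv coef_om by (auto simp: kahler_def)

lemma power_add_square_zero:
  fixes x y :: ext
  assumes "y * y = 0" "\<And>z. y * z = z * y"
  shows "(x + y) ^ Suc k = x ^ Suc k + of_nat (Suc k) * (x ^ k * y)"
proof (induction k)
  case (Suc k)
  have 1: "x ^ k * y * y = 0" using assms(1) by (simp add: mult.assoc)
  have 2: "x ^ k * y * x = x ^ Suc k * y"
    unfolding mult.assoc assms(2)[of x] power_Suc2 ..
  have "(x + y) ^ Suc (Suc k) = (x ^ Suc k + of_nat (Suc k) * (x ^ k * y)) * (x + y)"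
    unfolding power_Suc2[of _ "Suc k"] Suc ..
  also have "\<dots> = x ^ Suc k * x + of_nat (Suc k) * (x ^ k * y * x) + (x ^ Suc k * y + of_nat (Suc k) * (x ^ k * y * y))"
    by (simp only: distrib_left distrib_right mult.assoc)
  also have "\<dots> = x ^ Suc (Suc k) + (x ^ Suc k * y + of_nat (Suc k) * (x ^ Suc k * y))"
    unfolding 1 2 power_Suc2[of _ "Suc k"] by simp
  also have "\<dots> = x ^ Suc (Suc k) + of_nat (Suc (Suc k)) * (x ^ Suc k * y)"
    unfolding of_nat_Suc[of "Suc k"] distrib_right by simp
  finally show ?case .
qed simp

text \<open>Each \<open>w j\<close> is central with square zero, so adding it contributes only one
  linear term. The vanishing of the next power is proved along because it removes the other term in
  the induction step.\<close>

lemma sum_w_power: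
  assumes "finite I"
  shows "(\<Sum>k\<in>I. w k) ^ card I = of_nat (fact (card I)) * oprod w I \<and> (\<Sum>k\<in>I. w k) ^ Suc (card I) = 0"
  using assms
proof (induction I rule: finite_induct)
  case (insert j I)
  let ?s = "\<Sum>k\<in>I. w k" and ?m = "card I"
  have e: "(\<Sum>k\<in>insert j I. w k) = ?s + w j" using insert by (simp add: add.commute)
  note P = power_add_square_zero[of "w j" ?s, OF w_sq w_central]
  have "?s ^ Suc ?m = 0" and IH: "?s ^ ?m = of_nat (fact ?m) * oprod w I" using insert.IH by blast+
  then have 1: "(?s + w j) ^ Suc ?m = of_nat (Suc ?m) * (of_nat (fact ?m) * oprod w I * w j)"
    and 2: "(?s + w j) ^ Suc (Suc ?m) = 0"
    unfolding P by simp_all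
  have "oprod w I * w j = oprod w (insert j I)" using insert by (simp add: oprod_w_insert oprod_w_central)
  then have "of_nat (Suc ?m) * (of_nat (fact ?m) * oprod w I * w j) = of_nat (fact (Suc ?m)) * oprod w (insert j I)"
    by (simp only: fact_Suc of_nat_mult of_nat_id mult.assoc)
  then show ?case unfolding e using 1 2 insert by simp
qed simp

lemma cs_of_nat: "of_nat k = cs (of_nat k)"
  by (induction k) (simp_all add: cs_add)

lemma wpow_coef: "wpow (coef x) k = coef (x ^ k)"
  by (induction k) (simp_all add: wpow_def wedge_list_def times_ext.rep_eq one_ext.rep_eq)

lemma star_om: "star n (coef om) (coef x) = topc n x / vol"
proof -
  have "wpow (coef om) n {0..<2*n} = topc n (om ^ n)" by (simp add: wpow_coef topc_def)
  also have "\<dots> = of_nat (fact n) * vol"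
    using sum_w_power[of "{..<n}"] by (simp add: om_def cs_of_nat vol_def)
  finally show ?thesis by (simp add: star_def topc_def)
qed

end

section \<open>Comparison of two coframes\<close>

locale two_coframes = coframe n A + F: coframe n A' for n A A'
begin

lemma th_expand: assumes "j < n" obtains b where "th j = (\<Sum>a<n. cs (b a) * F.th a)"
proof -
  have "\<forall>i. \<exists>b. i < n \<longrightarrow> E {i} = (\<Sum>a<n. cs (b a) * F.th a)" using F.E_th by metis
  then obtain b where b: "\<And>i. i < n \<Longrightarrow> E {i} = (\<Sum>a<n. cs (b i a) * F.th a)" by metis
  have "th j = (\<Sum>i<n. \<Sum>a<n. cs (A j i * b i a) * F.th a)"
    unfolding th_def by (intro sum.cong refl) (simp add: b sum_distrib_left cs_mult_left)
  also have "\<dots> = (\<Sum>a<n. \<Sum>i<n. cs (A j i * b i a) * F.th a)" by (rule sum.swap)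
  also have "\<dots> = (\<Sum>a<n. cs (\<Sum>i<n. A j i * b i a) * F.th a)"
    by (simp add: cs_sum sum_distrib_right)
  finally show ?thesis by (rule that)
qed

text \<open>Multiplying by all \<open>w k\<close> with \<open>k \<noteq> l\<close> isolates
  \<open>h l\<close> on the right and leaves a sum of squares on the left. If all squares vanished,
  then, as \<open>th l\<close> is a combination of the \<open>F.th a\<close>, the product of all
  \<open>th k\<close> would be zero.\<close>

lemma diagonal_positive:
  assumes eq: "F.om = (\<Sum>l<n. cs (h l) * w l)" and l: "l < n"
  shows "\<exists>r>0. h l = of_real r"
proof -
  let ?X = "{..<n} - {l}"
  let ?c = "\<lambda>a. coef (F.th a * oprod th ?X) {..<n}"
  have X: "oprod w {..<n} = w l * oprod w ?X"
    using oprod_w_insert[of ?X l] l by (simp add: insert_absorb)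
  have z: "w k * oprod w ?X = 0" if "k < n" "k \<noteq> l" for k
    using oprod_w_insert[of "?X - {k}" k] that w_sq[of k]
    by (simp add: insert_absorb flip: mult.assoc)
  have "F.om * oprod w ?X = (\<Sum>k<n. cs (h k) * (w k * oprod w ?X))"
    by (simp add: eq sum_distrib_right mult.assoc)
  also have "\<dots> = (\<Sum>k<n. if k = l then cs (h l) * oprod w {..<n} else 0)"
    by (rule sum.cong) (auto simp: z X)
  finally have "F.om * oprod w ?X = cs (h l) * oprod w {..<n}" using l by (simp add: sum.delta)
  then have 1: "topc n (F.om * oprod w ?X) = h l * vol" by (simp add: vol_def)
  have sq: "topc n (F.w a * oprod w ?X) = vphase n * of_real ((cmod (?c a))\<^sup>2)" for a
    using top_square_area[of 1 n 0 "F.th a # map th (sorted_list_of_set ?X)"] th_V F.th_V l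
    unfolding oprod_w_list by (auto simp: F.w_def oprod_def)
  have "topc n (F.om * oprod w ?X) = vphase n * of_real (\<Sum>a<n. (cmod (?c a))\<^sup>2)"
    unfolding F.om_def by (simp add: sum_distrib_right sum_distrib_left sq)
  then have "vphase n * of_real (\<Sum>a<n. (cmod (?c a))\<^sup>2) = vphase n * (h l * of_real dsq)"
    using 1 by (simp add: vol_eq mult_ac)
  then have h: "h l * of_real dsq = of_real (\<Sum>a<n. (cmod (?c a))\<^sup>2)" by (simp add: vphase_nonzero)
  have pos: "(\<Sum>a<n. (cmod (?c a))\<^sup>2) > 0"
  proof (rule ccontr)
    assume "\<not> ?thesis"
    then have "(\<Sum>a<n. (cmod (?c a))\<^sup>2) = 0" by (meson linorder_neqE_linordered_idom not_less sum_nonneg zero_le_power2)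
    then have c0: "?c a = 0" if "a < n" for a using that by (simp add: sum_nonneg_eq_0_iff)
    have "F.th a * oprod th ?X = 0" if "a < n" for a
    proof -
      have "F.th a * oprod th ?X \<in> V n (int n) 0"
        using V_mult[OF F.th_V oprod_V[of th 1 0 ?X, OF th_V], of a] l by simp
      from V_top_holomorphic[OF this] show ?thesis using c0[OF that] by simp
    qed
    moreover obtain b where "th l = (\<Sum>a<n. cs (b a) * F.th a)" using th_expand[OF l] .
    ultimately have "th l * oprod th ?X = 0" by (simp add: sum_distrib_right mult.assoc)
    moreover have "{..<n} = insert l ?X" using l by auto
    ultimately have "oprod th {..<n} = 0"
      using oprod_insert[of th ?X l, OF th_homog] by simp
    then show False using oprod_th_nonzero by simp
  qed
  have "h l = of_real ((\<Sum>a<n. (cmod (?c a))\<^sup>2) / dsq)"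
    using h dsq_pos by (simp add: field_simps)
  then show ?thesis using pos dsq_pos by (meson divide_pos_pos)
qed

end

text \<open>With \<open>n = r + 4\<close>, the sign in \<open>Q\<close> for bidegree
  \<open>(r + 1, 1)\<close> uses the triangular number of \<open>r + 2\<close> and the volume phase
  that of \<open>r + 4\<close>. They differ by the odd number \<open>2r + 5\<close>; this is where
  the negativity on the Lefschetz image comes from.\<close>

lemma pref_vphase: "pref (Suc r) 1 * vphase 4 = - (2 ^ r) * vphase (r + 4)"
proof -
  have v4: "vphase 4 = 1 / 16" by (simp add: vphase_def power_divide)
  have f: "r + 4 = r + 2 + 2 * 1" by simp
  have "(-1::complex) ^ ((r + 4) * (r + 4 - 1) div 2) = (-1) ^ ((r + 2) * (r + 2 - 1) div 2) * (-1)"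
    unfolding f sign_triangle_add_double[of "r + 2" 1] by simp
  then have v: "vphase (r + 4) = (\<i> / 2) ^ (r + 4) * (-1) ^ ((r + 2) * (r + 2 - 1) div 2) * (-1)"
    by (simp only: vphase_def mult.assoc)
  have s: "Suc r + 1 = r + 2" and t: "int (Suc r) - int 1 = int r" by simp_all
  have p: "pref (Suc r) 1 = \<i> ^ r * (-1) ^ ((r + 2) * (r + 2 - 1) div 2)"
    unfolding pref_def s t power_int_of_nat ..
  have "(\<i> / 2) ^ (r + 4) = \<i> ^ r / 2 ^ r / 16" by (simp add: power_add power_divide)
  then show ?thesis unfolding v4 v p by simp
qed

text \<open>The sign \<open>(-1) ^ r\<close> arises from exchanging an \<open>r\<close>-form with
  its conjugate, and carries the case \<open>p = 1\<close> over to \<open>q = 1\<close>.\<close>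

lemma pref_swap: "pref 1 (Suc r) * (-1) ^ r = pref (Suc r) 1"
proof -
  have e: "\<i> ^ r = (- \<i>) ^ r * (-1) ^ r" by (simp flip: power_mult_distrib)
  define T :: complex where "T = (-1) ^ ((Suc r + 1) * (Suc r + 1 - 1) div 2)"
  have "pref 1 (Suc r) = \<i> * ((- \<i>) * (- \<i>) ^ r) * T" "pref (Suc r) 1 = \<i> * \<i> ^ r * (- \<i>) * T"
    unfolding pref_def i_powi_diff T_def add.commute[of 1 "Suc r"] power_Suc power_one_right by (rule refl)+
  then show ?thesis unfolding e by (simp only: mult_ac)
qed

section \<open>Negativity on the image of multiplication by \<omega>\<close>

locale kahler_setting = diagonal_pair n A a d c + two_coframes n A A'
  for n A a d c A'
begin

text \<open>The one-forms \<open>F.th i\<close> span the \<open>th j\<close>, so the hypothesis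
  yields \<open>b * oprod th N = 0\<close> for every four-element \<open>N\<close>. Taking
  \<open>N\<close> complementary to \<open>X\<close> detects the coefficient of \<open>b\<close> at
  the monomial \<open>X\<close>. Strict negativity on the Lefschetz image rests on this.\<close>

lemma vanishing:
  assumes b: "b \<in> V n (int r) 0" and n: "n = r + 4"
    and z: "\<And>i j Z. i < n \<Longrightarrow> j < n \<Longrightarrow> Z \<in> pairs \<Longrightarrow> b * (F.th i * (F.th j * oprod th Z)) = 0"
  shows "b = 0"
proof -
  obtain y where y: "b = (\<Sum>t\<in>types r 0. cs (y t) * mon t)" using V_expand[of b r 0] b by auto
  have quad: "b * oprod th N = 0" if N: "N \<subseteq> {..<n}" "card N = 4" for N
  proof -
    have fN: "finite N" using N fin_sub by blast
    obtain j where j: "j \<in> N" using N by fastforce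
    have "card (N - {j}) = 3" using N j fN by simp
    then have "N - {j} \<noteq> {}" by (intro notI) simp
    then obtain k where k: "k \<in> N - {j}" by blast
    let ?Z = "N - {j} - {k}"
    have "card ?Z = 2" using N j k fN by simp
    then have Z: "?Z \<in> pairs" using N by (auto simp: pairs_def)
    obtain s1 where s1: "oprod th N = cs s1 * (th j * oprod th (N - {j}))"
      using oprod_insert[of th "N - {j}" j, OF th_homog] fN j by (auto simp: insert_absorb)
    obtain s2 where s2: "oprod th (N - {j}) = cs s2 * (th k * oprod th ?Z)"
      using oprod_insert[of th ?Z k, OF th_homog] fN k by (auto simp: insert_absorb)
    obtain f where f: "th j = (\<Sum>i<n. cs (f i) * F.th i)" using th_expand[of j] j N by blast
    obtain g where g: "th k = (\<Sum>i<n. cs (g i) * F.th i)" using th_expand[of k] k N by blast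
    have "b * (th j * (th k * oprod th ?Z))
        = (\<Sum>i'<n. \<Sum>i<n. cs (f i * g i') * (b * (F.th i * (F.th i' * oprod th ?Z))))"
      unfolding f g by (simp add: sum_distrib_left sum_distrib_right cs_simps mult.assoc)
    also have "\<dots> = 0" by (intro sum.neutral ballI) (simp add: z[OF _ _ Z])
    finally show ?thesis unfolding s1 s2 by (simp add: cs_simps)
  qed
  have "y t = 0" if t: "t \<in> types r 0" for t
  proof -
    \<comment> \<open>In bidegree \<open>(r, 0)\<close> the sets \<open>Y\<close> and
      \<open>K\<close> are empty, and \<open>({}, X, ?N)\<close> is the unique dual type.\<close>
    obtain X Y K where t3: "t = (X, Y, K)" by (cases t)
    have Y: "Y = {}" "K = {}" and X: "X \<subseteq> {..<n}" "card X = r" using t fin_sub by (auto simp: t3 types_def)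
    let ?N = "{..<n} - X"
    have N: "?N \<subseteq> {..<n}" "card ?N = 4" using X n fin_sub by (auto simp: card_Diff_subset)
    have t': "({}, X, ?N) \<in> types 4 n" unfolding types_def using X N n by auto
    have "cs (phase (card ?N)) * oprod w ?N = oprod th ?N * oprod thb ?N"
      using oprod_th_thb[of ?N] by simp
    moreover have "phase (card ?N) \<noteq> 0" by (rule phase_nonzero)
    ultimately have "oprod w ?N = cs (1 / phase (card ?N)) * (oprod th ?N * oprod thb ?N)"
      by (metis cs_mult_left cs_1 mult_1_left nonzero_divide_eq_eq)
    then have "b * oprod w ?N = cs (1 / phase (card ?N)) * (b * oprod th ?N * oprod thb ?N)"
      by (simp add: cs_left_commute mult.assoc)
    then have "b * oprod w ?N = 0" using quad[OF N] by simp
    moreover have "b * mon ({}, X, ?N) = b * oprod w ?N * oprod thb X"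
      unfolding mon_def mult.assoc oprod_w_central[of ?N "oprod thb X"] by simp
    ultimately have "b * mon ({}, X, ?N) = 0" by simp
    then have "0 = topc n (b * mon ({}, X, ?N))" by simp
    also have "\<dots> = (\<Sum>s\<in>types r 0. y s * topc n (mon s * mon ({}, X, ?N)))"
      by (simp add: y sum_distrib_right mult.assoc)
    also have "\<dots> = (\<Sum>s\<in>types r 0. if s = t then y t * (phase (card X) * vol) else 0)"
    proof (rule sum.cong[OF refl])
      fix s assume s: "s \<in> types r 0"
      obtain X1 Y1 K1 where s3: "s = (X1, Y1, K1)" by (cases s)
      then have Y1: "Y1 = {}" "K1 = {}" using s fin_sub by (auto simp: types_def)
      have "mon s * mon ({}, X, ?N) = (if X1 = X then cs (phase (card X1) * phase 0) * oprod w {..<n} else 0)"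
        unfolding s3 using mon_pairing[OF s[unfolded s3] t'] n Y1 by simp
      then show "y s * topc n (mon s * mon ({}, X, ?N)) = (if s = t then y t * (phase (card X) * vol) else 0)"
        using Y Y1 s3 t3 by (auto simp: vol_def phase_def)
    qed
    also have "\<dots> = y t * (phase (card X) * vol)" using t finite_types by (simp add: sum.delta)
    finally show ?thesis using phase_nonzero vol_nonzero by simp
  qed
  then show ?thesis by (simp add: y)
qed

lemma square_terms_positive:
  assumes b: "b \<in> V n (int r) 0" and n: "n = r + 4" and b0: "b \<noteq> 0"
  shows "\<exists>s>0. topc n (b * cj n b * (F.om * F.om * Om)) = vphase 4 * of_real s"
proof -
  let ?c = "\<lambda>i j Z. coef (b * (F.th i * (F.th j * oprod th Z))) {..<n}"
  let ?I = "pairs \<times> {..<n} \<times> {..<n}"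
  let ?f = "\<lambda>(Z, j, i). e Z * (cmod (?c i j Z))\<^sup>2"
  have fin: "finite ?I" using finite_pairs by simp
  have sq: "topc n (b * cj n b * (F.w i * (F.w j * oprod w Z))) = vphase 4 * of_real ((cmod (?c i j Z))\<^sup>2)"
    if "Z \<in> pairs" for i j Z
  proof -
    let ?us = "F.th i # F.th j # map th (sorted_list_of_set Z)"
    have len: "length ?us = 4" using that by (simp add: pairs_def)
    have "prod_list (map (area n) ?us) = F.w i * (F.w j * oprod w Z)"
      by (simp add: F.w_def oprod_w_list)
    moreover have "prod_list ?us = F.th i * (F.th j * oprod th Z)" by (simp add: oprod_def)
    moreover have "set ?us \<subseteq> V n 1 0" using th_V F.th_V by auto
    ultimately show ?thesis using top_square_area[OF b, of ?us] n len by simp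
  qed
  have "b * cj n b * (F.om * F.om * Om) =
      (\<Sum>Z\<in>pairs. \<Sum>j<n. \<Sum>i<n. cs (of_real (e Z)) * (b * cj n b * (F.w i * (F.w j * oprod w Z))))"
    unfolding F.om_def Om_pairs by (simp add: sum_product sum_distrib_left sum_distrib_right cs_simps mult.assoc)
  then have "topc n (b * cj n b * (F.om * F.om * Om)) =
      (\<Sum>Z\<in>pairs. \<Sum>j<n. \<Sum>i<n. of_real (e Z) * topc n (b * cj n b * (F.w i * (F.w j * oprod w Z))))" by simp
  also have "\<dots> = (\<Sum>Z\<in>pairs. \<Sum>j<n. \<Sum>i<n. vphase 4 * of_real (?f (Z, j, i)))"
    by (intro sum.cong refl) (simp add: sq)
  also have "\<dots> = vphase 4 * of_real (\<Sum>x\<in>?I. ?f x)"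
    by (simp add: sum_distrib_left sum.cartesian_product')
  finally have 1: "topc n (b * cj n b * (F.om * F.om * Om)) = vphase 4 * of_real (\<Sum>x\<in>?I. ?f x)" .
  obtain i j Z where ijZ: "i < n" "j < n" "Z \<in> pairs" "b * (F.th i * (F.th j * oprod th Z)) \<noteq> 0"
    using vanishing[OF b n] b0 by blast
  have "oprod th Z \<in> V n 2 0"
    using oprod_V[of th 1 0 Z, OF th_V] ijZ(3) fin_sub by (simp add: pairs_def)
  from V_mult[OF b V_mult[OF F.th_V V_mult[OF F.th_V this]]]
  have "b * (F.th i * (F.th j * oprod th Z)) \<in> V n (int n) 0" using n by simp
  from V_top_holomorphic[OF this] have "?c i j Z \<noteq> 0" using ijZ(4) by force
  then have "?f (Z, j, i) > 0" using e_pos[OF ijZ(3)] by simp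
  then have "(\<Sum>x\<in>?I. ?f x) > 0"
    by (intro sum_pos2[OF fin, of "(Z, j, i)"]) (use ijZ e_pos in \<open>auto simp: less_imp_le\<close>)
  then show ?thesis using 1 by blast
qed

lemma negative_on_image:
  assumes n: "n = p + q + 2" and pq: "p \<le> 1 \<or> q \<le> 1"
    and b: "b \<in> V n (int p - 1) (int q - 1)" and b0: "b \<noteq> 0"
  shows "\<exists>s>0. pref p q * topc n (F.om * b * cj n (F.om * b) * Om) = - vphase n * of_real s"
proof -
  \<comment> \<open>A nonzero \<open>b\<close> excludes \<open>p = 0\<close> and
    \<open>q = 0\<close>, since a negative bidegree gives the zero space. Then one of
    \<open>p\<close>, \<open>q\<close> is 1 and \<open>b\<close> is purely holomorphic or
    antiholomorphic.\<close>
  have "basis_sets n (int p - 1) (int q - 1) \<noteq> {}"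
    using b b0 by (auto simp: V_def supported_def intro!: ext_eqI)
  then have pos: "p > 0" "q > 0" by (auto simp: basis_sets_def)
  have "F.om * b * cj n (F.om * b) * Om = F.om * (b * (F.om * (cj n b * Om)))"
    by (simp add: cj_mult F.cj_om mult.assoc)
  also have "\<dots> = b * cj n b * (F.om * F.om * Om)"
    using F.om_central by (metis mult.assoc Om_central)
  finally have e: "F.om * b * cj n (F.om * b) * Om = b * cj n b * (F.om * F.om * Om)" .
  consider "q = 1" | "p = 1" using pq pos by linarith
  then show ?thesis
  proof cases
    case 1
    define r where "r = p - 1"
    then have r: "p = Suc r" "n = r + 4" using pos n 1 by auto
    have "b \<in> V n (int r) 0" using b r 1 by simp
    from square_terms_positive[OF this r(2) b0] obtain s where s: "s > 0"
      "topc n (b * cj n b * (F.om * F.om * Om)) = vphase 4 * of_real s" by blast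
    have "pref p q * topc n (F.om * b * cj n (F.om * b) * Om) = (pref (Suc r) 1 * vphase 4) * of_real s"
      unfolding e s(2) r(1) 1 by simp
    also have "\<dots> = - vphase n * of_real (2 ^ r * s)" unfolding pref_vphase r(2) by simp
    finally show ?thesis using s(1) by (intro exI[of _ "2 ^ r * s"]) simp
  next
    case 2
    define r where "r = q - 1"
    then have r: "q = Suc r" "n = r + 4" using pos n 2 by auto
    \<comment> \<open>For antiholomorphic \<open>b\<close> the square expansion is applied to the
      conjugate, and \<open>b * cj n b\<close> is reordered accordingly.\<close>
    have bV: "b \<in> V n 0 (int r)" using b r 2 by simp
    then have b': "cj n b \<in> V n (int r) 0" and bb: "cj n (cj n b) = b" by (auto intro: V_cj cj_cj)
    have nz: "cj n b \<noteq> 0" using bb b0 by auto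
    have "homog r b" "homog r (cj n b)" using V_homog[of b n 0 r] V_homog[of "cj n b" n r 0] bV b' by auto
    then have "b * cj n b = cs ((-1) ^ (r * r)) * (cj n b * b)" by (rule homog_commute)
    also have "(-1::complex) ^ (r * r) = (-1) ^ r" by (simp add: minus_one_power_iff)
    finally have c: "b * cj n b = cs ((-1) ^ r) * (cj n b * cj n (cj n b))" unfolding bb .
    from square_terms_positive[OF b' r(2) nz] obtain s where s: "s > 0"
      "topc n (cj n b * cj n (cj n b) * (F.om * F.om * Om)) = vphase 4 * of_real s" by blast
    have "pref p q * topc n (F.om * b * cj n (F.om * b) * Om)
        = pref 1 (Suc r) * topc n (cs ((-1) ^ r) * (cj n b * cj n (cj n b) * (F.om * F.om * Om)))"
      unfolding e c r(1) 2 by (simp only: mult.assoc)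
    also have "\<dots> = (pref 1 (Suc r) * (-1) ^ r * vphase 4) * of_real s"
      unfolding topc_simps s(2) by simp
    also have "\<dots> = - vphase n * of_real (2 ^ r * s)" unfolding pref_swap pref_vphase r(2) by simp
    finally show ?thesis using s(1) by (intro exI[of _ "2 ^ r * s"]) simp
  qed
qed

end

subsection \<open>Hodge-Riemann, hard Lefschetz and Lefschetz decomposition\<close>

context kahler_setting
begin

definition Phi :: "nat set set \<Rightarrow> (nat set \<times> nat set \<Rightarrow> ext) \<Rightarrow> ext \<Rightarrow> ext" where
  "Phi J H x = (\<Sum>S\<in>J. cs (topc n (x * H (S \<inter> {..<n}, {b. b < n \<and> n + b \<in> S}))) * E S)"

lemma trace_blocks_encode:
  assumes B: "(X, Y) \<in> trace_blocks p q"
  shows "\<exists>S\<in>basis_sets n (int p - 1) (int q - 1). S \<inter> {..<n} = X \<and> {b. b < n \<and> n + b \<in> S} = Y"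
proof -
  have sub: "X \<subseteq> {..<n}" "Y \<subseteq> {..<n}" "Suc (card X) = p" "Suc (card Y) = q"
    using B by (auto simp: trace_blocks_def)
  let ?S = "X \<union> (+) n ` Y"
  have 1: "?S \<inter> {..<n} = X" "{b. b < n \<and> n + b \<in> ?S} = Y" "?S \<inter> {n..<2*n} = (+) n ` Y"
    using sub by fastforce+
  have "card ((+) n ` Y) = card Y" by (rule card_image) simp
  then have "?S \<in> basis_sets n (int p - 1) (int q - 1)"
    using sub 1 unfolding basis_sets_def by auto
  then show ?thesis using 1 by blast
qed

context
  fixes p q :: nat
  assumes n: "n = p + q + 2" and pq: "p \<le> 1 \<or> q \<le> 1"
begin

abbreviation "Vpq' \<equiv> V n (int p) (int q)"
abbreviation "Vlow \<equiv> V n (int p - 1) (int q - 1)"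

lemma om_mult_V: "b \<in> Vlow \<Longrightarrow> F.om * b \<in> Vpq'"
  using V_mult[OF F.om_V, of b "int p - 1" "int q - 1"] by simp

lemma central_rearrange:
  "F.om * b * Om * F.om = b * (F.om * F.om * Om)"
  "x * (F.om * (y * Om)) = x * Om * F.om * y"
  "F.om * b * y * Om = b * (y * Om * F.om)"
  "F.om * b * (F.om * y) * Om = b * (F.om * F.om * Om) * y"
proof -
  have om: "u * (F.om * z) = F.om * (u * z)" and Om: "u * (Om * z) = Om * (u * z)" for u z
    using F.om_central Om_central by (metis mult.assoc)+
  \<comment> \<open>Normal form: \<open>F.om\<close> first, then \<open>Om\<close>, then the
    remaining factors. Only these instances are used, since the general rules would let
    \<open>F.om\<close> be exchanged with itself forever.\<close>
  note move = F.om_central[of b, symmetric] F.om_central[of x, symmetric] F.om_central[of y, symmetric]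
    Om_central[of b, symmetric] Om_central[of x, symmetric] Om_central[of y, symmetric] F.om_central[of Om, symmetric]
    om[of b] om[of x] om[of y] om[of Om] Om[of b] Om[of x] Om[of y]
  show "F.om * b * Om * F.om = b * (F.om * F.om * Om)"
    "x * (F.om * (y * Om)) = x * Om * F.om * y"
    "F.om * b * y * Om = b * (y * Om * F.om)"
    "F.om * b * (F.om * y) * Om = b * (F.om * F.om * Om) * y"
    by (simp_all only: mult.assoc move)
qed

lemma cross_zero:
  assumes "x * Om * F.om = 0"
  shows "x * cj n (F.om * b) * Om = 0" and "F.om * b * cj n x * Om = 0"
proof -
  have "x * cj n (F.om * b) * Om = x * (F.om * (cj n b * Om))"
    by (simp add: cj_mult F.cj_om mult.assoc)
  also have "\<dots> = x * Om * F.om * cj n b"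
    by (rule central_rearrange)
  finally show "x * cj n (F.om * b) * Om = 0" using assms by simp
  have "F.om * b * cj n x * Om = b * (cj n x * Om * F.om)"
    by (rule central_rearrange)
  also have "cj n x * Om * F.om = cj n (x * Om * F.om)" by (simp add: cj_mult cj_Om F.cj_om)
  finally show "F.om * b * cj n x * Om = 0" using assms by simp
qed

text \<open>An inertia argument: \<open>Q\<close> is positive on the kernel of \<open>Phi\<close>
  and negative on the image of \<open>F.om\<close>, and the two complement each other. A primitive
  \<open>x\<close> is orthogonal to the image, so correcting it into the kernel by an element of the
  image can only decrease \<open>Q\<close>.\<close>

lemma hodge_riemann:
  assumes x: "x \<in> Vpq'" and prim: "x * Om * F.om = 0" and x0: "x \<noteq> 0"
  shows "\<exists>r>0. pref p q * topc n (x * cj n x * Om) = vphase n * of_real r"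
proof -
  obtain H where H: "\<And>x. x \<in> Vpq' \<Longrightarrow> (\<forall>B\<in>trace_blocks p q. topc n (x * H B) = 0) \<Longrightarrow> x \<noteq> 0 \<Longrightarrow>
     \<exists>r>0. pref p q * topc n (x * cj n x * Om) = vphase n * of_real r"
    using positive_on_kernel[OF n pq] by blast
  let ?J = "basis_sets n (int p - 1) (int q - 1)"
  have coef_Phi: "coef (Phi ?J H y) S = topc n (y * H (S \<inter> {..<n}, {b. b < n \<and> n + b \<in> S}))"
    if "S \<in> ?J" for y S
  proof -
    let ?t = "\<lambda>S. topc n (y * H (S \<inter> {..<n}, {b. b < n \<and> n + b \<in> S}))"
    have "coef (Phi ?J H y) S = (\<Sum>T\<in>?J. if T = S then ?t S else 0)"
      unfolding Phi_def coef_sum coef_cs_mult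
      by (rule sum.cong) (auto simp: coef_E finite_basis_sets_mem)
    then show ?thesis using finite_basis_sets that by (simp add: sum.delta)
  qed
  have Phi0: "topc n (y * H B) = 0" if z: "Phi ?J H y = 0" and B: "B \<in> trace_blocks p q" for y B
  proof -
    obtain X Y where XY: "B = (X, Y)" by (cases B)
    from trace_blocks_encode[of X Y p q] B obtain S where S: "S \<in> ?J" "S \<inter> {..<n} = X" "{b. b < n \<and> n + b \<in> S} = Y"
      by (auto simp: XY)
    show ?thesis using coef_Phi[OF S(1), of y] by (simp add: z S XY)
  qed
  have add: "Phi ?J H (y + z) = Phi ?J H y + Phi ?J H z" for y z
    by (simp add: Phi_def distrib_right cs_add sum.distrib)
  have scale: "Phi ?J H (cs k * y) = cs k * Phi ?J H y" for k y
    by (simp add: Phi_def mult.assoc sum_distrib_left cs_mult_left)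
  have low: "Phi ?J H y \<in> supported ?J" for y
  proof -
    have "E S \<in> Vlow" if "S \<in> ?J" for S
      using that by (auto simp: V_def supported_def coef_E finite_basis_sets_mem)
    then show ?thesis unfolding Phi_def V_def[symmetric] by (intro V_sum V_cs)
  qed
  \<comment> \<open>If \<open>Phi\<close> vanished at \<open>F.om * b\<close> with
    \<open>b \<noteq> 0\<close>, then \<open>Q\<close> would be positive there by \<open>H\<close>
    and negative by \<open>negative_on_image\<close>.\<close>
  have bij: "bij_betw (\<lambda>b. Phi ?J H (F.om * b)) (supported ?J) (supported ?J)"
  proof (rule supported_linear_surj)
    fix b assume b: "b \<in> supported ?J" and z: "Phi ?J H (F.om * b) = 0"
    show "b = 0"
    proof (rule ccontr)
      assume b0: "b \<noteq> 0"
      have bV: "b \<in> Vlow" using b by (simp add: V_def)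
      obtain s where s: "s > 0" "pref p q * topc n (F.om * b * cj n (F.om * b) * Om) = - vphase n * of_real s"
        using negative_on_image[OF n pq bV b0] by blast
      then have "F.om * b \<noteq> 0" by auto
      then obtain r where "r > 0" "pref p q * topc n (F.om * b * cj n (F.om * b) * Om) = vphase n * of_real r"
        using H[OF om_mult_V[OF bV]] Phi0[OF z] by blast
      then have "vphase n * of_real r = vphase n * of_real (- s)" using s(2) by simp
      then have "r = - s" by (simp only: mult_cancel_left of_real_eq_iff vphase_nonzero simp_thms)
      then show False using \<open>r > 0\<close> s(1) by simp
    qed
  qed (simp_all add: finite_basis_sets finite_basis_sets_mem add scale low distrib_left cs_left_commute)
  have "Phi ?J H x \<in> (\<lambda>b. Phi ?J H (F.om * b)) ` supported ?J"
    using low[of x] unfolding bij_betw_imp_surj_on[OF bij] .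
  then obtain b where Pb: "Phi ?J H x = Phi ?J H (F.om * b)" and b: "b \<in> supported ?J" by (rule imageE)
  have bV: "b \<in> Vlow" using b by (simp add: V_def)
  let ?l = "F.om * b"
  note cz = cross_zero[OF prim, of b]
  have Ql: "\<exists>s\<ge>0. pref p q * topc n (?l * cj n ?l * Om) = - vphase n * of_real s \<and> (b \<noteq> 0 \<longrightarrow> s > 0)"
  proof (cases "b = 0")
    case False
    then show ?thesis using negative_on_image[OF n pq bV] by (meson less_imp_le)
  qed (auto intro: exI[of _ 0])
  then obtain s where s: "s \<ge> 0" "pref p q * topc n (?l * cj n ?l * Om) = - vphase n * of_real s" "b \<noteq> 0 \<Longrightarrow> s > 0"
    by blast
  have cjd: "cj n (x - ?l) = cj n x - cj n ?l"
    using cj_add[of n "x - ?l" ?l] by (simp add: algebra_simps)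
  have split: "(x - ?l) * cj n (x - ?l) * Om = x * cj n x * Om + ?l * cj n ?l * Om"
    unfolding cjd left_diff_distrib right_diff_distrib cz by (simp add: mult.assoc)
  \<comment> \<open>If \<open>x\<close> equalled \<open>F.om * b\<close>, it would be orthogonal to
    itself by \<open>cz\<close>, which by strict negativity on the image forces \<open>b = 0\<close>
    and \<open>x = 0\<close>.\<close>
  have diff: "x - ?l \<noteq> 0"
  proof
    assume "x - ?l = 0"
    then have "x = ?l" by simp
    then have "?l * cj n ?l * Om = 0" using cz by simp
    then have "s = 0" using s(2) by simp
    then have "b = 0" using s(3) by auto
    then show False using \<open>x = ?l\<close> x0 by simp
  qed
  have "Phi ?J H (x - ?l) = 0" using add[of "x - ?l" ?l] Pb by simp
  then obtain r where r: "r > 0"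
     "pref p q * topc n ((x - ?l) * cj n (x - ?l) * Om) = vphase n * of_real r"
    using H[OF V_diff[OF x om_mult_V[OF bV]]] Phi0 diff by blast
  have "pref p q * topc n (x * cj n x * Om) = vphase n * of_real (r + s)"
    using r(2) s(2) unfolding split topc_simps by (simp add: algebra_simps)
  then show ?thesis using r(1) s(1) by (meson add_pos_nonneg)
qed

text \<open>An element killed by \<open>Om\<close> is in particular primitive and satisfies
  \<open>Q(x, x) = 0\<close>, so it is zero by \<open>hodge_riemann\<close>.\<close>

lemma hard_lefschetz: "bij_betw (\<lambda>x. x * Om) Vpq' (V n (int n - int q) (int n - int p))"
  unfolding V_def
proof (rule supported_linear_surj)
  show "x * Om \<in> supported (basis_sets n (int n - int q) (int n - int p))"
    if "x \<in> supported (basis_sets n (int p) (int q))" for x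
    using V_mult[OF _ Om_V, of x "int p" "int q"] that n by (simp add: V_def algebra_simps)
  show "x = 0" if x: "x \<in> supported (basis_sets n (int p) (int q))" and z: "x * Om = 0" for x
  proof (rule ccontr)
    assume "x \<noteq> 0"
    then obtain r where "r > 0" "pref p q * topc n (x * cj n x * Om) = vphase n * of_real r"
      using hodge_riemann[of x] x z by (auto simp: V_def)
    moreover have "x * cj n x * Om = x * Om * cj n x" by (simp add: mult.assoc Om_central)
    ultimately show False using z by simp
  qed
qed (simp_all add: finite_basis_sets finite_basis_sets_mem basis_sets_complement[of n "int p" "int q"]
    distrib_right mult.assoc)

text \<open>Multiplying the kernel condition by \<open>cj n x\<close> gives \<open>Q = 0\<close> at
  \<open>F.om * x\<close>, contradicting strict negativity on the image. This map provides both the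
  existence and the uniqueness of the Lefschetz component.\<close>

lemma lefschetz_bij: "bij_betw (\<lambda>b. b * (F.om * F.om * Om)) Vlow (V n (int n - (int q - 1)) (int n - (int p - 1)))"
  unfolding V_def
proof (rule supported_linear_surj)
  show "x * (F.om * F.om * Om) \<in> supported (basis_sets n (int n - (int q - 1)) (int n - (int p - 1)))"
    if "x \<in> supported (basis_sets n (int p - 1) (int q - 1))" for x
    using V_mult[OF _ V_mult[OF V_mult[OF F.om_V F.om_V] Om_V], of x "int p - 1" "int q - 1"] that n
    by (simp add: V_def algebra_simps)
  show "x = 0" if x: "x \<in> supported (basis_sets n (int p - 1) (int q - 1))"
    and z: "x * (F.om * F.om * Om) = 0" for x
  proof (rule ccontr)
    assume "x \<noteq> 0"
    then obtain s where "s > 0" "pref p q * topc n (F.om * x * cj n (F.om * x) * Om) = - vphase n * of_real s"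
      using negative_on_image[OF n pq, of x] x by (auto simp: V_def)
    moreover have "F.om * x * cj n (F.om * x) * Om = x * (F.om * F.om * Om) * cj n x"
      unfolding cj_mult F.cj_om by (rule central_rearrange)
    ultimately show False using z by simp
  qed
qed (simp_all add: finite_basis_sets finite_basis_sets_mem
    basis_sets_complement[of n "int p - 1" "int q - 1"] distrib_right mult.assoc)

text \<open>\<open>b\<close> is the preimage of \<open>x * Om * F.om\<close> under the bijection
  \<open>lefschetz_bij\<close>.\<close>

lemma lefschetz_decomposition:
  assumes x: "x \<in> Vpq'"
  shows "\<exists>b\<in>Vlow. (x - F.om * b) * Om * F.om = 0"
proof -
  have "x * Om * F.om \<in> V n (int p + 2 + 1) (int q + 2 + 1)"
    by (intro V_mult x Om_V F.om_V)
  then have "x * Om * F.om \<in> V n (int n - (int q - 1)) (int n - (int p - 1))"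
    using n by (simp add: algebra_simps)
  then have "x * Om * F.om \<in> (\<lambda>b. b * (F.om * F.om * Om)) ` Vlow"
    unfolding bij_betw_imp_surj_on[OF lefschetz_bij] .
  then obtain b where b: "x * Om * F.om = b * (F.om * F.om * Om)" "b \<in> Vlow" by (rule imageE)
  then have "(x - F.om * b) * Om * F.om = 0"
    unfolding left_diff_distrib central_rearrange(1) by simp
  then show ?thesis using b by blast
qed

lemma image_primitive_zero:
  assumes b: "b \<in> Vlow" and prim: "F.om * b * Om * F.om = 0"
  shows "b = 0"
proof -
  have "b * (F.om * F.om * Om) = 0 * (F.om * F.om * Om)" using prim unfolding central_rearrange(1) by simp
  then show ?thesis using lefschetz_bij b unfolding bij_betw_def inj_on_def by (metis V_0)
qed

lemma coef_wedge: "wedge (coef x) (coef y) = coef (x * y)"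
  by (simp add: times_ext.rep_eq)

lemma zero_form_coef: "zero_form = coef 0"
  by (simp add: zero_ext.rep_eq)

lemma conjf_coef: "conjf n (coef x) = coef (cj n x)"
  by (simp add: cj.rep_eq)

lemma Qform_eq:
  "Qform n (coef Om) (coef F.om) p q (coef x) (coef y) = pref p q * topc n (x * cj n y * Om) / F.vol"
  unfolding Qform_def conjf_coef coef_wedge F.star_om pref_def by simp

lemma primitive_eq:
  "primitive n (coef Om) (coef F.om) p q = coef ` {x \<in> Vpq'. x * Om * F.om = 0}"
  unfolding primitive_def Vpq_eq by (auto simp: coef_wedge zero_form_coef coef_inject)

lemma lef_image_eq: "lef_image n (coef F.om) p q = coef ` (\<lambda>b. F.om * b) ` Vlow"
  unfolding lef_image_def Vpq_eq image_image coef_wedge[symmetric] by blast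

lemma HLT_Om: "HLT n (coef Om) p q"
proof -
  have coef_bij: "bij_betw coef S (coef ` S)" for S by (simp add: bij_betw_def inj_on_def coef_inject)
  have 1: "bij_betw (coef \<circ> (\<lambda>x. x * Om)) Vpq' (coef ` V n (int n - int q) (int n - int p))"
    by (rule bij_betw_trans[OF hard_lefschetz coef_bij])
  moreover have "coef \<circ> (\<lambda>x. x * Om) = (\<lambda>f. wedge f (coef Om)) \<circ> coef"
    by (simp add: fun_eq_iff coef_wedge)
  ultimately have "bij_betw (\<lambda>f. wedge f (coef Om)) (coef ` Vpq') (coef ` V n (int n - int q) (int n - int p))"
    using bij_betw_comp_iff[OF coef_bij] by metis
  then show ?thesis unfolding HLT_def Vpq_eq .
qed

lemma HRR_Om: "HRR n (coef Om) (coef F.om) p q"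
  unfolding HRR_def primitive_eq
proof (intro ballI impI)
  fix f assume "f \<in> coef ` {x \<in> Vpq'. x * Om * F.om = 0}" "f \<noteq> zero_form"
  then obtain x where x: "f = coef x" "x \<in> Vpq'" "x * Om * F.om = 0" "x \<noteq> 0"
    by (auto simp: zero_form_coef)
  obtain r where r: "r > 0" "pref p q * topc n (x * cj n x * Om) = vphase n * of_real r"
    using hodge_riemann[OF x(2-4)] by blast
  have "Qform n (coef Om) (coef F.om) p q f f = of_real (r / F.dsq)"
    unfolding x(1) Qform_eq r(2) F.vol_eq by simp
  then show "Qform n (coef Om) (coef F.om) p q f f \<in> \<real> \<and> Re (Qform n (coef Om) (coef F.om) p q f f) > 0"
    using r(1) F.dsq_pos by simp
qed

lemma LD_Om: "LD n (coef Om) (coef F.om) p q"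
  unfolding LD_def primitive_eq lef_image_eq
proof (intro conjI ballI)
  let ?P = "{x \<in> Vpq'. x * Om * F.om = 0}" and ?L = "(\<lambda>b. F.om * b) ` Vlow"
  have fadd_coef: "fadd (coef x) (coef y) = coef (x + y)" for x y by (simp add: plus_ext.rep_eq)
  show "Vpq n (int p) (int q) = {fadd f g |f g. f \<in> coef ` ?L \<and> g \<in> coef ` ?P}"
  proof
    show "Vpq n (int p) (int q) \<subseteq> {fadd f g |f g. f \<in> coef ` ?L \<and> g \<in> coef ` ?P}"
    proof
      fix f assume "f \<in> Vpq n (int p) (int q)"
      then obtain x where x: "x \<in> Vpq'" "f = coef x" using Vpq_coef by blast
      obtain b where b: "b \<in> Vlow" "(x - F.om * b) * Om * F.om = 0"
        using lefschetz_decomposition[OF x(1)] by blast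
      have "f = fadd (coef (F.om * b)) (coef (x - F.om * b))" unfolding x fadd_coef by simp
      moreover have "x - F.om * b \<in> ?P" using b x om_mult_V V_diff by blast
      ultimately show "f \<in> {fadd f g |f g. f \<in> coef ` ?L \<and> g \<in> coef ` ?P}" using b(1) by blast
    qed
    show "{fadd f g |f g. f \<in> coef ` ?L \<and> g \<in> coef ` ?P} \<subseteq> Vpq n (int p) (int q)"
      unfolding Vpq_eq using om_mult_V V_add by (auto simp: fadd_coef)
  qed
  show "coef ` ?L \<inter> coef ` ?P = {zero_form}"
  proof
    show "coef ` ?L \<inter> coef ` ?P \<subseteq> {zero_form}"
    proof
      fix f assume "f \<in> coef ` ?L \<inter> coef ` ?P"
      then obtain b where b: "b \<in> Vlow" "f = coef (F.om * b)" "F.om * b * Om * F.om = 0"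
        by (auto simp: coef_inject)
      then show "f \<in> {zero_form}" using image_primitive_zero[OF b(1,3)] by (simp add: zero_form_coef)
    qed
    have "0 \<in> ?L" by (rule image_eqI[of _ _ 0]) simp_all
    moreover have "0 \<in> ?P" by simp
    ultimately show "{zero_form} \<subseteq> coef ` ?L \<inter> coef ` ?P" unfolding zero_form_coef by blast
  qed
  fix f g assume "f \<in> coef ` ?L" "g \<in> coef ` ?P"
  then obtain b x where bx: "f = coef (F.om * b)" "g = coef x" "x * Om * F.om = 0" by blast
  show "Qform n (coef Om) (coef F.om) p q f g = 0" "Qform n (coef Om) (coef F.om) p q g f = 0"
    unfolding bx(1,2) Qform_eq cross_zero[OF bx(3)] by simp_all
qed

end

end

section \<open>From Griffiths positivity to scalar data\<close>

lemma hermitian_positive_2x2: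
  fixes b :: "nat \<Rightarrow> nat \<Rightarrow> complex"
  assumes "\<And>t u. t \<noteq> 0 \<or> u \<noteq> 0 \<Longrightarrow>
     \<exists>r>0. t * cnj t * b 0 0 + t * cnj u * b 0 1 + u * cnj t * b 1 0 + u * cnj u * b 1 1 = of_real r"
  shows "b 0 0 = of_real (Re (b 0 0)) \<and> b 1 1 = of_real (Re (b 1 1)) \<and> b 1 0 = cnj (b 0 1) \<and>
     Re (b 0 0) > 0 \<and> Re (b 1 1) > 0 \<and> (cmod (b 0 1))\<^sup>2 < Re (b 0 0) * Re (b 1 1)"
proof -
  obtain r0 where r0: "r0 > 0" "b 0 0 = of_real r0" using assms[of 1 0] by auto
  obtain r1 where r1: "r1 > 0" "b 1 1 = of_real r1" using assms[of 0 1] by auto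
  \<comment> \<open>Real values at \<open>(1, 1)\<close> and \<open>(1, \<i>)\<close> determine the
    imaginary and real parts of the off-diagonal entries against each other, which is hermitian
    symmetry.\<close>
  obtain s where s: "b 0 0 + b 0 1 + b 1 0 + b 1 1 = of_real s" using assms[of 1 1] by auto
  obtain t where t: "b 0 0 - \<i> * b 0 1 + \<i> * b 1 0 + b 1 1 = of_real t" using assms[of 1 \<i>] by auto
  have "Im (b 0 1) + Im (b 1 0) = 0" using arg_cong[OF s, of Im] r0 r1 by simp
  moreover have "Re (b 1 0) = Re (b 0 1)" using arg_cong[OF t, of Im] r0 r1 by simp
  ultimately have h: "b 1 0 = cnj (b 0 1)" by (simp add: complex_eq_iff)
  let ?z = "b 0 1"
  \<comment> \<open>This test vector completes the square: the value at it is \<open>b 0 0\<close>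
    times the determinant.\<close>
  obtain r where r: "r > 0" "(- cnj ?z) * cnj (- cnj ?z) * b 0 0 + (- cnj ?z) * cnj (of_real r0) * ?z
      + of_real r0 * cnj (- cnj ?z) * b 1 0 + of_real r0 * cnj (of_real r0) * b 1 1 = of_real r"
    using assms[of "- cnj ?z" "of_real r0"] r0 by auto
  have "of_real r = of_real r0 * (of_real (r0 * r1) - ?z * cnj ?z)"
    unfolding r(2)[symmetric] h r0(2) r1(2) by (simp add: algebra_simps)
  also have "\<dots> = of_real (r0 * (r0 * r1 - (cmod ?z)\<^sup>2))"
    by (simp only: complex_norm_square[symmetric] of_real_mult of_real_diff)
  finally have "r = r0 * (r0 * r1 - (cmod ?z)\<^sup>2)" by (simp only: of_real_eq_iff)
  then have "r0 * r1 - (cmod ?z)\<^sup>2 > 0" using r(1) r0(1) by (simp add: zero_less_mult_iff)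
  then show ?thesis using r0 r1 h by simp
qed

lemma det_forms_2: "det_forms 2 M = (\<lambda>S. wedge (M 0 0) (wedge (M 1 1) unit_form) S - wedge (M 0 1) (wedge (M 1 0) unit_form) S)"
proof -
  have "{\<sigma>. \<sigma> permutes {..<2::nat}} = {id, Transposition.transpose 0 1}"
  proof -
    have "{..<2::nat} = {0, 1}" by auto
    then show ?thesis by (auto simp: permutes_doubleton_iff)
  qed
  moreover have "id \<noteq> Transposition.transpose (0::nat) 1" by (metis id_apply transpose_apply_first zero_neq_one)
  ultimately show ?thesis
    by (simp add: det_forms_def fsum_def fscale_def wedge_list_def upt_rec sign_swap_id)
qed

text \<open>For each \<theta> the contracted form is Kaehler in some coframe and diagonal in the
  frame \<open>A\<close>, so \<open>diagonal_positive\<close> makes each of its coefficients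
  positive. Varying \<theta> shows the coefficient matrix at each index \<open>l\<close> to be
  hermitian and positive definite.\<close>

lemma diagonal_pair_exists:
  assumes g: "griffiths_positive n 2 M" and dg: "diagonalized_entries n 2 M"
  obtains A a d c where "diagonal_pair n A a d c" "det_forms 2 M = coef (diagonal_pair.Om n A a d c)"
proof -
  obtain A b where A: "invertible_mat n A"
    and M: "\<And>i j. i < 2 \<Longrightarrow> j < 2 \<Longrightarrow> M i j = fsum (\<lambda>l. fscale (b i j l) (kahler_term n A l)) {..<n}"
    using dg unfolding diagonalized_entries_def by blast
  interpret coframe n A by unfold_locales (rule A)
  have M': "M i j = coef (\<Sum>l<n. cs (b i j l) * w l)" if "i < 2" "j < 2" for i j
    unfolding M[OF that] by (simp add: fsum_def fscale_def fun_eq_iff flip: coef_w)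
  have pos: "\<exists>r>0. t * cnj t * b 0 0 l + t * cnj u * b 0 1 l + u * cnj t * b 1 0 l + u * cnj u * b 1 1 l = of_real r"
    if tu: "t \<noteq> 0 \<or> u \<noteq> 0" and l: "l < n" for t u l
  proof -
    let ?h = "\<lambda>l. t * cnj t * b 0 0 l + t * cnj u * b 0 1 l + u * cnj t * b 1 0 l + u * cnj u * b 1 1 l"
    define \<theta> where "\<theta> i = (if i = (0::nat) then t else u)" for i
    have "\<exists>i<2. \<theta> i \<noteq> 0" using tu by (auto simp: \<theta>_def intro: exI[of _ 0] exI[of _ 1])
    then have k: "kahler n (fsum (\<lambda>(i,j). fscale (\<theta> i * cnj (\<theta> j)) (M i j)) ({..<2} \<times> {..<2}))"
      using g unfolding griffiths_positive_def by blast
    have two: "{..<2::nat} = {0, 1}" by auto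
    have e: "fsum (\<lambda>(i,j). fscale (\<theta> i * cnj (\<theta> j)) (M i j)) ({..<2} \<times> {..<2}) = coef (\<Sum>l<n. cs (?h l) * w l)"
      unfolding fun_eq_iff fsum_def sum.cartesian_product[symmetric]
      by (simp add: two M' fscale_def \<theta>_def sum_distrib_left sum.distrib[symmetric] algebra_simps)
    obtain A' where A': "invertible_mat n A'" "coef (\<Sum>l<n. cs (?h l) * w l) = fsum (kahler_term n A') {..<n}"
      using k unfolding e kahler_def by blast
    interpret two_coframes n A A' by unfold_locales (rule A'(1))
    have "coef F.om = coef (\<Sum>l<n. cs (?h l) * w l)" unfolding A'(2) by (rule F.coef_om)
    then have "F.om = (\<Sum>l<n. cs (?h l) * w l)" by (simp only: coef_inject)
    from diagonal_positive[OF this l] show ?thesis .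
  qed
  define a d c where "a l = Re (b 0 0 l)" and "d l = Re (b 1 1 l)" and "c l = b 0 1 l" for l
  have H: "b 0 0 l = of_real (a l) \<and> b 1 1 l = of_real (d l) \<and> b 1 0 l = cnj (c l) \<and>
     a l > 0 \<and> d l > 0 \<and> (cmod (c l))\<^sup>2 < a l * d l" if "l < n" for l
    using hermitian_positive_2x2[of "\<lambda>i j. b i j l"] pos that by (simp add: a_def d_def c_def)
  interpret diagonal_pair n A a d c by unfold_locales (use H in blast)
  have "Om = (\<Sum>l<n. cs (b 0 0 l) * w l) * (\<Sum>l<n. cs (b 1 1 l) * w l)
      - (\<Sum>l<n. cs (b 0 1 l) * w l) * (\<Sum>l<n. cs (b 1 0 l) * w l)"
    unfolding Om_def sum_product sum_subtractf[symmetric]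
    by (intro sum.cong refl) (simp add: H[unfolded One_nat_def] c_def[unfolded One_nat_def, symmetric] cs_simps mult.assoc ext.scale_left_diff_distrib)
  then have "det_forms 2 M = coef Om"
    unfolding det_forms_2 by (simp add: M' fun_eq_iff flip: times_ext.rep_eq one_ext.rep_eq)
  then show ?thesis using that diagonal_pair_axioms by blast
qed

theorem theorem2:
  fixes n :: nat and M :: "nat \<Rightarrow> nat \<Rightarrow> form"
  assumes "n \<ge> 2"
    and "griffiths_positive n 2 M"
    and "diagonalized_entries n 2 M"
  shows "(n \<le> 5 \<longrightarrow> (\<forall>\<omega>. kahler n \<omega> \<longrightarrow> (\<forall>p q. p + q = n - 2 \<longrightarrow>
            HLT n (det_forms 2 M) p q \<and> HRR n (det_forms 2 M) \<omega> p q \<and> LD n (det_forms 2 M) \<omega> p q)))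
       \<and> (n \<ge> 6 \<longrightarrow> HLT n (det_forms 2 M) (n - 2) 0 \<and> HLT n (det_forms 2 M) (n - 3) 1
            \<and> HLT n (det_forms 2 M) 1 (n - 3) \<and> HLT n (det_forms 2 M) 0 (n - 2))"
proof -
  obtain A a d c where D: "diagonal_pair n A a d c" and det: "det_forms 2 M = coef (diagonal_pair.Om n A a d c)"
    using diagonal_pair_exists[OF assms(2,3)] .
  interpret diagonal_pair n A a d c by (rule D)
  have main: "HLT n (det_forms 2 M) p q \<and> HRR n (det_forms 2 M) \<omega> p q \<and> LD n (det_forms 2 M) \<omega> p q"
    if pq: "p + q = n - 2" "p \<le> 1 \<or> q \<le> 1" and k: "kahler n \<omega>" for p q \<omega>
  proof -
    obtain A' where A': "invertible_mat n A'" "\<omega> = fsum (kahler_term n A') {..<n}"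
      using k unfolding kahler_def by blast
    interpret kahler_setting n A a d c A' by unfold_locales (rule A'(1))
    have \<omega>: "\<omega> = coef F.om" using A'(2) F.coef_om by simp
    have n: "n = p + q + 2" using pq(1) assms(1) by simp
    show ?thesis unfolding det \<omega> using HLT_Om[OF n pq(2)] HRR_Om[OF n pq(2)] LD_Om[OF n pq(2)] by blast
  qed
  \<comment> \<open>HLT does not mention a Kaehler form, so \<open>main\<close> is applied with the
    standard one of the diagonalizing coordinates.\<close>
  have hlt: "HLT n (det_forms 2 M) p q" if "p + q = n - 2" "p \<le> 1 \<or> q \<le> 1" for p q
    using main[OF that kahler_om] by blast
  show ?thesis
  proof (intro conjI impI allI)
    fix \<omega> p q assume "n \<le> 5" "kahler n \<omega>" and s: "p + q = n - 2"
    \<comment> \<open>\<open>n \<le> 5\<close> gives \<open>p + q \<le> 3\<close>, so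
      \<open>p\<close> and \<open>q\<close> cannot both be at least 2.\<close>
    then have "p \<le> 1 \<or> q \<le> 1" by linarith
    from main[OF s this \<open>kahler n \<omega>\<close>]
    show "HLT n (det_forms 2 M) p q" "HRR n (det_forms 2 M) \<omega> p q" "LD n (det_forms 2 M) \<omega> p q" by blast+
  qed (auto intro!: hlt)
qed

end
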